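(* Let $s(n,k)$ denote the signed Stirling number of the first kind and $S(n,k)$ the Stirling number of the second kind. Set $\mathrm{H}^{\mathrm{num}}_1(t)=1$, and for $n\ge 2$ let $\mathrm{H}^{\mathrm{num}}_n(t) := \sum_{k\geq 0} \dim_{\mathbb{Q}} \mathrm{CH}^k(B_n)\cdot t^k$ be the Chow polynomial of the braid matroid $B_n$. Then: (1) For $n\ge 2$, \[ (t-1)\cdot \mathrm{H}_n^{\mathrm{num}}(t) = \sum_{k=1}^{n-1}\mathrm{H}_k^{\mathrm{num}}(t)\cdot\sum_{j=k}^{n} s(n,j)\,S(j,k)\,t^{j-k}. \] (2) Set $\chi_1=1$ and for $n\ge 2$ set $\chi_n := \dim_{\mathbb{Q}}\mathrm{CH}^\star(B_n)$. Then for $n\ge 2$, \[ \chi_n = \sum_{k=1}^{n-1} \chi_k\cdot\binom{n}{k-1}\cdot (n-k-1)!\cdot(-1)^{n-k-1}. \]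
   Context: For $n\ge 2$, the braid matroid $B_n$ is the matroid of the normal vectors of the braid arrangement $\{z_i=z_j \mid 1\le i<j\le n\}\subseteq \mathbb{C}^n/\mathbb{C}\cdot(1,\ldots,1)$; equivalently, it is the graphic matroid of the complete graph $K_n$. Its lattice of flats is the lattice of set partitions of $\{1,\ldots,n\}$. $\mathrm{CH}^\star(B_n)$ denotes the rational Chow ring of $B_n$ with respect to the maximal building set: the graded ring $\mathbb{Q}[x_F : F \text{ a nonempty flat of } B_n]$ (each $x_F$ in degree 1) modulo the relations $x_Fx_G=0$ for incomparable flats $F,G$ and $\sum_{F\ni a} x_F=0$ for each element $a$ of the ground set. It coincides with the rational Chow ring of the De Concini--Procesi wonderful compactification of the (projectivized) complement of the braid arrangement with respect to the maximal building set. Stirling numbers: $\sum_k s(n,k)x^k = x(x-1)\cdots(x-n+1)$, and $S(n,k)$ is the number of partitions of an $n$-element set into $k$ nonempty blocks. *)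

theory Defs
  imports
    Complex_Main
    "HOL-Library.Poly_Mapping"
    "HOL-Computational_Algebra.Polynomial"
    "HOL-Combinatorics.Stirling"
    "HOL-Algebra.QuotRing"
    "HOL-Algebra.Embedded_Algebras"
begin

section \<open>Matroids and their flats\<close>

text \<open>A matroid is given by its ground set and its family of independent sets.\<close>

type_synonym 'a matroid = "'a set \<times> 'a set set"

definition ground :: "'a matroid \<Rightarrow> 'a set" where
  "ground M = fst M"

definition indep_sets :: "'a matroid \<Rightarrow> 'a set set" where
  "indep_sets M = snd M"

definition matroid_rank :: "'a matroid \<Rightarrow> 'a set \<Rightarrow> nat" where
  "matroid_rank M X = Max (card ` {I \<in> indep_sets M. I \<subseteq> X})"

definition flats :: "'a matroid \<Rightarrow> 'a set set" where
  "flats M = {F. F \<subseteq> ground M \<and>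
     (\<forall>e \<in> ground M - F. matroid_rank M F < matroid_rank M (insert e F))}"

definition nonempty_flats :: "'a matroid \<Rightarrow> 'a set set" where
  "nonempty_flats M = flats M - {{}}"


section \<open>The braid matroid\<close>

text \<open>Linear functionals in the coordinates \<open>z\<^sub>1, z\<^sub>2, \<dots>\<close>, written as finitely supported
  coefficient vectors. The functionals on the quotient of \<open>\<complex>\<^sup>n\<close> by the line spanned by
  \<open>(1, \<dots>, 1)\<close> are those supported in \<open>{1..n}\<close> whose coefficients add up to zero.\<close>

type_synonym functional = "nat \<Rightarrow>\<^sub>0 complex"

definition scale_functional :: "complex \<Rightarrow> functional \<Rightarrow> functional" where
  "scale_functional c v = Poly_Mapping.map ((*) c) v"

text \<open>The functional \<open>z\<^sub>i - z\<^sub>j\<close>, i.e. the normal vector of the hyperplane \<open>z\<^sub>i = z\<^sub>j\<close>.\<close>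

definition braid_normal :: "nat \<Rightarrow> nat \<Rightarrow> functional" where
  "braid_normal i j = Poly_Mapping.single i 1 - Poly_Mapping.single j 1"

definition braid_normals :: "nat \<Rightarrow> functional set" where
  "braid_normals n = {braid_normal i j |i j. 1 \<le> i \<and> i < j \<and> j \<le> n}"

definition braid_matroid :: "nat \<Rightarrow> functional matroid" where
  "braid_matroid n =
     (braid_normals n,
      {I. I \<subseteq> braid_normals n \<and> \<not> module.dependent scale_functional I})"


section \<open>Polynomial rings over the rationals\<close>

text \<open>A polynomial is a finitely supported map from monomials (exponent vectors) to
  coefficients; the product of this type is the usual convolution product.\<close>

type_synonym 'v mpoly_rat = "('v \<Rightarrow>\<^sub>0 nat) \<Rightarrow>\<^sub>0 rat"

definition mconst :: "rat \<Rightarrow> 'v mpoly_rat" where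
  "mconst c = Poly_Mapping.single 0 c"

definition mvar :: "'v \<Rightarrow> 'v mpoly_rat" where
  "mvar v = Poly_Mapping.single (Poly_Mapping.single v 1) 1"

definition mpoly_ring :: "'v set \<Rightarrow> 'v mpoly_rat ring" where
  "mpoly_ring V =
     \<lparr>carrier = {p. \<forall>m \<in> Poly_Mapping.keys p. Poly_Mapping.keys m \<subseteq> V},
      monoid.mult = (*), one = 1, zero = 0, add = (+)\<rparr>"

definition monomial_degree :: "('v \<Rightarrow>\<^sub>0 nat) \<Rightarrow> nat" where
  "monomial_degree m = (\<Sum>v \<in> Poly_Mapping.keys m. Poly_Mapping.lookup m v)"

definition homogeneous :: "nat \<Rightarrow> 'v mpoly_rat \<Rightarrow> bool" where
  "homogeneous k p \<longleftrightarrow> (\<forall>m \<in> Poly_Mapping.keys p. monomial_degree m = k)"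


section \<open>The Chow ring of a matroid with respect to the maximal building set\<close>

definition chow_poly_ring :: "'a matroid \<Rightarrow> 'a set mpoly_rat ring" where
  "chow_poly_ring M = mpoly_ring (nonempty_flats M)"

definition chow_relations :: "'a matroid \<Rightarrow> 'a set mpoly_rat set" where
  "chow_relations M =
     {mvar F * mvar G |F G. F \<in> nonempty_flats M \<and> G \<in> nonempty_flats M \<and>
        \<not> F \<subseteq> G \<and> \<not> G \<subseteq> F} \<union>
     {(\<Sum>F \<in> {F \<in> nonempty_flats M. a \<in> F}. mvar F) |a. a \<in> ground M}"

definition chow_ideal :: "'a matroid \<Rightarrow> 'a set mpoly_rat set" where
  "chow_ideal M = Idl\<^bsub>chow_poly_ring M\<^esub> (chow_relations M)"

definition chow_ring :: "'a matroid \<Rightarrow> 'a set mpoly_rat set ring" where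
  "chow_ring M = chow_poly_ring M Quot chow_ideal M"

definition chow_class :: "'a matroid \<Rightarrow> 'a set mpoly_rat \<Rightarrow> 'a set mpoly_rat set" where
  "chow_class M p = chow_ideal M +>\<^bsub>chow_poly_ring M\<^esub> p"

text \<open>The copy of the rationals in the Chow ring; dimensions are taken over it.\<close>

definition chow_scalars :: "'a matroid \<Rightarrow> 'a set mpoly_rat set set" where
  "chow_scalars M = range (\<lambda>c. chow_class M (mconst c))"

definition chow_graded_part :: "'a matroid \<Rightarrow> nat \<Rightarrow> 'a set mpoly_rat set set" where
  "chow_graded_part M k =
     chow_class M ` {p \<in> carrier (chow_poly_ring M). homogeneous k p}"

definition chow_graded_dim :: "'a matroid \<Rightarrow> nat \<Rightarrow> nat" where
  "chow_graded_dim M k = ring.dim (chow_ring M) (chow_scalars M) (chow_graded_part M k)"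

definition chow_dim :: "'a matroid \<Rightarrow> nat" where
  "chow_dim M = ring.dim (chow_ring M) (chow_scalars M) (carrier (chow_ring M))"

text \<open>The sum over all \<open>k \<ge> 0\<close>; only the finitely many nonzero graded parts contribute.\<close>

definition chow_polynomial :: "'a matroid \<Rightarrow> int poly" where
  "chow_polynomial M =
     (\<Sum>k | chow_graded_dim M k \<noteq> 0. Polynomial.monom (int (chow_graded_dim M k)) k)"


section \<open>The numerical sequences attached to braid matroids\<close>

definition H_num :: "nat \<Rightarrow> int poly" where
  "H_num n = (if n = 1 then 1 else chow_polynomial (braid_matroid n))"

definition chi :: "nat \<Rightarrow> int" where
  "chi n = (if n = 1 then 1 else int (chow_dim (braid_matroid n)))"

text \<open>The library's \<^const>\<open>stirling\<close> is unsigned; here the sign is included.\<close>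

definition signed_stirling :: "nat \<Rightarrow> nat \<Rightarrow> int" where
  "signed_stirling n k = Polynomial.coeff (\<Prod>i<n. [:- int i, 1:]) k"

end

theory Submission
  imports Defs
begin

text \<open>
  The Chow ring of a loopless matroid has the Feichtner--Yuzvinsky basis: the monomials
  \<open>x\<^sub>F\<^sub>1^a\<^sub>1 \<cdots> x\<^sub>F\<^sub>k^a\<^sub>k\<close> along chains \<open>\<emptyset> = F\<^sub>0 \<subset> F\<^sub>1 \<subset> \<cdots> \<subset> F\<^sub>k\<close> with
  \<open>0 < a\<^sub>i < rk F\<^sub>i - rk F\<^sub>i\<^sub>-\<^sub>1\<close>. They span by rewriting with \<open>x\<^sub>F (\<Sum>\<^sub>H\<^sub>\<supseteq>\<^sub>G x\<^sub>H)^(rk G - rk F) = 0\<close>.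
  They are independent because the ring arises from the ground field by adjoining the variables
  of an up-closed set of flats one flat at a time, from large to small: each step is the algebra
  of a blow-up, so that a linear functional on the new ring can be prescribed freely by
  functionals on the old ring and on the ring of the contraction.

  Splitting a chain at its first flat gives
  \<open>(t - 1) H\<^sub>n = (t - 1) + \<Sum>\<^sub>k\<^sub><\<^sub>n S(n,k) (t^(n-k) - t) H\<^sub>k\<close> for the braid matroids. The inversion
  of Stirling numbers turns this into (1), and (2) is the derivative of (1) at \<open>t = 1\<close>.
\<close>

section \<open>Stirling numbers\<close>

text \<open>No intermediate quotient ring is built: a functional on a quotient is one on a fixed
  polynomial ring that kills all multiples of the relations. Prescribing its values on all basis
  monomials gives independence. Adjoining \<open>x_F\<close> over a flat \<open>F0\<close> adds the
  equation \<open>(x_F + y)^c = 0\<close>, with \<open>y\<close> the sum of the variables above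
  \<open>F\<close> and \<open>c = r F - r F0\<close>, and \<open>x_F\<close> times the relations of
  the contraction by \<open>F\<close>. Exponent 0 of \<open>x_F\<close> carries a functional on the
  old ring, each exponent \<open>0 < i < c\<close> one on the contraction, and the equation forces
  the rest. The obstacle is consistency: forced values must respect both kinds of relations, and
  they reach exponent 0 only with a factor \<open>y^c\<close>. As contractions occur, the induction
  ranges over pairs of a flat and an up-closed set above it.

  The recursion closes on braid matroids because the flats above one with \<open>k\<close> blocks
  are the partitions of its set of blocks. Its left side is minus the missing term
  \<open>k = n\<close> of its sum; this makes it a relation to which inversion applies, and
  \<open>sum_j s(n,j) = 0\<close> removes the stray \<open>t - 1\<close>.\<close>

lemma signed_stirling_0: "signed_stirling 0 k = (if k = 0 then 1 else 0)"
  by (simp add: signed_stirling_def)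

lemma signed_stirling_Suc_0: "signed_stirling (Suc n) 0 = - int n * signed_stirling n 0"
  by (simp add: signed_stirling_def mult.commute)

lemma signed_stirling_Suc_Suc:
  "signed_stirling (Suc n) (Suc k) = signed_stirling n k - int n * signed_stirling n (Suc k)"
proof -
  have "(\<Prod>i<Suc n. [:- int i, 1:]) = (\<Prod>i<n. [:- int i, 1:]) * [:- int n, 1:]"
    by simp
  then show ?thesis
    by (simp add: signed_stirling_def algebra_simps)
qed

lemma signed_stirling_less: "n < k \<Longrightarrow> signed_stirling n k = 0"
proof (induction n arbitrary: k)
  case (Suc n)
  then show ?case by (cases k) (auto simp: signed_stirling_Suc_Suc)
qed (simp add: signed_stirling_0)

lemma signed_stirling_same: "signed_stirling n n = 1"
  by (induction n) (simp_all add: signed_stirling_0 signed_stirling_Suc_Suc signed_stirling_less)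

lemma Stirling_0_right: "0 < n \<Longrightarrow> Stirling n 0 = 0"
  by (cases n) auto

text \<open>This is \<open>x(x-1)...(x-n) = x(x-1)...(x-n+1) * (x-n)\<close> under the linear map
  sending \<open>x^j\<close> to \<open>f j\<close>. It turns sums against signed Stirling numbers
  into recursions in \<open>n\<close>.\<close>

lemma sum_signed_stirling_Suc:
  fixes f :: "nat \<Rightarrow> 'a::comm_ring_1"
  shows "(\<Sum>j\<le>Suc n. of_int (signed_stirling (Suc n) j) * f j) =
    (\<Sum>j\<le>n. of_int (signed_stirling n j) * (f (Suc j) - of_nat n * f j))"
proof -
  have a: "(\<Sum>j\<le>n. of_int (signed_stirling n j) * f j) =
      of_int (signed_stirling n 0) * f 0 + (\<Sum>j\<le>n. of_int (signed_stirling n (Suc j)) * f (Suc j))"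
  proof -
    have "(\<Sum>j\<le>n. of_int (signed_stirling n j) * f j) = (\<Sum>j\<le>Suc n. of_int (signed_stirling n j) * f j)"
      by (simp add: signed_stirling_less)
    then show ?thesis by (simp only: sum.atMost_Suc_shift)
  qed
  have "(\<Sum>j\<le>Suc n. of_int (signed_stirling (Suc n) j) * f j) =
     of_int (signed_stirling (Suc n) 0) * f 0 +
     (\<Sum>j\<le>n. of_int (signed_stirling (Suc n) (Suc j)) * f (Suc j))"
    by (simp only: sum.atMost_Suc_shift)
  also have "\<dots> = (\<Sum>j\<le>n. of_int (signed_stirling n j) * f (Suc j))
      - of_nat n * (of_int (signed_stirling n 0) * f 0 +
        (\<Sum>j\<le>n. of_int (signed_stirling n (Suc j)) * f (Suc j)))"
    by (simp add: signed_stirling_Suc_0 signed_stirling_Suc_Suc algebra_simps sum_subtractf sum_distrib_left)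
  also have "\<dots> = (\<Sum>j\<le>n. of_int (signed_stirling n j) * (f (Suc j) - of_nat n * f j))"
    unfolding a[symmetric] by (simp add: algebra_simps sum_subtractf sum_distrib_left)
  finally show ?thesis .
qed

lemma Stirling_Suc: "Stirling (Suc j) k = k * Stirling j k + (if k = 0 then 0 else Stirling j (k - 1))"
  by (cases k) auto

text \<open>By the recursions of both kinds, the sum \<open>D(n,k)\<close> satisfies
  \<open>D(n+1,k) = (k-n) D(n,k) + D(n,k-1)\<close>. The Kronecker delta solves this since
  \<open>k - n\<close> vanishes where \<open>D(n,k)\<close> does not.\<close>

lemma stirling_inversion:
  "(\<Sum>j\<le>n. signed_stirling n j * int (Stirling j k)) = (if n = k then 1 else 0)"
proof (induction n arbitrary: k)
  case 0
  then show ?case by (cases k) (auto simp: signed_stirling_0)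
next
  case (Suc n)
  have "(\<Sum>j\<le>Suc n. signed_stirling (Suc n) j * int (Stirling j k)) =
    (\<Sum>j\<le>n. signed_stirling n j * (int (Stirling (Suc j) k) - int n * int (Stirling j k)))"
    using sum_signed_stirling_Suc[of n "\<lambda>j. int (Stirling j k)"] by simp
  also have "\<dots> = (int k - int n) * (\<Sum>j\<le>n. signed_stirling n j * int (Stirling j k))
     + (if k = 0 then 0 else (\<Sum>j\<le>n. signed_stirling n j * int (Stirling j (k - 1))))"
    by (simp add: Stirling_Suc algebra_simps sum.distrib sum_subtractf sum_distrib_left)
  also have "\<dots> = (if Suc n = k then 1 else 0)"
    by (subst (1 2) Suc.IH) auto
  finally show ?case .
qed

text \<open>The column \<open>k = 1\<close> of the inversion, as \<open>Stirling j 1 = 1\<close> for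
  positive \<open>j\<close>.\<close>

lemma sum_signed_stirling: "2 \<le> n \<Longrightarrow> (\<Sum>j=1..n. signed_stirling n j) = 0"
proof -
  assume n: "2 \<le> n"
  have "(\<Sum>j=1..n. signed_stirling n j) = (\<Sum>j\<le>n. signed_stirling n j * int (Stirling j 1))"
  proof (intro sum.mono_neutral_cong_left)
    fix j assume "j \<in> {1..n}"
    then obtain i where "j = Suc i" by (cases j) auto
    then show "signed_stirling n j = signed_stirling n j * int (Stirling j 1)"
      using Stirling_1[of i] by (simp del: Stirling.simps)
  qed (auto simp: not_le)
  then show ?thesis using stirling_inversion[of n 1] n by simp
qed

text \<open>The weight \<open>j\<close> comes from differentiating \<open>t^(j-k)\<close>; these are
  the coefficients in the formula for the total dimension. The proof checks that the closed form
  obeys the recursion of the sums.\<close>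

lemma weighted_stirling_inversion:
  assumes "1 \<le> k" "k < n"
  shows "(\<Sum>j\<le>n. signed_stirling n j * int (Stirling j k) * int j) =
    int (n choose (k - 1)) * fact (n - k - 1) * (-1) ^ (n - k - 1)" (is "?D n k = _")
  using assms
proof (induction n arbitrary: k)
  case (Suc n)
  \<comment> \<open>The shifted weight is \<open>j + 1\<close>. Its summand 1 leaves the unweighted
    sums, and inversion evaluates them to the two delta terms.\<close>
  have rec: "?D (Suc n) k = (int k - int n) * ?D n k + ?D n (k - 1)
      + int k * (if n = k then 1 else 0) + (if n = k - 1 then 1 else 0)"
  proof -
    have "?D (Suc n) k = (\<Sum>j\<le>n. signed_stirling n j *
        (int (Stirling (Suc j) k) * int (Suc j) - int n * (int (Stirling j k) * int j)))"
      using sum_signed_stirling_Suc[of n "\<lambda>j. int (Stirling j k) * int j"] by (simp add: mult.assoc)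
    also have "\<dots> = (int k - int n) * ?D n k + ?D n (k - 1)
      + int k * (\<Sum>j\<le>n. signed_stirling n j * int (Stirling j k))
      + (\<Sum>j\<le>n. signed_stirling n j * int (Stirling j (k - 1)))"
      using Suc.prems
      by (simp add: Stirling_Suc algebra_simps sum.distrib sum_subtractf sum_distrib_left)
    finally show ?thesis by (simp only: stirling_inversion)
  qed
  have zero: "?D m 0 = 0" for m
    by (rule sum.neutral) (auto simp: Stirling_0_right intro: gr0I)
  show ?case
  proof (cases "k = n")
    \<comment> \<open>The diagonal value \<open>?D n n\<close> is outside the induction hypothesis,
      but its coefficient \<open>k - n\<close> is zero; the delta term contributes the
      \<open>n\<close> of Pascal's rule.\<close>
    case True
    show ?thesis
    proof (cases "n = 1")
      case True
      then show ?thesis using rec \<open>k = n\<close> zero[of 1] by simp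
    next
      case False
      then have n: "2 \<le> n" using Suc.prems True by simp
      have "?D n (n - 1) = int (n choose (n - 2))"
        using Suc.IH[of "n - 1"] n by (simp add: numeral_2_eq_2)
      then have "?D (Suc n) k = int (n choose (n - 2)) + int n"
        using rec n True by simp
      moreover have "Suc n choose (n - 1) = (n choose (n - 2)) + n"
      proof -
        obtain m where "n = Suc (Suc m)" using n by (metis add_2_eq_Suc le_Suc_ex)
        then show ?thesis using binomial_Suc_n[of "Suc m"] by simp
      qed
      ultimately show ?thesis using True by simp
    qed
  next
    case False
    then have k: "1 \<le> k" "k < n" using Suc.prems by auto
    have nk: "n - k = Suc (n - k - 1)" using k by simp
    have 1: "(int k - int n) * ?D n k = int (n choose (k - 1)) * fact (n - k) * (-1) ^ (n - k)"
    proof -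
      have "(fact (n - k) :: int) = (int n - int k) * fact (n - k - 1)"
        using k by (subst nk, subst fact_Suc) (simp add: of_nat_diff)
      moreover have "(-1 :: int) ^ (n - k) = - ((-1) ^ (n - k - 1))"
        by (subst nk) simp
      moreover have "(a - b) * (c * f * s) = c * ((b - a) * f) * (- s)" for a b c f s :: int
        by (simp add: algebra_simps)
      ultimately show ?thesis unfolding Suc.IH[OF k] by simp
    qed
    show ?thesis
    proof (cases "k = 1")
      case True
      then show ?thesis using rec 1 k zero[of n] by simp
    next
      case False
      then have 2: "?D n (k - 1) = int (n choose (k - 2)) * fact (n - k) * (-1) ^ (n - k)"
        using Suc.IH[of "k - 1"] k by (simp add: numeral_2_eq_2)
      have 3: "Suc n choose (k - 1) = (n choose (k - 1)) + (n choose (k - 2))"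
      proof -
        have "k = Suc (Suc (k - 2))" using k False by simp
        then obtain m where "k = Suc (Suc m)" by blast
        then show ?thesis by simp
      qed
      have ne: "(n = k) = False" "(n = k - 1) = False" "Suc n - k - 1 = n - k" using k by auto
      show ?thesis
        by (simp only: rec 1 2 3 ne if_False mult_zero_right add_0_right of_nat_add distrib_right)
    qed
  qed
qed simp

section \<open>From the recursion with Stirling numbers of the second kind to the two
  formulas\<close>

lemma of_int_poly_conv: "of_int c = [:c:]" for c :: int
  by (induction c) (auto simp: of_nat_poly one_pCons minus_pCons)

lemma pderiv_sum: "pderiv (sum f A) = (\<Sum>x\<in>A. pderiv (f x))"
  using higher_pderiv_sum[of 1] by simp

text \<open>The recursion is all that the two formulas need from the Chow rings. It is summed over
  its index against \<open>signed_stirling n\<close>.\<close>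

theorem stirling_transform:
  fixes H :: "nat \<Rightarrow> int poly"
  assumes rec: "\<And>n. 1 \<le> n \<Longrightarrow> [:-1, 1:] * H n = [:-1, 1:] +
      (\<Sum>k=1..<n. of_nat (Stirling n k) * (Polynomial.monom 1 (n - k) - Polynomial.monom 1 1) * H k)"
    and n: "2 \<le> n"
  shows "[:-1, 1:] * H n = (\<Sum>k=1..n-1. H k *
     (\<Sum>j=k..n. Polynomial.monom (signed_stirling n j * int (Stirling j k)) (j - k)))"
    and "poly (H n) 1 = (\<Sum>k=1..n-1. poly (H k) 1 * int (n choose (k - 1)) * fact (n - k - 1) * (-1) ^ (n - k - 1))"
proof -
  define t :: "int poly" where "t = Polynomial.monom 1 1"
  define C where "C k = (\<Sum>j=k..n. Polynomial.monom (signed_stirling n j * int (Stirling j k)) (j - k))" for k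
  have t1: "[:-1, 1:] = t - 1" by (simp add: t_def monom_altdef one_pCons)
  \<comment> \<open>The term \<open>k = j\<close> of this sum is \<open>(1 - t) * H j\<close>, so
    the left side of the recursion has been absorbed into the sum.\<close>
  have bal: "(t - 1) + (\<Sum>k=1..j. of_nat (Stirling j k) * (Polynomial.monom 1 (j - k) - t) * H k) = 0"
    if "1 \<le> j" for j
  proof -
    have "{1..j} = insert j {1..<j}" using that by auto
    then show ?thesis using rec[OF that] unfolding t1 t_def[symmetric]
      by (simp add: algebra_simps flip: one_pCons monom_0)
  qed
  \<comment> \<open>After the sums are exchanged, \<open>bal\<close> trades every power
    \<open>t^(j-k)\<close> for the single factor \<open>t\<close>, up to \<open>t - 1\<close>.
    Inversion then leaves only \<open>H n\<close>, and the error \<open>t - 1\<close> is multiplied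
    by a vanishing sum of Stirling numbers.\<close>
  have split: "(\<Sum>k=1..n. H k * C k) = t * H n"
  proof -
    have mon: "Polynomial.monom (a * int b) m = of_int a * (of_nat b * Polynomial.monom 1 m)" for a b m
      by (simp add: of_int_poly_conv of_nat_poly smult_monom)
    have "(\<Sum>k=1..n. H k * C k) = (\<Sum>k=1..n. \<Sum>j=1..n.
        if k \<le> j then of_int (signed_stirling n j) * (of_nat (Stirling j k) * Polynomial.monom 1 (j - k) * H k) else 0)"
      unfolding C_def
      by (intro sum.cong refl, subst sum.inter_filter[symmetric])
         (auto simp: sum_distrib_left mon mult_ac intro!: sum.cong)
    also have "\<dots> = (\<Sum>j=1..n. \<Sum>k=1..n.
        if k \<le> j then of_int (signed_stirling n j) * (of_nat (Stirling j k) * Polynomial.monom 1 (j - k) * H k) else 0)"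
      by (rule sum.swap)
    also have "\<dots> = (\<Sum>j=1..n. of_int (signed_stirling n j) * (\<Sum>k=1..j. of_nat (Stirling j k) * Polynomial.monom 1 (j - k) * H k))"
      by (intro sum.cong refl, subst sum.inter_filter[symmetric])
         (auto simp: sum_distrib_left intro!: sum.cong)
    also have "\<dots> = (\<Sum>j=1..n. of_int (signed_stirling n j) * (t * (\<Sum>k=1..j. of_nat (Stirling j k) * H k) - (t - 1)))"
    proof (intro sum.cong refl)
      fix j assume "j \<in> {1..n}"
      then have "(\<Sum>k=1..j. of_nat (Stirling j k) * Polynomial.monom 1 (j - k) * H k) =
         t * (\<Sum>k=1..j. of_nat (Stirling j k) * H k) - (t - 1)"
        using bal[of j] by (simp add: algebra_simps sum_subtractf sum_distrib_left add_eq_0_iff)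
      then show "of_int (signed_stirling n j) * (\<Sum>k=1..j. of_nat (Stirling j k) * Polynomial.monom 1 (j - k) * H k) =
        of_int (signed_stirling n j) * (t * (\<Sum>k=1..j. of_nat (Stirling j k) * H k) - (t - 1))" by simp
    qed
    also have "\<dots> = t * (\<Sum>j=1..n. of_int (signed_stirling n j) * (\<Sum>k=1..j. of_nat (Stirling j k) * H k))
        - (t - 1) * of_int (\<Sum>j=1..n. signed_stirling n j)"
      by (simp add: algebra_simps sum_subtractf sum_distrib_left sum.distrib)
    also have "(\<Sum>j=1..n. of_int (signed_stirling n j) * (\<Sum>k=1..j. of_nat (Stirling j k) * H k)) =
       (\<Sum>j=1..n. \<Sum>k=1..n. of_int (signed_stirling n j) * (of_nat (Stirling j k) * H k))"
      unfolding sum_distrib_left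
      by (intro sum.cong sum.mono_neutral_left refl) auto
    also have "\<dots> = (\<Sum>k=1..n. \<Sum>j=1..n. of_int (signed_stirling n j) * (of_nat (Stirling j k) * H k))"
      by (rule sum.swap)
    also have "\<dots> = (\<Sum>k=1..n. of_int (\<Sum>j\<le>n. signed_stirling n j * int (Stirling j k)) * H k)"
    proof (intro sum.cong refl)
      fix k assume k: "k \<in> {1..n}"
      have "(\<Sum>j\<le>n. signed_stirling n j * int (Stirling j k)) = (\<Sum>j=1..n. signed_stirling n j * int (Stirling j k))"
        using k by (intro sum.mono_neutral_right) (auto simp: not_le)
      then show "(\<Sum>j=1..n. of_int (signed_stirling n j) * (of_nat (Stirling j k) * H k)) =
         of_int (\<Sum>j\<le>n. signed_stirling n j * int (Stirling j k)) * H k"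
        by (simp add: sum_distrib_right mult.assoc)
    qed
    also have "\<dots> = H n"
      unfolding stirling_inversion using n by (simp add: if_distrib[of of_int] if_distribR if_distrib[of "\<lambda>x. x * _"] cong: if_cong)
    finally show ?thesis using sum_signed_stirling[OF n] by (simp del: of_int_sum)
  qed
  \<comment> \<open>The term \<open>k = n\<close> of \<open>split\<close> is thus \<open>H n\<close>
    itself; moving it to the other side turns \<open>t\<close> into \<open>t - 1\<close>.\<close>
  have Cn: "C n = 1"
    by (simp add: C_def signed_stirling_same one_pCons Polynomial.monom_0)
  have "{1..n} = insert n {1..n-1}" using n by auto
  then have fst: "[:-1, 1:] * H n = (\<Sum>k=1..n-1. H k * C k)"
    using split n unfolding t1 by (simp add: Cn algebra_simps)
  then show "[:-1, 1:] * H n = (\<Sum>k=1..n-1. H k *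
     (\<Sum>j=k..n. Polynomial.monom (signed_stirling n j * int (Stirling j k)) (j - k)))" by (simp add: C_def)
  have ext: "(\<Sum>j=k..n. signed_stirling n j * int (Stirling j k) * g j) =
       (\<Sum>j\<le>n. signed_stirling n j * int (Stirling j k) * g j)" for k and g :: "nat \<Rightarrow> int"
    by (rule sum.mono_neutral_left) (auto simp: not_le)
  \<comment> \<open>Because \<open>C k\<close> vanishes at 1, the product rule at 1 involves no
    derivative of \<open>H k\<close>.\<close>
  have C1: "poly (C k) 1 = 0" if "k \<in> {1..n-1}" for k
    using ext[of k "\<lambda>_. 1"] stirling_inversion[of n k] n that
    by (auto simp: C_def poly_sum poly_monom)
  have C2: "poly (pderiv (C k)) 1 = int (n choose (k - 1)) * fact (n - k - 1) * (-1) ^ (n - k - 1)"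
    if "k \<in> {1..n-1}" for k
  proof -
    have "poly (pderiv (C k)) 1 = (\<Sum>j=k..n. signed_stirling n j * int (Stirling j k) * (int j - int k))"
      by (simp add: C_def poly_sum poly_monom pderiv_sum pderiv_monom of_nat_diff mult_ac)
    also have "\<dots> = (\<Sum>j\<le>n. signed_stirling n j * int (Stirling j k) * int j)
        - int k * (\<Sum>j\<le>n. signed_stirling n j * int (Stirling j k))"
      unfolding ext by (simp add: algebra_simps sum_subtractf sum_distrib_left)
    also have "\<dots> = int (n choose (k - 1)) * fact (n - k - 1) * (-1) ^ (n - k - 1)"
      using weighted_stirling_inversion[of k n] stirling_inversion[of n k] that by auto
    finally show ?thesis .
  qed
  have "poly (pderiv ([:-1, 1:] * H n)) 1 = poly (H n) 1"
    unfolding pderiv_mult by (simp add: pderiv_pCons)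
  moreover have "poly (pderiv (\<Sum>k=1..n-1. H k * C k)) 1 =
     (\<Sum>k=1..n-1. poly (H k) 1 * (int (n choose (k - 1)) * fact (n - k - 1) * (-1) ^ (n - k - 1)))"
    unfolding pderiv_sum poly_sum pderiv_mult
    by (intro sum.cong refl) (simp add: C1 C2)
  ultimately show "poly (H n) 1 = (\<Sum>k=1..n-1. poly (H k) 1 * int (n choose (k - 1)) * fact (n - k - 1) * (-1) ^ (n - k - 1))"
    using fst by (simp add: mult.assoc)
qed

section \<open>Loopless matroids\<close>

text \<open>The rank axioms are stated for adding one element, where they can be read off from
  linear spans. \<open>rank_insert_mono\<close> is the local form of submodularity: what is spanned
  by a set is spanned by every larger one.\<close>

locale loopless_matroid =
  fixes M :: "'a matroid"
  assumes finite_ground: "finite (ground M)"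
    and rank_empty: "matroid_rank M {} = 0"
    and rank_insert_le: "\<lbrakk>X \<subseteq> ground M; e \<in> ground M\<rbrakk> \<Longrightarrow> matroid_rank M (insert e X) \<le> Suc (matroid_rank M X)"
    and rank_le_insert: "\<lbrakk>X \<subseteq> ground M; e \<in> ground M\<rbrakk> \<Longrightarrow> matroid_rank M X \<le> matroid_rank M (insert e X)"
    and rank_insert_mono: "\<lbrakk>X \<subseteq> Y; Y \<subseteq> ground M; e \<in> ground M; matroid_rank M (insert e X) = matroid_rank M X\<rbrakk>
      \<Longrightarrow> matroid_rank M (insert e Y) = matroid_rank M Y"
    and loopless: "e \<in> ground M \<Longrightarrow> matroid_rank M {e} = 1"
begin

abbreviation r :: "'a set \<Rightarrow> nat" where "r \<equiv> matroid_rank M"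

abbreviation E :: "'a set" where "E \<equiv> ground M"

definition closure :: "'a set \<Rightarrow> 'a set" where
  "closure X = {e \<in> E. r (insert e X) = r X}"

lemma closureD: "e \<in> closure X \<Longrightarrow> e \<in> E \<and> r (insert e X) = r X"
  by (simp add: closure_def)

lemma rank_mono: "X \<subseteq> Y \<Longrightarrow> Y \<subseteq> E \<Longrightarrow> r X \<le> r Y"
proof -
  assume XY: "X \<subseteq> Y" "Y \<subseteq> E"
  have "r X \<le> r (X \<union> D)" if "finite D" "D \<subseteq> E" for D
    using that
  proof (induction D rule: finite_induct)
    case (insert e D)
    then have "r (X \<union> D) \<le> r (insert e (X \<union> D))"
      using XY by (intro rank_le_insert) auto
    then show ?case using insert by simp
  qed simp
  from this[of "Y - X"] show ?thesis
    using XY finite_ground finite_subset[of "Y - X" E] by (auto simp: Un_absorb1 sup.absorb2)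
qed

lemma flats_subset: "F \<in> flats M \<Longrightarrow> F \<subseteq> E"
  by (auto simp: flats_def)

lemma finite_flats: "finite (flats M)"
  using finite_ground by (rule finite_subset[rotated, OF finite_Pow_iff[THEN iffD2]]) (auto simp: flats_def)

lemma subset_closure: "X \<subseteq> E \<Longrightarrow> X \<subseteq> closure X"
  by (auto simp: closure_def insert_absorb)

lemma closure_subset: "closure X \<subseteq> E"
  by (auto simp: closure_def)

text \<open>The elements of the closure are added one at a time; each remains spanned by the
  enlarged set, so the rank never moves.\<close>

lemma rank_closure: "X \<subseteq> E \<Longrightarrow> r (closure X) = r X"
proof -
  assume X: "X \<subseteq> E"
  have "r (X \<union> D) = r X" if "finite D" "D \<subseteq> closure X" for D
    using that
  proof (induction D rule: finite_induct)
    case (insert e D)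
    have "e \<in> closure X" "D \<subseteq> E" using insert.prems closureD by blast+
    then have "r (insert e (X \<union> D)) = r (X \<union> D)"
      using X closureD[of e X] rank_insert_mono[of X "X \<union> D" e] by blast
    then show ?case using insert.IH insert.prems by (simp add: Un_insert_right)
  qed simp
  from this[of "closure X"] show ?thesis
    using subset_closure[OF X] finite_subset[OF closure_subset finite_ground] by (simp add: sup.absorb2)
qed

lemma closure_flat: "X \<subseteq> E \<Longrightarrow> closure X \<in> flats M"
  unfolding flats_def
proof (intro CollectI conjI ballI closure_subset)
  fix e assume X: "X \<subseteq> E" and e: "e \<in> E - closure X"
  then have "r X < r (insert e X)"
    using rank_le_insert[of X e] by (auto simp: closure_def le_less)
  also have "\<dots> \<le> r (insert e (closure X))"
    using e X closure_subset subset_closure[OF X] by (intro rank_mono) auto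
  finally show "r (closure X) < r (insert e (closure X))" unfolding rank_closure[OF X] .
qed

lemma closure_least: "X \<subseteq> F \<Longrightarrow> F \<in> flats M \<Longrightarrow> closure X \<subseteq> F"
proof
  fix e assume X: "X \<subseteq> F" and F: "F \<in> flats M" and e: "e \<in> closure X"
  then have eq: "r (insert e F) = r F"
    using closureD[of e X] flats_subset[of F] rank_insert_mono[of X F e] by blast
  have "e \<in> E" using closureD e by blast
  with F eq show "e \<in> F" unfolding flats_def by (metis (mono_tags, lifting) DiffI mem_Collect_eq nat_neq_iff)
qed

lemma closure_subset_iff: "X \<subseteq> E \<Longrightarrow> F \<in> flats M \<Longrightarrow> closure X \<subseteq> F \<longleftrightarrow> X \<subseteq> F"
  using closure_least subset_closure by blast

lemma rank_strict_mono: "F \<in> flats M \<Longrightarrow> G \<in> flats M \<Longrightarrow> F \<subset> G \<Longrightarrow> r F < r G"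
proof -
  assume F: "F \<in> flats M" and G: "G \<in> flats M" and FG: "F \<subset> G"
  then obtain e where e: "e \<in> G - F" by blast
  then have "r F < r (insert e F)" using F flats_subset[OF G] by (auto simp: flats_def)
  also have "\<dots> \<le> r G" using e FG flats_subset[OF G] by (intro rank_mono) auto
  finally show ?thesis .
qed

lemma empty_flat: "{} \<in> flats M"
  by (auto simp: flats_def loopless rank_empty)

lemma rank_singleton_closure: "e \<in> E \<Longrightarrow> r (closure {e}) = 1"
  by (simp add: rank_closure loopless)

text \<open>The elements of \<open>G\<close> are added one at a time to \<open>X\<close> and to
  \<open>H\<close>. A step that raises the rank over \<open>H\<close> also raises it over the
  smaller set.\<close>

lemma rank_submodular:
  assumes "X \<subseteq> G" "X \<subseteq> H" "G \<subseteq> E" "H \<subseteq> E"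
  shows "r (G \<union> H) + r X \<le> r G + r H"
proof -
  have "r (H \<union> D) + r X \<le> r (X \<union> D) + r H" if "finite D" "D \<subseteq> E" for D
    using that
  proof (induction D rule: finite_induct)
    case (insert e D)
    have sub: "X \<union> D \<subseteq> H \<union> D" "H \<union> D \<subseteq> E" "X \<union> D \<subseteq> E" "e \<in> E" using assms insert.prems by auto
    have "r (insert e (H \<union> D)) + r (X \<union> D) \<le> r (insert e (X \<union> D)) + r (H \<union> D)"
      using rank_insert_mono[OF sub(1,2,4)] rank_le_insert[OF sub(3,4)] rank_insert_le[OF sub(2,4)]
      by linarith
    moreover have "r (H \<union> D) + r X \<le> r (X \<union> D) + r H" using insert by auto
    ultimately show ?case by simp
  qed simp
  from this[of G] show ?thesis
    using assms finite_subset[OF _ finite_ground, of G] by (simp add: Un_commute sup.absorb1)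
qed

abbreviation join :: "'a set \<Rightarrow> 'a set \<Rightarrow> 'a set" where
  "join F G \<equiv> closure (F \<union> G)"

lemma join_flat: "F \<in> flats M \<Longrightarrow> G \<in> flats M \<Longrightarrow> join F G \<in> flats M"
  by (intro closure_flat) (auto dest: flats_subset)

lemma join_subset_iff:
  "F \<in> flats M \<Longrightarrow> G \<in> flats M \<Longrightarrow> K \<in> flats M \<Longrightarrow> join F G \<subseteq> K \<longleftrightarrow> F \<subseteq> K \<and> G \<subseteq> K"
  by (subst closure_subset_iff) (auto dest: flats_subset)

lemma join_upper: "F \<in> flats M \<Longrightarrow> G \<in> flats M \<Longrightarrow> F \<subseteq> join F G \<and> G \<subseteq> join F G"
  using join_subset_iff join_flat by blast

text \<open>Rearranged, \<open>r (join G H) - r G \<le> r H - r X\<close>: passing to a join never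
  increases the exponent of a relation. This is the only use of submodularity.\<close>

lemma rank_join:
  "\<lbrakk>X \<subseteq> G; X \<subseteq> H; G \<in> flats M; H \<in> flats M\<rbrakk> \<Longrightarrow> r (join G H) + r X \<le> r G + r H"
  using rank_submodular[of X G H] by (simp add: rank_closure flats_subset)

end

section \<open>Polynomials and linear functionals on them\<close>

lemma mpoly_expand: "(\<Sum>m\<in>Poly_Mapping.keys p. Poly_Mapping.single m (Poly_Mapping.lookup p m)) = p"
  for p :: "'b \<Rightarrow>\<^sub>0 'c::comm_monoid_add"
proof (rule poly_mapping_eqI)
  fix k
  show "Poly_Mapping.lookup (\<Sum>m\<in>Poly_Mapping.keys p. Poly_Mapping.single m (Poly_Mapping.lookup p m)) k
      = Poly_Mapping.lookup p k"
    by (cases "k \<in> Poly_Mapping.keys p")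
       (auto simp: lookup_sum lookup_single when_def in_keys_iff cong: if_cong)
qed

lemma additive_of_nat_mult:
  fixes l :: "'r::semiring_1 \<Rightarrow> rat"
  assumes "\<And>a b. l (a + b) = l a + l b"
  shows "l (of_nat n * x) = of_nat n * l x"
proof (induction n)
  case 0
  then show ?case using assms[of 0 0] by simp
next
  case (Suc n)
  then show ?case by (simp add: distrib_right assms)
qed

text \<open>Killing all multiples of a relation needs checking on monomial multiples only.\<close>

lemma additive_kills_monomials:
  fixes l :: "'v mpoly_rat \<Rightarrow> rat"
  assumes l: "additive l" and "\<And>m c. l (Poly_Mapping.single m c * g) = 0"
  shows "l (s * g) = 0"
proof -
  have "s * g = (\<Sum>m\<in>Poly_Mapping.keys s. Poly_Mapping.single m (Poly_Mapping.lookup s m) * g)"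
    by (simp only: mpoly_expand flip: sum_distrib_right)
  then show ?thesis using assms(2) by (simp add: additive.sum[OF l])
qed

text \<open>A polynomial is read as one in the variable \<open>v\<close>, and \<open>L i\<close>
  acts on the coefficient of the \<open>i\<close>-th power of \<open>v\<close>. A functional on a
  polynomial ring \<open>R[v]\<close> is in this way a sequence of functionals on
  \<open>R\<close>.\<close>

definition spread :: "'v \<Rightarrow> (nat \<Rightarrow> 'v mpoly_rat \<Rightarrow> rat) \<Rightarrow> 'v mpoly_rat \<Rightarrow> rat" where
  "spread v L p = (\<Sum>m\<in>Poly_Mapping.keys p.
     L (Poly_Mapping.lookup m v)
       (Poly_Mapping.single (m - Poly_Mapping.single v (Poly_Mapping.lookup m v)) (Poly_Mapping.lookup p m)))"

lemma spread_additive: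
  assumes "\<And>i. additive (L i)"
  shows "additive (spread v L)"
proof
  fix p q :: "'a mpoly_rat"
  show "spread v L (p + q) = spread v L p + spread v L q"
    unfolding spread_def
    by (rule setsum_keys_plus_distrib)
       (auto simp: additive.zero[OF assms] additive.add[OF assms] single_add)
qed

lemma spread_single:
  assumes "\<And>i. additive (L i)"
  shows "spread v L (Poly_Mapping.single m c) =
    L (Poly_Mapping.lookup m v) (Poly_Mapping.single (m - Poly_Mapping.single v (Poly_Mapping.lookup m v)) c)"
  by (cases "c = 0") (auto simp: spread_def additive.zero[OF assms])

text \<open>A factor free of \<open>v\<close> leaves the exponent of \<open>v\<close> alone, so such
  relations can be tested on each \<open>L i\<close> separately.\<close>

lemma spread_single_mult:
  assumes L: "\<And>i. additive (L i)"
    and q: "q \<in> carrier (mpoly_ring (- {v}))"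
  shows "spread v L (Poly_Mapping.single m c * q) =
    L (Poly_Mapping.lookup m v) (Poly_Mapping.single (m - Poly_Mapping.single v (Poly_Mapping.lookup m v)) c * q)"
proof -
  note sp = spread_additive[of L v, OF L]
  have "Poly_Mapping.single m' c * q = (\<Sum>n\<in>Poly_Mapping.keys q.
     Poly_Mapping.single (m' + n) (c * Poly_Mapping.lookup q n))" for m'
    by (subst mpoly_expand[of q, symmetric]) (simp add: sum_distrib_left mult_single)
  moreover have "Poly_Mapping.lookup (m + n) v = Poly_Mapping.lookup m v"
      "m + n - Poly_Mapping.single v (Poly_Mapping.lookup m v) =
       m - Poly_Mapping.single v (Poly_Mapping.lookup m v) + n" if "n \<in> Poly_Mapping.keys q" for n
  proof -
    have "Poly_Mapping.lookup n v = 0"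
      using q that by (auto simp: mpoly_ring_def in_keys_iff)
    then show "Poly_Mapping.lookup (m + n) v = Poly_Mapping.lookup m v"
      "m + n - Poly_Mapping.single v (Poly_Mapping.lookup m v) =
       m - Poly_Mapping.single v (Poly_Mapping.lookup m v) + n"
      by (auto intro!: poly_mapping_eqI simp: lookup_add lookup_minus lookup_single when_def)
  qed
  ultimately show ?thesis
    by (simp add: additive.sum[OF sp] additive.sum[OF L] spread_single[of L, OF L])
qed

text \<open>The equation \<open>(T + y)^c = 0\<close> determines a functional on the products \<open>T^i * s\<close> from its
  values for \<open>i < c\<close>. The argument \<open>i\<close> of \<open>tower\<close> is the exponent of \<open>T\<close>.\<close>

fun tower :: "nat \<Rightarrow> 'r::comm_ring_1 \<Rightarrow> (nat \<Rightarrow> 'r \<Rightarrow> rat) \<Rightarrow> nat \<Rightarrow> 'r \<Rightarrow> rat" where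
  "tower c y l i s = (if i < c \<or> c = 0 then l i s else
     - (\<Sum>j<c. of_nat (c choose j) * tower c y l (i - c + j) (s * y ^ (c - j))))"

declare tower.simps [simp del]

lemma tower_less: "i < c \<Longrightarrow> tower c y l i s = l i s"
  by (simp add: tower.simps)

lemma tower_additive:
  assumes c: "0 < c" and l: "\<And>i. additive (l i)"
  shows "additive (tower c y l i)"
proof (induction i rule: less_induct)
  case (less i)
  show ?case
  proof
    fix a b
    show "tower c y l i (a + b) = tower c y l i a + tower c y l i b"
    proof (cases "i < c")
      case True
      then show ?thesis by (simp add: tower_less additive.add[OF l])
    next
      case False
      then have "additive (tower c y l (i - c + j))" if "j < c" for j
        using that by (intro less) auto
      then show ?thesis using False c
        by (subst (1 2 3) tower.simps)
           (simp add: additive.add distrib_right distrib_left sum.distrib)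
    qed
  qed
qed

text \<open>The binomial expansion of \<open>T^i * s * (T + y)^c\<close>, evaluated by the
  functional.\<close>

lemma tower_relation:
  assumes "0 < c"
  shows "(\<Sum>j\<le>c. of_nat (c choose j) * tower c y l (i + j) (s * y ^ (c - j))) = 0"
proof -
  have "tower c y l (i + c) s = - (\<Sum>j<c. of_nat (c choose j) * tower c y l (i + j) (s * y ^ (c - j)))"
    using assms by (subst tower.simps) simp
  then show ?thesis by (simp flip: lessThan_Suc_atMost)
qed

text \<open>Unfolding a positive exponent meets exponent 0 only at \<open>i = c\<close>,
  \<open>j = 0\<close>, where the factor is \<open>y^c\<close>. So \<open>g\<close> itself has to be
  killed at the exponents strictly between 0 and \<open>c\<close>, and only \<open>y^c * g\<close>
  at exponent 0.\<close>

lemma tower_kills: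
  assumes c: "0 < c" and l: "\<And>i s. 0 < i \<Longrightarrow> i < c \<Longrightarrow> l i (s * g) = 0"
    and l0: "\<And>s. l 0 (s * (y ^ c * g)) = 0"
  shows "0 < i \<Longrightarrow> tower c y l i (s * g) = 0"
proof (induction i arbitrary: s rule: less_induct)
  case (less i)
  show ?case
  proof (cases "i < c")
    case True
    then show ?thesis using l less by (simp add: tower_less)
  next
    case False
    have "tower c y l (i - c + j) (s * g * y ^ (c - j)) = 0" if j: "j < c" for j
    proof (cases "i - c + j = 0")
      case True
      then show ?thesis using l0[of s] c by (simp add: tower_less mult_ac)
    next
      case nz: False
      then have "tower c y l (i - c + j) (s * y ^ (c - j) * g) = 0"
        using False j by (intro less.IH) auto
      then show ?thesis by (simp add: mult_ac)
    qed
    then show ?thesis using False c by (subst tower.simps) simp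
  qed
qed

section \<open>Ideals relative to a subring\<close>

text \<open>Covers two cases: kernels of functionals, with \<open>C\<close> the whole type, and the
  Chow ideal, which is an ideal only in the subring of polynomials in the nonempty flats.\<close>

locale relative_ideal =
  fixes C I :: "'r::comm_ring_1 set"
  assumes C_one: "1 \<in> C" and C_uminus: "a \<in> C \<Longrightarrow> - a \<in> C"
    and C_add: "a \<in> C \<Longrightarrow> b \<in> C \<Longrightarrow> a + b \<in> C" and C_mult: "a \<in> C \<Longrightarrow> b \<in> C \<Longrightarrow> a * b \<in> C"
    and I_zero: "0 \<in> I" and I_add: "a \<in> I \<Longrightarrow> b \<in> I \<Longrightarrow> a + b \<in> I"
    and I_mult: "c \<in> C \<Longrightarrow> a \<in> I \<Longrightarrow> c * a \<in> I"
begin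

lemma C_zero: "0 \<in> C"
  using C_add[OF C_one C_uminus[OF C_one]] by simp

lemma C_power: "a \<in> C \<Longrightarrow> a ^ n \<in> C"
  by (induction n) (auto simp: C_one C_mult)

lemma C_sum: "(\<And>x. x \<in> A \<Longrightarrow> f x \<in> C) \<Longrightarrow> sum f A \<in> C"
  by (induction A rule: infinite_finite_induct) (auto simp: C_zero C_add)

lemma I_uminus: "a \<in> I \<Longrightarrow> - a \<in> I"
  using I_mult[OF C_uminus[OF C_one]] by simp

lemma I_diff: "a \<in> I \<Longrightarrow> b \<in> I \<Longrightarrow> a - b \<in> I"
  using I_add[OF _ I_uminus] by simp

lemma I_sum: "(\<And>x. x \<in> A \<Longrightarrow> f x \<in> I) \<Longrightarrow> sum f A \<in> I"
  by (induction A rule: infinite_finite_induct) (auto simp: I_zero I_add)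

lemma I_diff_iff: "a - b \<in> I \<Longrightarrow> a \<in> I \<longleftrightarrow> b \<in> I"
  using I_add[of "a - b" b] I_diff[of a "a - b"] by auto

text \<open>\<open>a - b\<close> divides \<open>a^n - b^n\<close>. Two elements that agree next to
  the factor \<open>x\<close> may therefore be exchanged there in every power, even if they differ
  modulo \<open>I\<close>.\<close>

lemma I_mult_power_diff:
  assumes "x * (a - b) \<in> I" "a \<in> C" "b \<in> C"
  shows "x * (a ^ n - b ^ n) \<in> I"
proof -
  have "x * (a ^ n - b ^ n) = (\<Sum>i<n. a ^ i * b ^ (n - Suc i)) * (x * (a - b))"
    using power_diff_sumr2[of a n b] by (simp add: mult_ac)
  then show ?thesis using assms by (simp add: I_mult C_sum C_mult C_power)
qed

lemma I_mult_power_iff: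
  assumes "x * (a - b) \<in> I" "a \<in> C" "b \<in> C"
  shows "x * a ^ n \<in> I \<longleftrightarrow> x * b ^ n \<in> I"
  by (rule I_diff_iff) (use I_mult_power_diff[OF assms, of n] in \<open>simp add: right_diff_distrib\<close>)

lemma I_mult_power_mono:
  assumes "x * a ^ m \<in> I" "a \<in> C" "m \<le> n"
  shows "x * a ^ n \<in> I"
proof -
  have "x * a ^ n = a ^ (n - m) * (x * a ^ m)"
    using assms(3) power_add[of a "n - m" m] by (simp add: mult_ac)
  then show ?thesis using assms by (simp add: I_mult C_power)
qed

end

lemma mpoly_ring_simps:
  "p \<in> carrier (mpoly_ring V) \<longleftrightarrow> (\<forall>m \<in> Poly_Mapping.keys p. Poly_Mapping.keys m \<subseteq> V)"
  "(\<otimes>\<^bsub>mpoly_ring V\<^esub>) = (*)" "\<one>\<^bsub>mpoly_ring V\<^esub> = 1" "\<zero>\<^bsub>mpoly_ring V\<^esub> = 0" "(\<oplus>\<^bsub>mpoly_ring V\<^esub>) = (+)"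
  by (auto simp: mpoly_ring_def)

lemma mpoly_ring_single: "Poly_Mapping.keys m \<subseteq> V \<Longrightarrow> Poly_Mapping.single m c \<in> carrier (mpoly_ring V)"
  by (auto simp: mpoly_ring_simps)

lemma mpoly_ring_mvar: "v \<in> V \<Longrightarrow> mvar v \<in> carrier (mpoly_ring V)"
  by (auto simp: mvar_def intro: mpoly_ring_single)

lemma mpoly_ring_relative_ideal:
  assumes "0 \<in> I" "\<And>a b. a \<in> I \<Longrightarrow> b \<in> I \<Longrightarrow> a + b \<in> I"
    "\<And>c a. c \<in> carrier (mpoly_ring V) \<Longrightarrow> a \<in> I \<Longrightarrow> c * a \<in> I"
  shows "relative_ideal (carrier (mpoly_ring V)) I"
proof
  fix a b :: "'a mpoly_rat"
  assume a: "a \<in> carrier (mpoly_ring V)" and b: "b \<in> carrier (mpoly_ring V)"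
  show "a + b \<in> carrier (mpoly_ring V)"
    using a b keys_add[of a b] by (auto simp: mpoly_ring_simps)
  show "a * b \<in> carrier (mpoly_ring V)"
    unfolding mpoly_ring_simps
  proof
    fix m assume "m \<in> Poly_Mapping.keys (a * b)"
    then obtain m1 m2 where "m = m1 + m2" "m1 \<in> Poly_Mapping.keys a" "m2 \<in> Poly_Mapping.keys b"
      using keys_mult[of a b] by blast
    then show "Poly_Mapping.keys m \<subseteq> V"
      using keys_add[of m1 m2] a b unfolding mpoly_ring_simps by blast
  qed
qed (use assms in \<open>auto simp: mpoly_ring_simps\<close>)

text \<open>The largest ideal on which \<open>l\<close> vanishes; \<open>l\<close> descends to the
  quotient by given relations exactly when they lie in it.\<close>

definition kernel_ideal :: "('r::comm_ring_1 \<Rightarrow> rat) \<Rightarrow> 'r set" where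
  "kernel_ideal l = {p. \<forall>s. l (s * p) = 0}"

lemma kernel_ideal: "additive l \<Longrightarrow> relative_ideal UNIV (kernel_ideal l)"
  by standard (auto simp: kernel_ideal_def distrib_left additive.add additive.zero mult.assoc[symmetric])

section \<open>The relations of a matroid\<close>

context loopless_matroid
begin

text \<open>For the closure of a single element this is the linear relation of the Chow ring; for
  larger flats its powers enter the relations.\<close>

definition upper_sum :: "'a set \<Rightarrow> 'a set mpoly_rat" where
  "upper_sum G = (\<Sum>K | K \<in> nonempty_flats M \<and> G \<subseteq> K. mvar K)"

definition above :: "'a set \<Rightarrow> 'a set set" where
  "above F = {G \<in> flats M. F \<subset> G}"

lemma finite_above: "finite (above F)"
  by (auto simp: above_def finite_flats)

lemma above_nonempty_flats: "above F \<subseteq> nonempty_flats M"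
  by (auto simp: above_def nonempty_flats_def)

lemma finite_nonempty_flats: "finite (nonempty_flats M)"
  by (simp add: nonempty_flats_def finite_flats)

lemma upper_sum_diff:
  assumes "H \<in> flats M" "G \<subseteq> H"
  shows "upper_sum G - upper_sum H = (\<Sum>K | K \<in> nonempty_flats M \<and> G \<subseteq> K \<and> \<not> H \<subseteq> K. mvar K)"
proof -
  have "{K \<in> nonempty_flats M. G \<subseteq> K} =
    {K \<in> nonempty_flats M. G \<subseteq> K \<and> \<not> H \<subseteq> K} \<union> {K \<in> nonempty_flats M. H \<subseteq> K}"
    using assms by auto
  then have "upper_sum G = (\<Sum>K | K \<in> nonempty_flats M \<and> G \<subseteq> K \<and> \<not> H \<subseteq> K. mvar K) + upper_sum H"
    unfolding upper_sum_def
    by (simp only:) (rule sum.union_disjoint, auto simp: finite_nonempty_flats)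
  then show ?thesis by simp
qed

lemma upper_sum_proper: "F \<in> nonempty_flats M \<Longrightarrow> upper_sum F = mvar F + (\<Sum>K\<in>above F. mvar K)"
proof -
  assume F: "F \<in> nonempty_flats M"
  then have "{K \<in> nonempty_flats M. F \<subseteq> K} = insert F (above F)"
    by (auto simp: above_def nonempty_flats_def)
  moreover have "F \<notin> above F" by (simp add: above_def)
  ultimately show ?thesis
    unfolding upper_sum_def by (simp add: finite_above)
qed

end

text \<open>Collects what follows from the products of incomparable variables alone, for use with
  the Chow ideal and with kernels of functionals.\<close>

locale matroid_ideal = loopless_matroid M + relative_ideal C I
  for M :: "'a matroid" and C I :: "'a set mpoly_rat set" +
  assumes C_mvar: "G \<in> nonempty_flats M \<Longrightarrow> mvar G \<in> C"
    and incomparable: "\<lbrakk>F \<in> nonempty_flats M; G \<in> nonempty_flats M; \<not> F \<subseteq> G; \<not> G \<subseteq> F\<rbrakk>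
      \<Longrightarrow> mvar F * mvar G \<in> I"
begin

lemma C_upper_sum: "upper_sum G \<in> C"
  unfolding upper_sum_def by (rule C_sum) (auto intro: C_mvar)

text \<open>A flat containing \<open>G\<close> but not the join cannot contain \<open>F\<close>, and
  it is not contained in \<open>F\<close> because \<open>G\<close> is not. Hence its variable is
  annihilated by \<open>mvar F\<close>.\<close>

lemma mvar_mult_upper_sum_join:
  assumes F: "F \<in> nonempty_flats M" and G: "G \<in> flats M" and "\<not> G \<subseteq> F"
  shows "mvar F * (upper_sum G - upper_sum (join F G)) \<in> I"
proof -
  have Ff: "F \<in> flats M" using F by (simp add: nonempty_flats_def)
  have "upper_sum G - upper_sum (join F G) =
      (\<Sum>K | K \<in> nonempty_flats M \<and> G \<subseteq> K \<and> \<not> join F G \<subseteq> K. mvar K)"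
    using join_flat join_upper Ff G by (intro upper_sum_diff) auto
  moreover have "mvar F * mvar K \<in> I" if "K \<in> nonempty_flats M" "G \<subseteq> K" "\<not> join F G \<subseteq> K" for K
  proof (rule incomparable[OF F that(1)])
    show "\<not> F \<subseteq> K" using that join_subset_iff[OF Ff G, of K] by (simp add: nonempty_flats_def)
    show "\<not> K \<subseteq> F" using that assms by blast
  qed
  ultimately show ?thesis by (simp add: sum_distrib_left) (rule I_sum, simp)
qed

lemma mvar_mult_upper_sum_power_join:
  assumes F: "F \<in> nonempty_flats M" and G: "G \<in> flats M" and "\<not> G \<subseteq> F"
  shows "mvar F * upper_sum G ^ n \<in> I \<longleftrightarrow> mvar F * upper_sum (join F G) ^ n \<in> I"
  using mvar_mult_upper_sum_join[OF assms] by (intro I_mult_power_iff C_upper_sum)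

end

section \<open>Independence\<close>

context loopless_matroid
begin

text \<open>For an up-closed set \<open>U\<close> of flats properly containing \<open>F\<close>, the quotient by these relations is
  the Chow ring of the projective space of the contraction by \<open>F\<close>, blown up along the flats in
  \<open>U\<close>. The variables outside \<open>U\<close> are killed so that all these rings are quotients of the
  same polynomial ring.\<close>

inductive_set upset_relations :: "'a set \<Rightarrow> 'a set set \<Rightarrow> 'a set mpoly_rat set"
  for F :: "'a set" and U :: "'a set set" where
  rel_outside: "G \<notin> U \<Longrightarrow> mvar G \<in> upset_relations F U"
| rel_incomparable: "\<lbrakk>G \<in> U; H \<in> U; \<not> G \<subseteq> H; \<not> H \<subseteq> G\<rbrakk> \<Longrightarrow> mvar G * mvar H \<in> upset_relations F U"
| rel_chain: "\<lbrakk>G \<in> U; H \<in> U; G \<subset> H\<rbrakk> \<Longrightarrow> mvar G * upper_sum H ^ (r H - r G) \<in> upset_relations F U"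
| rel_power: "H \<in> U \<Longrightarrow> upper_sum H ^ (r H - r F) \<in> upset_relations F U"

text \<open>Variables outside \<open>U\<close> lie in \<open>I\<close>, which extends the
  incomparability relations from \<open>U\<close> to all nonempty flats.\<close>

lemma matroid_ideal_upset:
  assumes I: "relative_ideal UNIV I" and sub: "upset_relations F U \<subseteq> I"
  shows "matroid_ideal M UNIV I"
proof -
  interpret relative_ideal UNIV I by (rule I)
  show ?thesis
  proof
    fix G H :: "'a set"
    assume inc: "\<not> G \<subseteq> H" "\<not> H \<subseteq> G"
    consider "G \<notin> U" | "H \<notin> U" | "G \<in> U" "H \<in> U" by blast
    then show "mvar G * mvar H \<in> I"
    proof cases
      case 1
      then have "mvar G \<in> I" by (intro subsetD[OF sub] upset_relations.intros)
      then show ?thesis using I_mult[of "mvar H" "mvar G"] by (simp add: mult.commute)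
    next
      case 2
      then have "mvar H \<in> I" by (intro subsetD[OF sub] upset_relations.intros)
      then show ?thesis by (simp add: I_mult)
    next
      case 3
      then show ?thesis using inc upset_relations.rel_incomparable[of G U H F] by (intro subsetD[OF sub]) simp_all
    qed
  qed auto
qed

text \<open>The restriction to the centre: the ring of the contraction by \<open>F\<close> is a
  quotient of the old ring, so functionals on it also kill the old relations.\<close>

lemma upset_relations_above_subset:
  assumes I: "relative_ideal UNIV I" and sub: "upset_relations F (above F) \<subseteq> I"
    and F: "F \<in> flats M" and F0: "F0 \<in> flats M" "F0 \<subseteq> F"
    and U: "above F \<subseteq> U" "U \<subseteq> above F0" "F \<notin> U"
    and upc: "\<And>G H. G \<in> U \<Longrightarrow> H \<in> flats M \<Longrightarrow> G \<subseteq> H \<Longrightarrow> H \<in> U"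
  shows "upset_relations F0 U \<subseteq> I"
proof -
  interpret matroid_ideal M UNIV I by (rule matroid_ideal_upset[OF I sub])
  have out: "mvar G \<in> I" if "G \<notin> above F" for G
    using upset_relations.intros that by (intro subsetD[OF sub]) simp_all
  have rel: "mvar G * upper_sum H ^ (r H - r G) \<in> I" if "G \<in> above F" "H \<in> above F" "G \<subset> H" for G H
    using upset_relations.intros that by (intro subsetD[OF sub]) simp_all
  have top: "upper_sum H ^ (r H - r F) \<in> I" if "H \<in> above F" for H
    using upset_relations.intros that by (intro subsetD[OF sub]) simp_all
  have Uf: "U \<subseteq> nonempty_flats M" using U above_nonempty_flats by blast
  show ?thesis
  proof
    fix g assume "g \<in> upset_relations F0 U"
    then show "g \<in> I"
    proof (cases rule: upset_relations.cases)
      case (rel_outside G)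
      note a = this
      then show ?thesis using out U by blast
    next
      case (rel_incomparable G H)
      note b = this
      then show ?thesis using incomparable Uf by blast
    next
      case (rel_chain G H)
      note c = this
      show ?thesis
      proof (cases "G \<in> above F")
        case True
        then have "H \<in> above F" using c Uf by (auto simp: above_def nonempty_flats_def)
        then show ?thesis using rel True c by blast
      next
        case False
        then show ?thesis using I_mult[OF UNIV_I out[OF False], of "upper_sum H ^ (r H - r G)"] c
            by (simp add: mult.commute)
      qed
    next
      case (rel_power H)
      note d = this
      have Hf: "H \<in> flats M" "F0 \<subseteq> H" using d U by (auto simp: above_def)
      have HF: "\<not> H \<subseteq> F" using upc d F U by blast
      \<comment> \<open>\<open>H\<close> need not lie above \<open>F\<close>. Variables outside
        \<open>above F\<close> are killed, so the flats above \<open>H\<close> that survive contain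
        \<open>J\<close>, and \<open>H\<close> may be replaced by \<open>J\<close>; the required
        exponent does not grow.\<close>
      define J where "J = join F H"
      have J: "J \<in> above F"
        using join_flat[OF F Hf(1)] join_upper[OF F Hf(1)] HF by (auto simp: J_def above_def)
      have "upper_sum H - upper_sum J = (\<Sum>K | K \<in> nonempty_flats M \<and> H \<subseteq> K \<and> \<not> J \<subseteq> K. mvar K)"
        using J join_upper[OF F Hf(1)] by (intro upper_sum_diff) (auto simp: J_def above_def)
      also have "\<dots> \<in> I"
      proof (rule I_sum)
        fix K assume "K \<in> {K. K \<in> nonempty_flats M \<and> H \<subseteq> K \<and> \<not> J \<subseteq> K}"
        then have "K \<notin> above F"
          using join_subset_iff[OF F Hf(1), of K] by (auto simp: J_def above_def)
        then show "mvar K \<in> I" by (rule out)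
      qed
      finally have "1 * (upper_sum H - upper_sum J) \<in> I" by simp
      then have eq: "1 * upper_sum H ^ n \<in> I \<longleftrightarrow> 1 * upper_sum J ^ n \<in> I" for n
        by (rule I_mult_power_iff) auto
      have "r J - r F \<le> r H - r F0"
        using rank_join[OF F0(2) Hf(2) F Hf(1)] by (simp add: J_def)
      then have "1 * upper_sum J ^ (r H - r F0) \<in> I"
        using I_mult_power_mono[of 1 "upper_sum J" "r J - r F" "r H - r F0"] top[OF J] by simp
      then show ?thesis using eq d by simp
    qed
  qed
qed

text \<open>The power is the constant term of the equation of the blow-up along \<open>F\<close>. That it annihilates
  the kernel of the restriction to the centre keeps the adjoined variable from imposing new
  relations on the old ring.\<close>

lemma power_mult_relations_above:
  assumes I: "relative_ideal UNIV I" and sub: "upset_relations F0 U \<subseteq> I"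
    and F: "F \<in> flats M" and F0: "F0 \<in> flats M" "F0 \<subset> F"
    and U: "above F \<subseteq> U" "U \<subseteq> above F0" "F \<notin> U"
    and upc: "\<And>G H. G \<in> U \<Longrightarrow> H \<in> flats M \<Longrightarrow> G \<subseteq> H \<Longrightarrow> H \<in> U"
    and g: "g \<in> upset_relations F (above F)"
  shows "(\<Sum>K\<in>above F. mvar K) ^ (r F - r F0) * g \<in> I"
proof -
  interpret matroid_ideal M UNIV I by (rule matroid_ideal_upset[OF I sub])
  define y where "y = (\<Sum>K\<in>above F. mvar K)"
  have Fne: "F \<in> nonempty_flats M" using F F0 by (auto simp: nonempty_flats_def)
  \<comment> \<open>\<open>F\<close> is outside \<open>U\<close>, so its variable is in
    \<open>I\<close> and \<open>y\<close> agrees with \<open>upper_sum F\<close> modulo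
    \<open>I\<close>.\<close>
  have y: "y = upper_sum F - mvar F" using upper_sum_proper[OF Fne] by (simp add: y_def)
  have out: "mvar G \<in> I" if "G \<notin> U" for G
    using upset_relations.intros that by (intro subsetD[OF sub]) simp_all
  have rel: "mvar G * upper_sum H ^ (r H - r G) \<in> I" if "G \<in> U" "H \<in> U" "G \<subset> H" for G H
    using upset_relations.intros that by (intro subsetD[OF sub]) simp_all
  have top: "upper_sum H ^ (r H - r F0) \<in> I" if "H \<in> U" for H
    using upset_relations.intros that by (intro subsetD[OF sub]) simp_all
  have Uf: "U \<subseteq> nonempty_flats M" using U above_nonempty_flats by blast
  \<comment> \<open>The chain relation for a flat \<open>H\<close> that need not contain
    \<open>G\<close>: it is the one for the join with \<open>G\<close>, whose exponent is the rank
    difference to \<open>G\<close>.\<close>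
  have join_rel: "mvar G * upper_sum H ^ n \<in> I"
    if "G \<in> U" "H \<in> flats M" "\<not> H \<subseteq> G" "r (join G H) - r G \<le> n" for G H n
  proof -
    have G: "G \<in> nonempty_flats M" "G \<in> flats M" using that Uf by (auto simp: nonempty_flats_def)
    have "G \<subset> join G H" "join G H \<in> U"
      using join_upper[OF G(2) that(2)] join_flat[OF G(2) that(2)] that(1,3) upc by blast+
    then have "mvar G * upper_sum (join G H) ^ n \<in> I"
      using that by (intro I_mult_power_mono[OF rel]) auto
    then show ?thesis using mvar_mult_upper_sum_power_join[OF G(1) that(2,3)] by simp
  qed
  from g have "y ^ (r F - r F0) * g \<in> I"
  proof (cases rule: upset_relations.cases)
    case (rel_outside G)
    note a = this
    show ?thesis
    proof (cases "G \<in> U")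
      case False
      then show ?thesis using out a by (simp add: I_mult)
    next
      case True
      then have G: "G \<in> flats M" "F0 \<subseteq> G" "\<not> F \<subseteq> G"
        using U a by (auto simp: above_def)
      have "mvar G * (y - upper_sum F) \<in> I"
        using I_mult[OF UNIV_I out[OF U(3)]] I_uminus by (fastforce simp: y)
      then have "mvar G * y ^ n \<in> I \<longleftrightarrow> mvar G * upper_sum F ^ n \<in> I" for n
        by (rule I_mult_power_iff) auto
      moreover have "mvar G * upper_sum F ^ (r F - r F0) \<in> I"
        using rank_join[of F0 G F] G F F0 by (intro join_rel True) auto
      ultimately show ?thesis using a by (simp add: mult.commute)
    qed
  next
    case (rel_incomparable G H)
    note b = this
    then have "G \<in> U" "H \<in> U" using U by blast+
    then have "g \<in> upset_relations F0 U" using b by (simp add: upset_relations.rel_incomparable)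
    then show ?thesis using sub by (intro I_mult) auto
  next
    case (rel_chain G H)
    note c = this
    then have "mvar G * upper_sum H ^ (r H - r G) \<in> I" using U by (intro rel) auto
    then show ?thesis using c by (simp add: I_mult)
  next
    case (rel_power H)
    note d = this
    \<comment> \<open>Next to \<open>upper_sum H ^ e\<close> the factor \<open>y\<close> may be
      replaced by \<open>upper_sum H\<close>. The total exponent becomes \<open>r H - r F0\<close>,
      which is exactly the power relation of \<open>H\<close> over \<open>F0\<close>.\<close>
    define e where "e = r H - r F"
    have H: "H \<in> flats M" "F \<subset> H" "H \<in> U" using d U by (auto simp: above_def)
    have "upper_sum F - upper_sum H = (\<Sum>K | K \<in> nonempty_flats M \<and> F \<subseteq> K \<and> \<not> H \<subseteq> K. mvar K)"
      using H by (intro upper_sum_diff) auto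
    then have "(upper_sum F - upper_sum H) * upper_sum H ^ e =
        (\<Sum>K | K \<in> nonempty_flats M \<and> F \<subseteq> K \<and> \<not> H \<subseteq> K. mvar K * upper_sum H ^ e)"
      by (simp add: sum_distrib_right)
    also have "\<dots> \<in> I"
    proof (rule I_sum)
      fix K assume "K \<in> {K. K \<in> nonempty_flats M \<and> F \<subseteq> K \<and> \<not> H \<subseteq> K}"
      then have K: "K \<in> nonempty_flats M" "F \<subseteq> K" "\<not> H \<subseteq> K" by simp_all
      show "mvar K * upper_sum H ^ e \<in> I"
      proof (cases "K = F")
        case True
        then show ?thesis using I_mult[OF UNIV_I out[OF U(3)], of "upper_sum H ^ e"] by (simp add: mult.commute)
      next
        case False
        then have "K \<in> U" using K U by (auto simp: above_def nonempty_flats_def)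
        then show ?thesis
          using rank_join[of F K H] K H unfolding e_def
          by (intro join_rel) (auto simp: nonempty_flats_def)
      qed
    qed
    finally have "(upper_sum F - upper_sum H) * upper_sum H ^ e - mvar F * upper_sum H ^ e \<in> I"
      using I_mult[OF UNIV_I out[OF U(3)], of "upper_sum H ^ e"] by (intro I_diff) (simp_all add: mult.commute)
    then have "upper_sum H ^ e * (y - upper_sum H) \<in> I"
      by (simp add: y algebra_simps)
    then have "upper_sum H ^ e * y ^ n \<in> I \<longleftrightarrow> upper_sum H ^ e * upper_sum H ^ n \<in> I" for n
      by (rule I_mult_power_iff) auto
    moreover have "upper_sum H ^ e * upper_sum H ^ (r F - r F0) \<in> I"
    proof -
      have "e + (r F - r F0) = r H - r F0"
        using rank_strict_mono[OF F0(1) F F0(2)] rank_strict_mono[OF F H(1,2)] by (simp add: e_def)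
      then show ?thesis using top[OF H(3)] by (simp flip: power_add)
    qed
    ultimately show ?thesis using d by (simp add: mult.commute e_def)
  qed
  then show ?thesis by (simp add: y_def)
qed

text \<open>The flat \<open>F\<close> plays the part of \<open>F_0\<close> below the chain, and a
  step prepends a new smallest flat. Allowing \<open>F\<close> other than \<open>{}\<close> gives
  the basis for the contraction by \<open>F\<close>.\<close>

inductive fy_monomial :: "'a set \<Rightarrow> ('a set \<Rightarrow>\<^sub>0 nat) \<Rightarrow> bool" where
  fy_one: "fy_monomial F 0"
| fy_step: "\<lbrakk>G \<in> above F; 0 < i; i < r G - r F; fy_monomial G m\<rbrakk> \<Longrightarrow> fy_monomial F (Poly_Mapping.single G i + m)"

lemma keys_add_nat: "Poly_Mapping.keys (m + n) = Poly_Mapping.keys m \<union> Poly_Mapping.keys n"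
  for m n :: "'b \<Rightarrow>\<^sub>0 nat"
  by (auto simp: in_keys_iff lookup_add)

lemma fy_keys: "fy_monomial F m \<Longrightarrow> Poly_Mapping.keys m \<subseteq> above F"
  by (induction rule: fy_monomial.induct) (auto simp: keys_add_nat above_def)

text \<open>Freely prescribed values give dual functionals, hence independence. The values
  \<open>f\<close> must be arbitrary because the contraction receives a shifted copy of them. The
  measure decreases both when a flat leaves \<open>U\<close> and when \<open>F0\<close> is replaced
  by a larger flat of \<open>U\<close>.\<close>

theorem fy_monomials_separated:
  assumes "F0 \<in> flats M" "U \<subseteq> above F0"
    and "\<And>G H. G \<in> U \<Longrightarrow> H \<in> flats M \<Longrightarrow> G \<subseteq> H \<Longrightarrow> H \<in> U"
  shows "\<exists>l. additive l \<and> upset_relations F0 U \<subseteq> kernel_ideal l \<and>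
    (\<forall>m. fy_monomial F0 m \<and> Poly_Mapping.keys m \<subseteq> U \<longrightarrow> l (Poly_Mapping.single m 1) = f m)"
  using assms
proof (induction "card (above F0) + card U" arbitrary: F0 U f rule: less_induct)
  case less
  note F0 = less.prems(1) and U = less.prems(2) and upc = less.prems(3)
  have finU: "finite U" using U finite_above finite_subset by blast
  show ?case
  proof (cases "U = {}")
    case True
    \<comment> \<open>With no flats every variable is killed, and only the constant term
      remains.\<close>
    define l :: "'a set mpoly_rat \<Rightarrow> rat" where "l p = f 0 * Poly_Mapping.lookup p 0" for p
    have add: "additive l" by standard (simp add: l_def lookup_add distrib_left)
    have "l (s * mvar G) = 0" for s G
    proof (rule additive_kills_monomials[OF add])
      fix m :: "'a set \<Rightarrow>\<^sub>0 nat" and c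
      have "m + Poly_Mapping.single G 1 \<noteq> 0"
      proof
        assume "m + Poly_Mapping.single G 1 = 0"
        then have "Poly_Mapping.lookup (m + Poly_Mapping.single G 1) G = 0" by simp
        then show False by (simp add: lookup_add)
      qed
      then show "l (Poly_Mapping.single m c * mvar G) = 0"
        by (simp add: l_def mvar_def mult_single lookup_single when_def)
    qed
    then have "upset_relations F0 U \<subseteq> kernel_ideal l"
      using True by (auto elim!: upset_relations.cases simp: kernel_ideal_def)
    moreover have "l (Poly_Mapping.single m 1) = f m" if "Poly_Mapping.keys m \<subseteq> U" for m
      using that True by (simp add: l_def)
    ultimately show ?thesis using add by blast
  next
    case False
    \<comment> \<open>Minimality keeps \<open>U - {F}\<close> up-closed and keeps
      \<open>mvar F\<close> out of all relations of the smaller problems.\<close>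
    then obtain F where FU: "F \<in> U" and Fmin: "\<And>G. G \<in> U \<Longrightarrow> \<not> G \<subset> F"
      using finite_has_minimal[OF finU] by (metis order.strict_iff_order)
    define U' where "U' = U - {F}"
    have F: "F \<in> flats M" "F0 \<subset> F" using FU U by (auto simp: above_def)
    have aF: "above F \<subseteq> U'" using upc[OF FU] by (auto simp: above_def U'_def)
    have U'0: "U' \<subseteq> above F0" "F \<notin> U'" using U by (auto simp: U'_def)
    have upc': "H \<in> U'" if "G \<in> U'" "H \<in> flats M" "G \<subseteq> H" for G H
      using upc[of G H] that Fmin[of G] by (auto simp: U'_def)
    have UU': "U = insert F U'" using FU by (auto simp: U'_def)
    define c where "c = r F - r F0"
    have c: "0 < c" using rank_strict_mono[OF F0 F] by (simp add: c_def)
    define y :: "'a set mpoly_rat" where "y = (\<Sum>K\<in>above F. mvar K)"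

    have "card U' < card U" using FU finU unfolding U'_def by (rule card_Diff1_less[rotated])
    then obtain l0 where l0: "additive l0" "upset_relations F0 U' \<subseteq> kernel_ideal l0"
      and l0f: "\<And>m. fy_monomial F0 m \<Longrightarrow> Poly_Mapping.keys m \<subseteq> U' \<Longrightarrow> l0 (Poly_Mapping.single m 1) = f m"
      using less.hyps[of F0 U' f] F0 U'0 upc' by auto
    have "above F \<subset> above F0" using aF U'0 FU U by blast
    then have "card (above F) < card (above F0)" using finite_above psubset_card_mono by blast
    moreover have "card (above F) \<le> card U" using aF finU by (intro card_mono) (auto simp: UU')
    ultimately have "card (above F) + card (above F) < card (above F0) + card U" by simp
    then have "\<exists>l. additive l \<and> upset_relations F (above F) \<subseteq> kernel_ideal l \<and>
      (\<forall>m. fy_monomial F m \<and> Poly_Mapping.keys m \<subseteq> above F \<longrightarrow> l (Poly_Mapping.single m 1) =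
         f (Poly_Mapping.single F i + m))" for i
      using F by (intro less.hyps) (auto simp: above_def)
    then obtain l1 where l1: "\<And>i. additive (l1 i)" "\<And>i. upset_relations F (above F) \<subseteq> kernel_ideal (l1 i)"
      and l1f: "\<And>i m. fy_monomial F m \<Longrightarrow> l1 i (Poly_Mapping.single m 1) = f (Poly_Mapping.single F i + m)"
      using fy_keys by metis

    \<comment> \<open>Exponent 0 of \<open>mvar F\<close> belongs to basis monomials without
      \<open>F\<close>, positive exponents below \<open>c\<close> to those whose chain starts with
      \<open>F\<close>.\<close>
    define l where "l i = (if i = 0 then l0 else l1 i)" for i :: nat
    define L where "L = tower c y l"
    have l_add: "additive (l i)" for i using l0 l1 by (simp add: l_def)
    have L_add: "additive (L i)" for i unfolding L_def by (rule tower_additive[OF c l_add])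
    have L_less: "L i s = l i s" if "i < c" for i s using that by (simp add: L_def tower_less)
    \<comment> \<open>The exponent is positive since relations of the contraction occur only
      multiplied by \<open>mvar F\<close>.\<close>
    have KJ: "L i (s * g) = 0" if "g \<in> upset_relations F (above F)" "0 < i" for i s g
      unfolding L_def
    proof (rule tower_kills[OF c _ _ that(2)])
      show "l i (s * g) = 0" if "0 < i" for i s
        using l1(2)[of i] \<open>g \<in> _\<close> that by (auto simp: l_def kernel_ideal_def)
      have "y ^ c * g \<in> kernel_ideal l0"
        unfolding y_def c_def
        by (rule power_mult_relations_above[OF kernel_ideal[OF l0(1)] l0(2) F(1) F0 F(2) aF U'0 upc' that(1)])
      then show "l 0 (s * (y ^ c * g)) = 0" for s
        by (auto simp: l_def kernel_ideal_def)
    qed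
    \<comment> \<open>At positive exponents below \<open>c\<close> the old relations are killed
      because they hold in the contraction; the recursion carries this to higher exponents.\<close>
    have K0: "L i (s * g) = 0" if g: "g \<in> upset_relations F0 U'" for i s g
    proof (cases "i = 0")
      case True
      then show ?thesis using l0(2) g c by (auto simp: L_less l_def kernel_ideal_def)
    next
      case False
      have l0g: "l0 (s * g) = 0" for s
        using l0(2) g by (auto simp: kernel_ideal_def)
      have "F0 \<subseteq> F" using F(2) by simp
      then have "upset_relations F0 U' \<subseteq> kernel_ideal (l1 i)" for i
        by (rule upset_relations_above_subset[OF kernel_ideal[OF l1(1)] l1(2) F(1) F0 _ aF U'0 upc'])
      then have l1g: "l1 i (s * g) = 0" for i s
        using g by (auto simp: kernel_ideal_def)
      have "tower c y l i (s * g) = 0"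
      proof (rule tower_kills[OF c])
        show "l 0 (s * (y ^ c * g)) = 0" for s
          using l0g[of "s * y ^ c"] by (simp add: l_def mult.assoc)
      qed (use False l1g in \<open>auto simp: l_def\<close>)
      then show ?thesis by (simp add: L_def)
    qed

    define lam where "lam = spread F L"
    have lam_add: "additive lam" unfolding lam_def by (rule spread_additive[OF L_add])
    interpret R0: relative_ideal "carrier (mpoly_ring (- {F}))" "{0}"
      by (rule mpoly_ring_relative_ideal) auto
    have R0_mvar: "mvar G \<in> carrier (mpoly_ring (- {F}))" if "G \<noteq> F" for G
      using that by (intro mpoly_ring_mvar) auto
    have R0_y: "y \<in> carrier (mpoly_ring (- {F}))"
      unfolding y_def by (intro R0.C_sum R0_mvar) (auto simp: above_def)
    have R0_upper: "upper_sum H \<in> carrier (mpoly_ring (- {F}))" if "H \<in> U'" for H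
      unfolding upper_sum_def
    proof (intro R0.C_sum R0_mvar notI)
      fix K assume "K \<in> {K \<in> nonempty_flats M. H \<subseteq> K}" "K = F"
      then show False using that Fmin[of H] by (auto simp: U'_def)
    qed
    have lam_R0: "lam (Poly_Mapping.single m a * (mvar F ^ k * q)) =
        L (Poly_Mapping.lookup m F + k)
          (Poly_Mapping.single (m - Poly_Mapping.single F (Poly_Mapping.lookup m F)) a * q)"
      if "q \<in> carrier (mpoly_ring (- {F}))" for m a k q
    proof -
      have "mvar F ^ k = Poly_Mapping.single (Poly_Mapping.single F k) 1"
        by (induction k) (auto simp: mvar_def mult_single simp flip: single_add)
      moreover have "m + Poly_Mapping.single F k - Poly_Mapping.single F (Poly_Mapping.lookup m F + k)
          = m - Poly_Mapping.single F (Poly_Mapping.lookup m F)"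
        by (rule poly_mapping_eqI) (simp add: lookup_add lookup_minus lookup_single when_def)
      ultimately show ?thesis
        using spread_single_mult[of L q F "m + Poly_Mapping.single F k" a, OF L_add that]
        by (simp add: lam_def mult_single lookup_add flip: mult.assoc)
    qed
    note lam_R00 = lam_R0[where k = 0, simplified]
    have "lam (s * g) = 0" if g: "g \<in> upset_relations F0 U" for s g
    proof (rule additive_kills_monomials[OF lam_add])
      fix m a
      \<comment> \<open>Each relation of \<open>U\<close> is an old one free of
        \<open>mvar F\<close>, or \<open>mvar F\<close> times a relation of the contraction, or the
        power relation of \<open>F\<close> itself.\<close>
      have old: "lam (Poly_Mapping.single m a * g) = 0" if "g \<in> upset_relations F0 U'" "g \<in> carrier (mpoly_ring (- {F}))"
        using that by (simp add: lam_R00 K0)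
      have new: "lam (Poly_Mapping.single m a * g) = 0" if "g = mvar F * h" "h \<in> upset_relations F (above F)" "h \<in> carrier (mpoly_ring (- {F}))" for h
        using that lam_R0[of h m a 1] by (simp add: KJ)
      from g show "lam (Poly_Mapping.single m a * g) = 0"
      proof (cases rule: upset_relations.cases)
        case (rel_outside G)
        note a = this
        then have "g \<in> upset_relations F0 U'" "G \<noteq> F"
          using FU upset_relations.rel_outside[of G U' F0] unfolding U'_def by auto
        then show ?thesis using a by (intro old) (auto intro: R0_mvar)
      next
        case (rel_incomparable G H)
        note b = this
        consider "G = F" | "H = F" | "G \<noteq> F" "H \<noteq> F" by blast
        then show ?thesis
        proof cases
          case 1
          then have "mvar H \<in> upset_relations F (above F)" "H \<noteq> F"
            using b by (auto intro: upset_relations.rel_outside simp: above_def)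
          then show ?thesis using b 1 by (intro new[of "mvar H"]) (auto intro: R0_mvar)
        next
          case 2
          then have "mvar G \<in> upset_relations F (above F)" "G \<noteq> F"
            using b by (auto intro: upset_relations.rel_outside simp: above_def)
          then show ?thesis using b 2 by (intro new[of "mvar G"]) (auto intro: R0_mvar)
        next
          case 3
          then have "g \<in> upset_relations F0 U'"
            using b upset_relations.rel_incomparable[of G U' H F0] unfolding U'_def by blast
          then show ?thesis using b 3 by (intro old) (auto intro: R0_mvar R0.C_mult)
        qed
      next
        case (rel_chain G H)
        note c = this
        then have H: "H \<in> U'" using Fmin by (auto simp: U'_def)
        show ?thesis
        proof (cases "G = F")
          case True
          then have "H \<in> above F" using c U by (auto simp: above_def)
          then have "upper_sum H ^ (r H - r F) \<in> upset_relations F (above F)"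
            by (rule upset_relations.rel_power)
          then show ?thesis using c True
            by (intro new[of "upper_sum H ^ (r H - r F)"]) (auto intro: R0.C_power R0_upper H)
        next
          case False
          then have "g \<in> upset_relations F0 U'"
            using c H upset_relations.rel_chain[of G U' H F0] unfolding U'_def by blast
          then show ?thesis using c H False
            by (intro old) (auto intro: R0_mvar R0.C_mult R0.C_power R0_upper)
        qed
      next
        case (rel_power H)
        note d = this
        show ?thesis
        proof (cases "H = F")
          case False
          then have H: "H \<in> U'" using d by (simp add: U'_def)
          then have "g \<in> upset_relations F0 U'" using d upset_relations.rel_power by blast
          then show ?thesis using d H by (intro old) (auto intro: R0.C_power R0_upper)
        next
          case True
          have "F \<in> nonempty_flats M" using F by (auto simp: nonempty_flats_def)
          \<comment> \<open>This is the equation from which \<open>tower\<close> was built.\<close>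
          then have "g = (mvar F + y) ^ c" using d True by (simp add: upper_sum_proper y_def c_def)
          also have "\<dots> = (\<Sum>k\<le>c. of_nat (c choose k) * mvar F ^ k * y ^ (c - k))"
            by (rule binomial_ring)
          moreover have "lam (s * (of_nat n * x)) = of_nat n * lam (s * x)" for s n x
            using additive_of_nat_mult[of lam n "s * x", OF additive.add[OF lam_add]]
            by (simp add: mult.left_commute)
          ultimately have "lam (Poly_Mapping.single m a * g) =
             (\<Sum>k\<le>c. of_nat (c choose k) * lam (Poly_Mapping.single m a * (mvar F ^ k * y ^ (c - k))))"
            by (simp add: sum_distrib_left additive.sum[OF lam_add] mult.assoc)
          also have "\<dots> = 0"
            using tower_relation[OF c, of y l "Poly_Mapping.lookup m F"
               "Poly_Mapping.single (m - Poly_Mapping.single F (Poly_Mapping.lookup m F)) a"]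
            by (simp add: lam_R0 R0.C_power R0_y L_def)
          finally show ?thesis .
        qed
      qed
    qed
    then have "upset_relations F0 U \<subseteq> kernel_ideal lam" by (auto simp: kernel_ideal_def)
    moreover have "lam (Poly_Mapping.single m 1) = f m"
      if m: "fy_monomial F0 m" "Poly_Mapping.keys m \<subseteq> U" for m
    proof (cases "F \<in> Poly_Mapping.keys m")
      case False
      then have "lam (Poly_Mapping.single m 1) = l0 (Poly_Mapping.single m 1)"
        using lam_R00[of 1 m 1] R0.C_one c by (simp add: in_keys_iff L_less l_def)
      then show ?thesis using l0f[OF m(1)] m(2) False by (auto simp: UU')
    next
      case True
      with m(1) obtain G i m' where m': "m = Poly_Mapping.single G i + m'" "G \<in> above F0" "0 < i"
          "i < r G - r F0" "fy_monomial G m'"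
        by (cases rule: fy_monomial.cases) auto
      have "G \<in> U" using m m' by (auto simp: keys_add_nat)
      \<comment> \<open>The chain must start with \<open>F\<close>: otherwise its first flat would
        be an element of \<open>U\<close> strictly below \<open>F\<close>.\<close>
      have GF: "G = F"
      proof (rule ccontr)
        assume "G \<noteq> F"
        then have "F \<in> above G" using True m' fy_keys[OF m'(5)] by (auto simp: keys_add_nat split: if_splits)
        then show False using Fmin[OF \<open>G \<in> U\<close>] by (simp add: above_def)
      qed
      have "F \<notin> Poly_Mapping.keys m'" using fy_keys[OF m'(5)] GF by (auto simp: above_def)
      then have "Poly_Mapping.lookup m F = i" "m - Poly_Mapping.single F i = m'"
        using m' GF by (auto simp: lookup_add in_keys_iff)
      then have "lam (Poly_Mapping.single m 1) = L i (Poly_Mapping.single m' 1)"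
        using lam_R00[of 1 m 1] R0.C_one by simp
      also have "\<dots> = l1 i (Poly_Mapping.single m' 1)"
        using m' GF by (simp add: L_less l_def c_def)
      finally show ?thesis using l1f[of m' i] m' GF by simp
    qed
    ultimately show ?thesis using lam_add by blast
  qed
qed

end

section \<open>Spanning\<close>

lemma sum_keys_add:
  fixes m n :: "'b \<Rightarrow>\<^sub>0 nat" and w :: "'b \<Rightarrow> nat"
  shows "(\<Sum>v\<in>Poly_Mapping.keys (m + n). Poly_Mapping.lookup (m + n) v * w v) =
    (\<Sum>v\<in>Poly_Mapping.keys m. Poly_Mapping.lookup m v * w v) +
    (\<Sum>v\<in>Poly_Mapping.keys n. Poly_Mapping.lookup n v * w v)"
  by (rule setsum_keys_plus_distrib) (auto simp: distrib_right)

lemma monomial_degree_add: "monomial_degree (m + n) = monomial_degree m + monomial_degree n"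
  using sum_keys_add[of m n "\<lambda>_. 1"] by (simp add: monomial_degree_def)

lemma monomial_degree_single [simp]: "monomial_degree (Poly_Mapping.single v k) = k"
  by (cases "k = 0") (auto simp: monomial_degree_def)

lemma monomial_degree_zero [simp]: "monomial_degree 0 = 0"
  by (simp add: monomial_degree_def)

context loopless_matroid
begin

lemma finite_fy: "finite {m. fy_monomial F m}"
proof (induction "card (above F)" arbitrary: F rule: less_induct)
  case less
  have "{m. fy_monomial F m} \<subseteq> insert 0 (\<Union>G\<in>above F. \<Union>i<r G. (+) (Poly_Mapping.single G i) ` {m. fy_monomial G m})"
  proof
    fix m assume "m \<in> {m. fy_monomial F m}"
    then have "fy_monomial F m" by simp
    then show "m \<in> insert 0 (\<Union>G\<in>above F. \<Union>i<r G. (+) (Poly_Mapping.single G i) ` {m. fy_monomial G m})"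
    proof cases
      case (fy_step G i m')
      then have "m \<in> (+) (Poly_Mapping.single G i) ` {m. fy_monomial G m}" "i < r G" by auto
      then show ?thesis using fy_step(2) by blast
    qed simp
  qed
  moreover have "finite {m. fy_monomial G m}" if "G \<in> above F" for G
  proof (rule less)
    have "above G \<subset> above F" using that by (auto simp: above_def)
    then show "card (above G) < card (above F)" by (simp add: finite_above psubset_card_mono)
  qed
  ultimately show ?case
    using finite_above by (elim finite_subset) auto
qed

text \<open>A chain monomial outside the basis is divisible by the term of a chain relation that is
  to be rewritten, namely \<open>mvar F * mvar G ^ (r G - r F)\<close>, without the first factor if
  \<open>F = F0\<close>.\<close>

lemma fy_or_excess:
  assumes "Poly_Mapping.keys m \<subseteq> above F0"
    and "\<And>F G. F \<in> Poly_Mapping.keys m \<Longrightarrow> G \<in> Poly_Mapping.keys m \<Longrightarrow> F \<subseteq> G \<or> G \<subseteq> F"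
  shows "fy_monomial F0 m \<or> (\<exists>F G. (F = F0 \<or> F \<in> Poly_Mapping.keys m) \<and> G \<in> Poly_Mapping.keys m \<and>
    F \<subset> G \<and> r G - r F \<le> Poly_Mapping.lookup m G)"
  using assms
proof (induction "card (Poly_Mapping.keys m)" arbitrary: m F0 rule: less_induct)
  case less
  note keys = less.prems(1) and chain = less.prems(2)
  show ?case
  proof (cases "m = 0")
    case True
    then show ?thesis by (simp add: fy_one)
  next
    case False
    then have "Poly_Mapping.keys m \<noteq> {}" by simp
    then obtain G where G: "G \<in> Poly_Mapping.keys m" "\<And>K. K \<in> Poly_Mapping.keys m \<Longrightarrow> G \<subseteq> K"
      using finite_has_minimal[of "Poly_Mapping.keys m"] chain by (metis finite_keys)
    define i where "i = Poly_Mapping.lookup m G"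
    define m' where "m' = m - Poly_Mapping.single G i"
    have m: "m = Poly_Mapping.single G i + m'"
      by (rule poly_mapping_eqI) (simp add: m'_def lookup_add lookup_minus lookup_single when_def i_def)
    have Gm': "G \<notin> Poly_Mapping.keys m'"
      by (simp add: m'_def in_keys_iff lookup_minus i_def)
    have "0 < i" using G by (simp add: i_def in_keys_iff)
    then have km: "Poly_Mapping.keys m = insert G (Poly_Mapping.keys m')"
      by (subst m) (simp add: keys_add_nat)
    have Ga: "G \<in> above F0" using G keys by blast
    have "fy_monomial G m' \<or> (\<exists>F H. (F = G \<or> F \<in> Poly_Mapping.keys m') \<and> H \<in> Poly_Mapping.keys m' \<and>
       F \<subset> H \<and> r H - r F \<le> Poly_Mapping.lookup m' H)"
    proof (rule less.hyps)
      show "card (Poly_Mapping.keys m') < card (Poly_Mapping.keys m)"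
        using Gm' by (simp add: km)
      show "Poly_Mapping.keys m' \<subseteq> above G"
      proof
        fix K assume K: "K \<in> Poly_Mapping.keys m'"
        then have "G \<subseteq> K" "G \<noteq> K" "K \<in> flats M" using G km Gm' keys by (auto simp: above_def)
        then show "K \<in> above G" by (auto simp: above_def)
      qed
    qed (use chain km in auto)
    then show ?thesis
    proof
      assume fy: "fy_monomial G m'"
      show ?thesis
      proof (cases "i < r G - r F0")
        case True
        then have "fy_monomial F0 m"
          using fy Ga \<open>0 < i\<close> by (subst m) (rule fy_step)
        then show ?thesis ..
      next
        case False
        then have "F0 \<subset> G \<and> r G - r F0 \<le> Poly_Mapping.lookup m G" using Ga by (simp add: i_def above_def)
        then show ?thesis using G(1) by blast
      qed
    next
      assume "\<exists>F H. (F = G \<or> F \<in> Poly_Mapping.keys m') \<and> H \<in> Poly_Mapping.keys m' \<and>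
       F \<subset> H \<and> r H - r F \<le> Poly_Mapping.lookup m' H"
      then obtain F H where FH: "F = G \<or> F \<in> Poly_Mapping.keys m'" "H \<in> Poly_Mapping.keys m'" "F \<subset> H"
        "r H - r F \<le> Poly_Mapping.lookup m' H" by blast
      moreover have "Poly_Mapping.lookup m' H = Poly_Mapping.lookup m H"
        using FH(2) Gm' by (auto simp: m'_def lookup_minus lookup_single when_def)
      ultimately show ?thesis unfolding km by (metis insert_iff)
    qed
  qed
qed

section \<open>Weights of monomials\<close>

definition flat_weight :: "('a set \<Rightarrow>\<^sub>0 nat) \<Rightarrow> nat" where
  "flat_weight m = (\<Sum>G\<in>Poly_Mapping.keys m. Poly_Mapping.lookup m G * r G)"

lemma flat_weight_add: "flat_weight (m + n) = flat_weight m + flat_weight n"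
  unfolding flat_weight_def by (rule sum_keys_add)

lemma flat_weight_single [simp]: "flat_weight (Poly_Mapping.single G k) = k * r G"
  by (cases "k = 0") (auto simp: flat_weight_def)

lemma flat_weight_zero [simp]: "flat_weight 0 = 0"
  by (simp add: flat_weight_def)

lemma flat_weight_le:
  assumes "Poly_Mapping.keys m \<subseteq> nonempty_flats M"
  shows "flat_weight m \<le> monomial_degree m * r E"
  unfolding flat_weight_def monomial_degree_def sum_distrib_right
  using assms flats_subset by (intro sum_mono mult_le_mono2 rank_mono) (auto simp: nonempty_flats_def)

text \<open>Rewriting a monomial with the chain relations raises its weight, which is bounded in each
  degree.\<close>

definition heavy :: "nat \<Rightarrow> nat \<Rightarrow> 'a set mpoly_rat set" where
  "heavy k w = {p \<in> carrier (chow_poly_ring M).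
     \<forall>m\<in>Poly_Mapping.keys p. monomial_degree m = k \<and> w \<le> flat_weight m}"

lemma heavy_keys:
  "p \<in> heavy k w \<longleftrightarrow> (\<forall>m\<in>Poly_Mapping.keys p. Poly_Mapping.keys m \<subseteq> nonempty_flats M \<and>
     monomial_degree m = k \<and> w \<le> flat_weight m)"
  by (auto simp: heavy_def chow_poly_ring_def mpoly_ring_simps)

lemma heavy_single:
  "\<lbrakk>Poly_Mapping.keys m \<subseteq> nonempty_flats M; monomial_degree m = k; w \<le> flat_weight m\<rbrakk>
    \<Longrightarrow> Poly_Mapping.single m c \<in> heavy k w"
  by (auto simp: heavy_keys)

lemma heavy_zero: "0 \<in> heavy k w"
  by (simp add: heavy_keys)

lemma heavy_add: "p \<in> heavy k w \<Longrightarrow> q \<in> heavy k w \<Longrightarrow> p + q \<in> heavy k w"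
  using keys_add[of p q] unfolding heavy_keys by blast

lemma heavy_uminus: "p \<in> heavy k w \<Longrightarrow> - p \<in> heavy k w"
  by (auto simp: heavy_keys in_keys_iff)

lemma heavy_sum: "(\<And>x. x \<in> A \<Longrightarrow> f x \<in> heavy k w) \<Longrightarrow> sum f A \<in> heavy k w"
  by (induction A rule: infinite_finite_induct) (auto simp: heavy_zero heavy_add)

lemma heavy_mono: "p \<in> heavy k w \<Longrightarrow> w' \<le> w \<Longrightarrow> p \<in> heavy k w'"
  by (auto simp: heavy_def)

lemma heavy_mult: "p \<in> heavy k w \<Longrightarrow> q \<in> heavy k' w' \<Longrightarrow> p * q \<in> heavy (k + k') (w + w')"
  unfolding heavy_keys
proof
  fix m
  assume p: "\<forall>m\<in>Poly_Mapping.keys p. Poly_Mapping.keys m \<subseteq> nonempty_flats M \<and> monomial_degree m = k \<and> w \<le> flat_weight m"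
    and q: "\<forall>m\<in>Poly_Mapping.keys q. Poly_Mapping.keys m \<subseteq> nonempty_flats M \<and> monomial_degree m = k' \<and> w' \<le> flat_weight m"
    and "m \<in> Poly_Mapping.keys (p * q)"
  then obtain m1 m2 where "m = m1 + m2" "m1 \<in> Poly_Mapping.keys p" "m2 \<in> Poly_Mapping.keys q"
    using keys_mult[of p q] by blast
  then show "Poly_Mapping.keys m \<subseteq> nonempty_flats M \<and> monomial_degree m = k + k' \<and> w + w' \<le> flat_weight m"
    using p q by (auto simp: keys_add_nat monomial_degree_add flat_weight_add add_mono)
qed

lemma heavy_one: "1 \<in> heavy 0 0"
  by (simp add: heavy_keys)

lemma heavy_power: "p \<in> heavy k w \<Longrightarrow> p ^ n \<in> heavy (n * k) (n * w)"
  by (induction n) (auto simp: heavy_one dest: heavy_mult)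

lemma heavy_of_nat_mult: "p \<in> heavy k w \<Longrightarrow> of_nat n * p \<in> heavy k w"
  by (induction n) (auto simp: heavy_zero distrib_right intro: heavy_add)

lemma heavy_mvar: "G \<in> nonempty_flats M \<Longrightarrow> mvar G \<in> heavy 1 (r G)"
  by (auto simp: mvar_def intro: heavy_single)

end

locale chow_relation_ideal = matroid_ideal M "carrier (chow_poly_ring M)" I
  for M :: "'a matroid" and I :: "'a set mpoly_rat set" +
  assumes linear_relation: "a \<in> ground M \<Longrightarrow> (\<Sum>F \<in> {F \<in> nonempty_flats M. a \<in> F}. mvar F) \<in> I"
begin

lemma upper_sum_atom:
  assumes "a \<in> E"
  shows "upper_sum (closure {a}) \<in> I"
proof -
  have "{K. K \<in> nonempty_flats M \<and> closure {a} \<subseteq> K} = {F \<in> nonempty_flats M. a \<in> F}"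
    using assms closure_subset_iff[of "{a}"] by (auto simp: nonempty_flats_def)
  then show ?thesis using linear_relation[OF assms] by (simp add: upper_sum_def)
qed

text \<open>Multiplying the linear relation of \<open>a\<close> by \<open>mvar H\<close> removes the
  flats incomparable with \<open>H\<close>; those left contain both \<open>a\<close> and
  \<open>H\<close>.\<close>

lemma mvar_mult_upper_sum_atom:
  assumes H: "H \<in> nonempty_flats M" and a: "a \<in> E" "a \<notin> H" and K: "K = closure (insert a H)"
  shows "mvar H * upper_sum K \<in> I"
proof -
  have A: "closure {a} \<in> flats M" and Hf: "H \<in> flats M"
    using a H by (auto intro: closure_flat simp: nonempty_flats_def)
  have sub: "{a} \<subseteq> E" "insert a H \<subseteq> E" using a flats_subset[OF Hf] by auto
  have nA: "\<not> closure {a} \<subseteq> H" using subset_closure[OF sub(1)] a by auto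
  have "closure (insert a H) = join H (closure {a})"
    using closure_subset_iff[OF sub(2)] closure_subset_iff[OF sub(1)] join_subset_iff[OF Hf A]
      closure_flat[OF sub(2)] join_flat[OF Hf A]
    by (intro antisym) auto
  then have "mvar H * (upper_sum (closure {a}) - upper_sum K) \<in> I"
    using mvar_mult_upper_sum_join[OF H A nA] K by simp
  moreover have "mvar H * upper_sum (closure {a}) \<in> I"
    using upper_sum_atom[OF a(1)] C_mvar[OF H] by (intro I_mult)
  ultimately show ?thesis
    by (metis I_diff_iff right_diff_distrib)
qed

text \<open>The value 1 at the empty flat lets the chain relation include the pure power
  relations.\<close>

definition flat_var :: "'a set \<Rightarrow> 'a set mpoly_rat" where
  "flat_var F = (if F = {} then 1 else mvar F)"

lemma C_flat_var: "F \<in> flats M \<Longrightarrow> flat_var F \<in> carrier (chow_poly_ring M)"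
  by (auto simp: flat_var_def C_one C_mvar nonempty_flats_def)

text \<open>Induction on the rank of \<open>G\<close> through a flat \<open>G'\<close> just below
  it. In the presence of one factor \<open>upper_sum G\<close>, the sums for \<open>G'\<close> and
  \<open>G\<close> are interchangeable, so the relation for \<open>G'\<close> multiplied by
  \<open>upper_sum G\<close> is the one for \<open>G\<close>.\<close>

lemma chain_relation:
  assumes F: "F \<in> flats M" and "G \<in> flats M" "F \<subset> G"
  shows "flat_var F * upper_sum G ^ (r G - r F) \<in> I"
  using assms(2,3)
proof (induction "r G" arbitrary: G rule: less_induct)
  case less
  define S where "S = {K \<in> flats M. F \<subseteq> K \<and> K \<subset> G}"
  have "finite S" "F \<in> S" using finite_flats F less.prems by (auto simp: S_def)
  \<comment> \<open>A maximal flat below \<open>G\<close> in the interval: any \<open>a\<close> in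
    \<open>G\<close> outside it generates \<open>G\<close> over it, so the rank difference is
    1.\<close>
  then obtain G' where G': "G' \<in> S" and max: "\<And>K. K \<in> S \<Longrightarrow> \<not> G' \<subset> K"
    using finite_has_maximal[of S] by (metis empty_iff order.strict_iff_order)
  have G'f: "G' \<in> flats M" "F \<subseteq> G'" "G' \<subset> G" using G' by (auto simp: S_def)
  then obtain a where a: "a \<in> G" "a \<notin> G'" by blast
  have aE: "a \<in> E" "insert a G' \<subseteq> E" using a G'f flats_subset[OF less.prems(1)] by auto
  have Gcl: "closure (insert a G') = G"
  proof (rule ccontr)
    assume "closure (insert a G') \<noteq> G"
    moreover have "closure (insert a G') \<subseteq> G" using a G'f less.prems by (intro closure_least) auto
    ultimately have "closure (insert a G') \<in> S"
      using closure_flat[OF aE(2)] subset_closure[OF aE(2)] G'f by (auto simp: S_def)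
    then show False using max subset_closure[OF aE(2)] a by blast
  qed
  have "r G = r (insert a G')" using rank_closure[OF aE(2)] Gcl by simp
  then have rG: "r G = Suc (r G')"
    using rank_insert_le[of G' a] rank_strict_mono[OF G'f(1) less.prems(1) G'f(3)] aE by auto
  \<comment> \<open>\<open>a\<close> is not in \<open>K\<close>, since otherwise \<open>K\<close>
    would contain \<open>G\<close>. Its linear relation times \<open>mvar K\<close> gives the claim
    for the join of \<open>K\<close> and \<open>G\<close>, which can be exchanged for
    \<open>G\<close>.\<close>
  have Kcl: "mvar K * upper_sum G \<in> I" if K: "K \<in> nonempty_flats M" "G' \<subseteq> K" "\<not> G \<subseteq> K" for K
  proof -
    have Kf: "K \<in> flats M" using K by (simp add: nonempty_flats_def)
    have aK: "a \<notin> K" using K Kf closure_subset_iff[OF aE(2) Kf] Gcl by auto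
    have sub: "insert a K \<subseteq> E" using flats_subset[OF Kf] aE by auto
    have "closure (insert a K) = join K G"
    proof (rule antisym)
      show "closure (insert a K) \<subseteq> join K G"
        using join_upper[OF Kf less.prems(1)] a join_flat[OF Kf less.prems(1)] by (intro closure_least) auto
      have "G \<subseteq> closure (insert a K)"
        using closure_least[of "insert a G'" "closure (insert a K)"] closure_flat[OF sub]
          subset_closure[OF sub] K Gcl by auto
      then show "join K G \<subseteq> closure (insert a K)"
        using closure_flat[OF sub] subset_closure[OF sub] by (intro closure_least) auto
    qed
    then have "mvar K * upper_sum (join K G) \<in> I"
      using mvar_mult_upper_sum_atom[OF K(1) aE(1) aK] by simp
    then show ?thesis
      using mvar_mult_upper_sum_power_join[OF K(1) less.prems(1) K(3), of 1] by simp
  qed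
  show ?case
  proof (cases "G' = F")
    case True
    then have d: "r G - r F = 1" using rG by simp
    show ?thesis
    proof (cases "F = {}")
      case True
      then have "G = closure {a}" using Gcl \<open>G' = F\<close> by simp
      then show ?thesis using d True upper_sum_atom[OF aE(1)] by (simp add: flat_var_def)
    next
      case False
      then show ?thesis
        using d Kcl[of F] F less.prems True by (simp add: flat_var_def nonempty_flats_def)
    qed
  next
    case False
    then have "F \<subset> G'" using G'f by auto
    then have IH: "flat_var F * upper_sum G' ^ (r G' - r F) \<in> I"
      using less.hyps rG G'f by auto
    have "(upper_sum G' - upper_sum G) * upper_sum G =
       (\<Sum>K | K \<in> nonempty_flats M \<and> G' \<subseteq> K \<and> \<not> G \<subseteq> K. mvar K * upper_sum G)"
      using G'f less.prems by (subst upper_sum_diff) (auto simp: sum_distrib_right)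
    also have "\<dots> \<in> I" by (rule I_sum) (simp add: Kcl)
    finally have "flat_var F * ((upper_sum G' - upper_sum G) * upper_sum G) \<in> I"
      by (rule I_mult[OF C_flat_var[OF F]])
    then have "flat_var F * upper_sum G * (upper_sum G' - upper_sum G) \<in> I"
      by (simp add: mult_ac)
    then have "flat_var F * upper_sum G * upper_sum G' ^ (r G' - r F) \<in> I \<longleftrightarrow>
      flat_var F * upper_sum G * upper_sum G ^ (r G' - r F) \<in> I"
      by (rule I_mult_power_iff) (rule C_upper_sum)+
    moreover have "flat_var F * upper_sum G * upper_sum G' ^ (r G' - r F) \<in> I"
      using I_mult[OF C_upper_sum IH, of G] by (simp add: mult_ac)
    moreover have "r G - r F = Suc (r G' - r F)"
      using rG rank_strict_mono[OF F G'f(1) \<open>F \<subset> G'\<close>] by simp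
    ultimately show ?thesis by (simp add: mult_ac)
  qed
qed

section \<open>Rewriting to basis monomials\<close>

definition fy_span :: "('a set \<Rightarrow>\<^sub>0 nat) set \<Rightarrow> 'a set mpoly_rat set" where
  "fy_span S = {p. \<exists>c. p - (\<Sum>b\<in>S. Poly_Mapping.single b (c b)) \<in> I}"

lemma fy_span_I: "p \<in> I \<Longrightarrow> p \<in> fy_span S"
  unfolding fy_span_def by (rule CollectI, rule exI[of _ "\<lambda>_. 0"]) simp

lemma fy_span_add:
  assumes "p \<in> fy_span S" "q \<in> fy_span S"
  shows "p + q \<in> fy_span S"
proof -
  obtain c d where "p - (\<Sum>b\<in>S. Poly_Mapping.single b (c b)) \<in> I" "q - (\<Sum>b\<in>S. Poly_Mapping.single b (d b)) \<in> I"
    using assms by (auto simp: fy_span_def)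
  then have "(p + q) - (\<Sum>b\<in>S. Poly_Mapping.single b (c b + d b)) \<in> I"
    using I_add by (fastforce simp: single_add sum.distrib algebra_simps)
  then show ?thesis by (auto simp: fy_span_def)
qed

lemma fy_span_sum: "(\<And>x. x \<in> A \<Longrightarrow> f x \<in> fy_span S) \<Longrightarrow> sum f A \<in> fy_span S"
  by (induction A rule: infinite_finite_induct) (auto simp: fy_span_add intro: fy_span_I[OF I_zero])

lemma fy_span_base: "finite S \<Longrightarrow> b \<in> S \<Longrightarrow> Poly_Mapping.single b a \<in> fy_span S"
proof -
  assume S: "finite S" "b \<in> S"
  have "(\<Sum>x\<in>S. Poly_Mapping.single x (if x = b then a else 0)) = (\<Sum>x\<in>{b}. Poly_Mapping.single x a)"
    using S by (intro sum.mono_neutral_cong_right) auto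
  then have "Poly_Mapping.single b a - (\<Sum>x\<in>S. Poly_Mapping.single x (if x = b then a else 0)) \<in> I"
    by (simp add: I_zero)
  then show ?thesis
    unfolding fy_span_def by (intro CollectI exI[of _ "\<lambda>x. if x = b then a else 0"])
qed

lemma fy_span_mono: "S \<subseteq> T \<Longrightarrow> finite T \<Longrightarrow> p \<in> fy_span S \<Longrightarrow> p \<in> fy_span T"
proof -
  assume ST: "S \<subseteq> T" "finite T" and "p \<in> fy_span S"
  then obtain c where c: "p - (\<Sum>b\<in>S. Poly_Mapping.single b (c b)) \<in> I" by (auto simp: fy_span_def)
  have "(\<Sum>b\<in>S. Poly_Mapping.single b (c b)) = (\<Sum>b\<in>T. Poly_Mapping.single b (if b \<in> S then c b else 0))"
    using ST by (intro sum.mono_neutral_cong_left) auto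
  then show ?thesis using c unfolding fy_span_def by auto
qed

text \<open>A monomial with incomparable flats vanishes, a basis monomial stays, and any other is
  replaced through a chain relation by terms of the same degree and strictly larger weight. The
  induction is on the distance to the maximal weight.\<close>

lemma heavy_fy_span:
  "p \<in> heavy k w \<Longrightarrow> p \<in> fy_span {m. fy_monomial {} m \<and> monomial_degree m = k}"
\<comment> \<open>The \<open>Suc\<close> makes the measure drop even when the rewritten monomial
  already has the maximal weight \<open>k * r E\<close>.\<close>
proof (induction "Suc (k * r E) - w" arbitrary: p w rule: less_induct)
  case less
  define S where "S = {m. fy_monomial {} m \<and> monomial_degree m = k}"
  have finS: "finite S" unfolding S_def using finite_fy by (rule rev_finite_subset) auto
  have "Poly_Mapping.single m a \<in> fy_span S" if "m \<in> Poly_Mapping.keys p" for m a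
  proof -
    have m: "Poly_Mapping.keys m \<subseteq> nonempty_flats M" "monomial_degree m = k" "w \<le> flat_weight m"
      using that less.prems by (auto simp: heavy_keys)
    show ?thesis
    proof (cases "\<exists>F\<in>Poly_Mapping.keys m. \<exists>G\<in>Poly_Mapping.keys m. \<not> F \<subseteq> G \<and> \<not> G \<subseteq> F")
      case True
      then obtain F G where FG: "F \<in> Poly_Mapping.keys m" "G \<in> Poly_Mapping.keys m" "\<not> F \<subseteq> G" "\<not> G \<subseteq> F" by blast
      define m' where "m' = m - Poly_Mapping.single F 1 - Poly_Mapping.single G 1"
      have mm: "m = m' + (Poly_Mapping.single F 1 + Poly_Mapping.single G 1)"
        using FG by (intro poly_mapping_eqI)
          (auto simp: m'_def lookup_add lookup_minus lookup_single when_def in_keys_iff)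
      have "Poly_Mapping.keys m' \<subseteq> nonempty_flats M" using m(1) by (subst (asm) mm) (simp add: keys_add_nat)
      then have "Poly_Mapping.single m' a * (mvar F * mvar G) \<in> I"
        using FG m by (intro I_mult incomparable) (auto simp: chow_poly_ring_def intro: mpoly_ring_single)
      then show ?thesis by (subst mm) (auto simp: mvar_def mult_single add_ac intro: fy_span_I)
    next
      case False
      have "above {} = nonempty_flats M" by (auto simp: above_def nonempty_flats_def)
      then have "fy_monomial {} m \<or> (\<exists>F G. (F = {} \<or> F \<in> Poly_Mapping.keys m) \<and> G \<in> Poly_Mapping.keys m \<and>
          F \<subset> G \<and> r G - r F \<le> Poly_Mapping.lookup m G)"
        using False m by (intro fy_or_excess) auto
      then show ?thesis
      proof
        assume "fy_monomial {} m"
        then show ?thesis using m finS by (intro fy_span_base) (auto simp: S_def)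
      next
        assume "\<exists>F G. (F = {} \<or> F \<in> Poly_Mapping.keys m) \<and> G \<in> Poly_Mapping.keys m \<and>
          F \<subset> G \<and> r G - r F \<le> Poly_Mapping.lookup m G"
        then obtain F G where FG: "F = {} \<or> F \<in> Poly_Mapping.keys m" "G \<in> Poly_Mapping.keys m"
          "F \<subset> G" "r G - r F \<le> Poly_Mapping.lookup m G" by blast
        have Gf: "G \<in> nonempty_flats M" "G \<in> flats M" and Ff: "F \<in> flats M"
          using FG m empty_flat by (auto simp: nonempty_flats_def)
        define d where "d = r G - r F"
        define e where "e = (if F = {} then 0 else Poly_Mapping.single F (1::nat))"
        define m' where "m' = m - Poly_Mapping.single G d - e"
        have mm: "m = m' + e + Poly_Mapping.single G d"
          using FG by (intro poly_mapping_eqI)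
            (auto simp: m'_def e_def d_def lookup_add lookup_minus lookup_single when_def in_keys_iff)
        have km': "Poly_Mapping.keys m' \<subseteq> nonempty_flats M" "Poly_Mapping.keys e \<subseteq> nonempty_flats M"
          using m(1) by (subst (asm) mm, simp add: keys_add_nat)+
        have e: "Poly_Mapping.single e 1 = flat_var F" by (simp add: e_def flat_var_def mvar_def)
        \<comment> \<open>The power of \<open>upper_sum G\<close> without its term
          \<open>mvar G ^ d\<close>. Each remaining term has a factor from a flat strictly above
          \<open>G\<close>, and this raises the weight.\<close>
        define z where "z = (\<Sum>i<d. of_nat (d choose i) * mvar G ^ i * (\<Sum>K\<in>above G. mvar K) ^ (d - i))"
        have z: "upper_sum G ^ d = z + mvar G ^ d"
          unfolding upper_sum_proper[OF Gf(1)] binomial_ring z_def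
          by (simp flip: lessThan_Suc_atMost)
        have "mvar G ^ d = Poly_Mapping.single (Poly_Mapping.single G d) 1"
          by (induction d) (auto simp: mvar_def mult_single simp flip: single_add)
        then have "Poly_Mapping.single m a = Poly_Mapping.single m' a * flat_var F * mvar G ^ d"
          by (subst mm) (simp add: mult_single flip: e)
        also have "\<dots> = Poly_Mapping.single m' a * (flat_var F * upper_sum G ^ d)
           + - (Poly_Mapping.single m' a * flat_var F * z)"
          by (simp add: z algebra_simps)
        also have "\<dots> \<in> fy_span S"
        proof (rule fy_span_add)
          have "flat_var F * upper_sum G ^ d \<in> I"
            unfolding d_def by (rule chain_relation[OF Ff Gf(2) FG(3)])
          then show "Poly_Mapping.single m' a * (flat_var F * upper_sum G ^ d) \<in> fy_span S"
            using km' by (intro fy_span_I I_mult[of "Poly_Mapping.single m' a"])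
              (auto simp: chow_poly_ring_def intro: mpoly_ring_single)
          have "z \<in> heavy d (d * r G + 1)"
            unfolding z_def
          proof (rule heavy_sum)
            fix i assume i: "i \<in> {..<d}"
            have "(\<Sum>K\<in>above G. mvar K) \<in> heavy 1 (Suc (r G))"
            proof (rule heavy_sum)
              fix K assume "K \<in> above G"
              then have "K \<in> nonempty_flats M" "r G < r K"
                using above_nonempty_flats rank_strict_mono[OF Gf(2)] by (auto simp: above_def)
              then show "mvar K \<in> heavy 1 (Suc (r G))"
                by (intro heavy_mono[OF heavy_mvar]) auto
            qed
            then have "(\<Sum>K\<in>above G. mvar K) ^ (d - i) \<in> heavy ((d - i) * 1) ((d - i) * Suc (r G))"
              by (rule heavy_power)
            moreover have "mvar G ^ i \<in> heavy (i * 1) (i * r G)"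
              by (rule heavy_power[OF heavy_mvar[OF Gf(1)]])
            ultimately have "mvar G ^ i * (\<Sum>K\<in>above G. mvar K) ^ (d - i) \<in>
               heavy (i * 1 + (d - i) * 1) (i * r G + (d - i) * Suc (r G))"
              by (intro heavy_mult)
            moreover have "i * 1 + (d - i) * 1 = d" using i by simp
            moreover have "d * r G + 1 \<le> i * r G + (d - i) * Suc (r G)"
            proof -
              obtain j where "d = i + Suc j" using i by (auto dest: less_imp_Suc_add)
              then show ?thesis by (simp add: algebra_simps)
            qed
            ultimately have "mvar G ^ i * (\<Sum>K\<in>above G. mvar K) ^ (d - i) \<in> heavy d (d * r G + 1)"
              by (auto intro: heavy_mono)
            then show "of_nat (d choose i) * mvar G ^ i * (\<Sum>K\<in>above G. mvar K) ^ (d - i) \<in> heavy d (d * r G + 1)"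
              unfolding mult.assoc by (rule heavy_of_nat_mult)
          qed
          moreover have "Poly_Mapping.single m' a * flat_var F \<in>
              heavy (monomial_degree m' + monomial_degree e) (flat_weight m' + flat_weight e)"
            unfolding e[symmetric] using km' by (intro heavy_mult heavy_single) auto
          ultimately have "Poly_Mapping.single m' a * flat_var F * z \<in>
             heavy (monomial_degree m' + monomial_degree e + d) (flat_weight m' + flat_weight e + (d * r G + 1))"
            by (rule heavy_mult[rotated])
          moreover have "monomial_degree m' + monomial_degree e + d = k"
            using m(2) by (subst (asm) mm) (simp add: monomial_degree_add)
          moreover have "flat_weight m' + flat_weight e + (d * r G + 1) = Suc (flat_weight m)"
            by (subst mm) (simp add: flat_weight_add)
          ultimately have "- (Poly_Mapping.single m' a * flat_var F * z) \<in> heavy k (Suc (flat_weight m))"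
            by (simp add: heavy_uminus)
          moreover have "flat_weight m \<le> k * r E"
            using flat_weight_le[OF m(1)] m(2) by simp
          ultimately show "- (Poly_Mapping.single m' a * flat_var F * z) \<in> fy_span S"
            unfolding S_def using m(3) by (intro less.hyps) auto
        qed
        finally show ?thesis .
      qed
    qed
  qed
  then have "(\<Sum>m\<in>Poly_Mapping.keys p. Poly_Mapping.single m (Poly_Mapping.lookup p m)) \<in> fy_span S"
    by (intro fy_span_sum)
  then show ?case by (simp add: mpoly_expand S_def)
qed

lemma homogeneous_fy_span:
  "\<lbrakk>p \<in> carrier (chow_poly_ring M); homogeneous k p\<rbrakk> \<Longrightarrow> p \<in> fy_span {m. fy_monomial {} m \<and> monomial_degree m = k}"
  by (rule heavy_fy_span[of _ _ 0]) (auto simp: heavy_def homogeneous_def)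

lemma carrier_fy_span:
  assumes p: "p \<in> carrier (chow_poly_ring M)"
  shows "p \<in> fy_span {m. fy_monomial {} m}"
proof -
  have "(\<Sum>m\<in>Poly_Mapping.keys p. Poly_Mapping.single m (Poly_Mapping.lookup p m)) \<in> fy_span {m. fy_monomial {} m}"
  proof (rule fy_span_sum)
    fix m assume "m \<in> Poly_Mapping.keys p"
    then have "Poly_Mapping.single m (Poly_Mapping.lookup p m) \<in> fy_span {b. fy_monomial {} b \<and> monomial_degree b = monomial_degree m}"
      using p by (intro homogeneous_fy_span)
        (auto simp: homogeneous_def chow_poly_ring_def mpoly_ring_simps)
    then show "Poly_Mapping.single m (Poly_Mapping.lookup p m) \<in> fy_span {m. fy_monomial {} m}"
      by (rule fy_span_mono[rotated 2]) (auto simp: finite_fy)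
  qed
  then show ?thesis by (simp add: mpoly_expand)
qed

end

section \<open>Dimensions\<close>

lemma mpoly_ring_cring: "cring (mpoly_ring V)"
proof -
  interpret relative_ideal "carrier (mpoly_ring V)" "{0}"
    by (rule mpoly_ring_relative_ideal) auto
  show ?thesis
  proof (intro cringI abelian_groupI comm_monoidI)
    fix x assume "x \<in> carrier (mpoly_ring V)"
    then show "\<exists>y\<in>carrier (mpoly_ring V). y \<oplus>\<^bsub>mpoly_ring V\<^esub> x = \<zero>\<^bsub>mpoly_ring V\<^esub>"
      by (intro bexI[of _ "- x"]) (auto simp: mpoly_ring_simps(2-) C_uminus)
  qed (auto simp: mpoly_ring_simps(2-) C_add C_mult C_zero C_one algebra_simps)
qed

lemma mpoly_ring_uminus: "p \<in> carrier (mpoly_ring V) \<Longrightarrow> \<ominus>\<^bsub>mpoly_ring V\<^esub> p = - p"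
proof -
  assume p: "p \<in> carrier (mpoly_ring V)"
  interpret cring "mpoly_ring V" by (rule mpoly_ring_cring)
  have "- p \<in> carrier (mpoly_ring V)" using p by (auto simp: mpoly_ring_simps)
  then have "\<ominus>\<^bsub>mpoly_ring V\<^esub> (- p) = p"
    using p by (intro minus_equality) (auto simp: mpoly_ring_simps(2-))
  then show ?thesis using \<open>- p \<in> _\<close> minus_minus by metis
qed

text \<open>An additive map between rational vector spaces is linear, which is why the functionals
  were only required to be additive.\<close>

lemma additive_single:
  fixes l :: "'v mpoly_rat \<Rightarrow> rat"
  assumes l: "additive l"
  shows "l (Poly_Mapping.single m c) = c * l (Poly_Mapping.single m 1)"
proof -
  have nat: "l (Poly_Mapping.single m (of_nat n * x)) = of_nat n * l (Poly_Mapping.single m x)" for n x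
    using additive_of_nat_mult[of l n "Poly_Mapping.single m x", OF additive.add[OF l]]
    by (simp add: of_nat_single mult_single del: single_of_nat)
  have int: "l (Poly_Mapping.single m (of_int k)) = of_int k * l (Poly_Mapping.single m 1)" for k
  proof (cases k)
    case (nonneg n)
    then show ?thesis using nat[of n 1] by simp
  next
    case (neg n)
    have "l (Poly_Mapping.single m (- (of_nat (Suc n) * 1))) = - (of_nat (Suc n) * l (Poly_Mapping.single m 1))"
      by (simp only: single_uminus additive.minus[OF l] nat)
    moreover have "(of_int k :: rat) = - of_nat (Suc n)" using neg by simp
    ultimately show ?thesis by (simp only: mult_1_right mult_minus_left)
  qed
  obtain a b where c: "c = of_int a / of_int b" "b > 0"
    by (cases c) (auto simp: Fract_of_int_quotient)
  have "of_int b * l (Poly_Mapping.single m c) = l (Poly_Mapping.single m (of_int b * c))"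
    using nat[of "nat b" c] c(2) by simp
  also have "\<dots> = of_int a * l (Poly_Mapping.single m 1)"
    using int[of a] c by simp
  finally show ?thesis using c(2) by (simp add: c(1) field_simps)
qed

context loopless_matroid
begin

lemma chow_poly_ring_cring: "cring (chow_poly_ring M)"
  unfolding chow_poly_ring_def by (rule mpoly_ring_cring)

lemma chow_relations_subset: "chow_relations M \<subseteq> carrier (chow_poly_ring M)"
proof -
  interpret relative_ideal "carrier (mpoly_ring (nonempty_flats M))" "{0}"
    by (rule mpoly_ring_relative_ideal) auto
  show ?thesis
    unfolding chow_relations_def chow_poly_ring_def
    by (auto intro!: C_mult C_sum mpoly_ring_mvar)
qed

lemma chow_ideal_ideal: "ideal (chow_ideal M) (chow_poly_ring M)"
  unfolding chow_ideal_def
  by (rule ring.genideal_ideal[OF cring.axioms(1)[OF chow_poly_ring_cring] chow_relations_subset])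

lemma chow_poly_ring_simps:
  "(\<otimes>\<^bsub>chow_poly_ring M\<^esub>) = (*)" "\<one>\<^bsub>chow_poly_ring M\<^esub> = 1" "\<zero>\<^bsub>chow_poly_ring M\<^esub> = 0"
  "(\<oplus>\<^bsub>chow_poly_ring M\<^esub>) = (+)"
  by (simp_all add: chow_poly_ring_def mpoly_ring_simps)

lemma chow_relation_ideal: "chow_relation_ideal M (chow_ideal M)"
proof -
  interpret ideal "chow_ideal M" "chow_poly_ring M" by (rule chow_ideal_ideal)
  interpret relative_ideal "carrier (chow_poly_ring M)" "chow_ideal M"
    unfolding chow_poly_ring_def
  proof (rule mpoly_ring_relative_ideal)
    show "0 \<in> chow_ideal M"
      using additive_subgroup.zero_closed[OF ideal.axioms(1)[OF chow_ideal_ideal]]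
      by (simp add: chow_poly_ring_simps)
    show "a + b \<in> chow_ideal M" if "a \<in> chow_ideal M" "b \<in> chow_ideal M" for a b
      using additive_subgroup.a_closed[OF ideal.axioms(1)[OF chow_ideal_ideal] that]
      by (simp add: chow_poly_ring_simps)
    show "c * a \<in> chow_ideal M" if "c \<in> carrier (mpoly_ring (nonempty_flats M))" "a \<in> chow_ideal M" for c a
      using I_l_closed[OF that(2), of c] that(1) by (simp add: chow_poly_ring_def mpoly_ring_simps(2-))
  qed
  have rel: "chow_relations M \<subseteq> chow_ideal M"
    unfolding chow_ideal_def
    by (rule ring.genideal_self[OF cring.axioms(1)[OF chow_poly_ring_cring] chow_relations_subset])
  show ?thesis
  proof
    show "mvar G \<in> carrier (chow_poly_ring M)" if "G \<in> nonempty_flats M" for G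
      using that by (simp add: chow_poly_ring_def mpoly_ring_mvar)
    show "mvar F * mvar G \<in> chow_ideal M"
      if "F \<in> nonempty_flats M" "G \<in> nonempty_flats M" "\<not> F \<subseteq> G" "\<not> G \<subseteq> F" for F G
      using that by (intro subsetD[OF rel]) (auto simp: chow_relations_def)
    show "(\<Sum>F \<in> {F \<in> nonempty_flats M. a \<in> F}. mvar F) \<in> chow_ideal M" if "a \<in> E" for a
      using that by (intro subsetD[OF rel]) (auto simp: chow_relations_def)
  qed
qed

text \<open>Links the two presentations: the generators of the Chow ideal are among the relations
  for all flats above \<open>{}\<close>. The kernel is cut down to the polynomial subring, where the
  ideal is generated.\<close>

lemma chow_ideal_kernel:
  assumes l: "additive l" and sub: "upset_relations {} (above {}) \<subseteq> kernel_ideal l"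
  shows "chow_ideal M \<subseteq> kernel_ideal l"
proof -
  let ?R = "chow_poly_ring M"
  interpret R: cring ?R by (rule chow_poly_ring_cring)
  interpret K: relative_ideal UNIV "kernel_ideal l" by (rule kernel_ideal[OF l])
  have ab: "above {} = nonempty_flats M" by (auto simp: above_def nonempty_flats_def)
  have uminus: "\<ominus>\<^bsub>?R\<^esub> p = - p" if "p \<in> carrier ?R" for p
    using that unfolding chow_poly_ring_def by (rule mpoly_ring_uminus)
  have "ideal (carrier ?R \<inter> kernel_ideal l) ?R"
  proof (rule idealI[OF R.ring_axioms])
    show "subgroup (carrier ?R \<inter> kernel_ideal l) (add_monoid ?R)"
    proof (rule R.add.subgroupI)
      show "\<ominus>\<^bsub>?R\<^esub> a \<in> carrier ?R \<inter> kernel_ideal l" if a: "a \<in> carrier ?R \<inter> kernel_ideal l" for a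
        using R.a_inv_closed[of a] a K.I_uminus[of a] by (auto simp: uminus)
      show "a \<oplus>\<^bsub>?R\<^esub> b \<in> carrier ?R \<inter> kernel_ideal l"
        if "a \<in> carrier ?R \<inter> kernel_ideal l" "b \<in> carrier ?R \<inter> kernel_ideal l" for a b
        using R.a_closed[of a b] that K.I_add[of a b] by (auto simp: chow_poly_ring_simps)
      have "0 \<in> carrier ?R \<inter> kernel_ideal l"
        using R.zero_closed K.I_zero by (simp add: chow_poly_ring_simps)
      then show "carrier ?R \<inter> kernel_ideal l \<noteq> {}" by blast
    qed auto
    fix a x assume "a \<in> carrier ?R \<inter> kernel_ideal l" "x \<in> carrier ?R"
    then show "x \<otimes>\<^bsub>?R\<^esub> a \<in> carrier ?R \<inter> kernel_ideal l" "a \<otimes>\<^bsub>?R\<^esub> x \<in> carrier ?R \<inter> kernel_ideal l"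
      using R.m_closed[of x a] R.m_closed[of a x] K.I_mult[of x a]
      by (auto simp: chow_poly_ring_simps mult.commute)
  qed
  moreover have "chow_relations M \<subseteq> carrier ?R \<inter> kernel_ideal l"
  proof (intro Int_greatest chow_relations_subset subsetI)
    fix p assume "p \<in> chow_relations M"
    then consider F G where "p = mvar F * mvar G" "F \<in> nonempty_flats M" "G \<in> nonempty_flats M"
        "\<not> F \<subseteq> G" "\<not> G \<subseteq> F"
      | a where "p = (\<Sum>F \<in> {F \<in> nonempty_flats M. a \<in> F}. mvar F)" "a \<in> E"
      unfolding chow_relations_def by blast
    then show "p \<in> kernel_ideal l"
    proof cases
      case 1
      then show ?thesis
        by (auto intro!: subsetD[OF sub] upset_relations.rel_incomparable simp: ab)
    next
      case 2
      then have sa: "{a} \<subseteq> E" by simp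
      have "{K. K \<in> nonempty_flats M \<and> closure {a} \<subseteq> K} = {F \<in> nonempty_flats M. a \<in> F}"
        using closure_subset_iff[OF sa] by (auto simp: nonempty_flats_def)
      \<comment> \<open>The closure of one element has rank 1, so the linear relation is its power
        relation with exponent 1.\<close>
      then have "p = upper_sum (closure {a}) ^ (r (closure {a}) - r {})"
        using 2 by (simp add: rank_singleton_closure rank_empty upper_sum_def)
      moreover have "closure {a} \<in> above {}"
        using closure_flat[OF sa] subset_closure[OF sa] by (auto simp: above_def)
      ultimately show ?thesis using sub by (auto intro: upset_relations.rel_power)
    qed
  qed
  ultimately have "chow_ideal M \<subseteq> carrier ?R \<inter> kernel_ideal l"
    unfolding chow_ideal_def by (rule R.genideal_minimal)
  then show ?thesis by blast
qed

text \<open>The functional dual to \<open>b0\<close> vanishes on the ideal and reads off the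
  coefficient.\<close>

lemma fy_coefficients_zero:
  assumes "finite S" "S \<subseteq> {m. fy_monomial {} m}"
    and "(\<Sum>b\<in>S. Poly_Mapping.single b (c b)) \<in> chow_ideal M" and "b0 \<in> S"
  shows "c b0 = 0"
proof -
  have "\<exists>l. additive l \<and> upset_relations {} (above {}) \<subseteq> kernel_ideal l \<and>
    (\<forall>m. fy_monomial {} m \<and> Poly_Mapping.keys m \<subseteq> above {} \<longrightarrow> l (Poly_Mapping.single m 1) = (if m = b0 then 1 else 0))"
    using empty_flat by (intro fy_monomials_separated) (auto simp: above_def)
  then obtain l where l: "additive l" "upset_relations {} (above {}) \<subseteq> kernel_ideal l"
    "\<And>m. fy_monomial {} m \<Longrightarrow> l (Poly_Mapping.single m 1) = (if m = b0 then 1 else 0)"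
    using fy_keys by metis
  have "(\<Sum>b\<in>S. Poly_Mapping.single b (c b)) \<in> kernel_ideal l"
    using chow_ideal_kernel[OF l(1,2)] assms(3) by blast
  then have "l (1 * (\<Sum>b\<in>S. Poly_Mapping.single b (c b))) = 0" by (simp only: kernel_ideal_def mem_Collect_eq)
  then have "(\<Sum>b\<in>S. l (Poly_Mapping.single b (c b))) = 0" by (simp add: additive.sum[OF l(1)])
  moreover have "l (Poly_Mapping.single b (c b)) = (if b = b0 then c b else 0)" if "b \<in> S" for b
    using l(3) assms(2) that by (subst additive_single[OF l(1)]) auto
  ultimately show ?thesis using assms(1,4) by simp
qed

text \<open>A general \<open>S\<close> serves the graded parts and the whole ring alike. The work is
  to pass between coefficient functions on \<open>S\<close> and the lists of scalars on which linear
  combinations are defined.\<close>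

lemma chow_dimension:
  assumes "finite S" "S \<subseteq> {m. fy_monomial {} m}"
  shows "ring.dim (chow_ring M) (chow_scalars M)
     {chow_class M (\<Sum>b\<in>S. Poly_Mapping.single b (c b)) |c. True} = card S"
proof -
  let ?R = "chow_poly_ring M" and ?Q = "chow_ring M" and ?h = "chow_class M"
  interpret R: cring ?R by (rule chow_poly_ring_cring)
  interpret I: ideal "chow_ideal M" ?R by (rule chow_ideal_ideal)
  interpret chow_relation_ideal M "chow_ideal M" by (rule chow_relation_ideal)
  have hom: "?h \<in> ring_hom ?R ?Q"
    unfolding chow_ring_def chow_class_def by (rule I.rcos_ring_hom)
  interpret Q: cring ?Q unfolding chow_ring_def by (rule I.quotient_is_cring[OF R.cring_axioms])
  interpret h: ring_hom_ring ?R ?Q ?h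
    by (rule ring_hom_ringI2[OF R.ring_axioms Q.ring_axioms hom])
  have h_zero_iff: "?h p = \<zero>\<^bsub>?Q\<^esub> \<longleftrightarrow> p \<in> chow_ideal M" if "p \<in> carrier ?R" for p
    using that I.rcos_const_imp_mem[of p] I.a_rcos_const[of p]
    by (auto simp: chow_class_def chow_ring_def FactRing_def)
  have const: "mconst a \<in> carrier ?R" for a
    by (auto simp: mconst_def chow_poly_ring_def intro: mpoly_ring_single)
  have single: "Poly_Mapping.single b a \<in> carrier ?R" if "fy_monomial {} b" for a b
    using fy_keys[OF that] above_nonempty_flats
    by (auto simp: chow_poly_ring_def intro!: mpoly_ring_single)
  \<comment> \<open>The monomial 1 belongs to the empty chain, hence the Chow ring is nonzero; this
    makes the image of the rationals a field.\<close>
  have one: "1 \<notin> chow_ideal M"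
    using fy_coefficients_zero[of "{0}" "\<lambda>_. 1" 0] by (auto simp: fy_one)
  have K: "subfield (chow_scalars M) ?Q"
  proof -
    have "subfield (range mconst) ?R"
    proof (rule R.subfieldI)
      show "subcring (range mconst) ?R"
      proof (rule R.subcringI', rule R.subringI)
        show "range mconst \<subseteq> carrier ?R" using const by auto
        show "\<one>\<^bsub>?R\<^esub> \<in> range mconst"
          by (auto simp: chow_poly_ring_simps mconst_def image_iff intro!: exI[of _ 1])
        show "\<ominus>\<^bsub>?R\<^esub> x \<in> range mconst" if x: "x \<in> range mconst" for x
        proof -
          obtain a where a: "x = mconst a" using x by auto
          have "\<ominus>\<^bsub>?R\<^esub> x = - x" using const[of a] a unfolding chow_poly_ring_def by (auto intro: mpoly_ring_uminus)
          also have "\<dots> = mconst (- a)" by (simp add: a mconst_def single_uminus)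
          finally show ?thesis by simp
        qed
        show "x \<otimes>\<^bsub>?R\<^esub> y \<in> range mconst" if "x \<in> range mconst" "y \<in> range mconst" for x y
          using that by (auto simp: chow_poly_ring_simps mconst_def mult_single)
        show "x \<oplus>\<^bsub>?R\<^esub> y \<in> range mconst" if "x \<in> range mconst" "y \<in> range mconst" for x y
          using that by (auto simp: chow_poly_ring_simps mconst_def simp flip: single_add)
      qed
      show "Units (?R\<lparr>carrier := range mconst\<rparr>) = range mconst - {\<zero>\<^bsub>?R\<^esub>}"
      proof (intro equalityI subsetI)
        fix x assume "x \<in> Units (?R\<lparr>carrier := range mconst\<rparr>)"
        then obtain a b where ab: "x = mconst a" "mconst b * mconst a = (1 :: 'a set mpoly_rat)"
          by (auto simp: Units_def chow_poly_ring_simps)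
        then have "x \<noteq> 0" by auto
        then show "x \<in> range mconst - {\<zero>\<^bsub>?R\<^esub>}" using ab by (simp add: chow_poly_ring_simps)
      next
        fix x assume "x \<in> range mconst - {\<zero>\<^bsub>?R\<^esub>}"
        then obtain a where a: "x = mconst a" "x \<noteq> 0"
          by (auto simp: chow_poly_ring_simps)
        then have "a \<noteq> 0" by (auto simp: mconst_def)
        then have "mconst (1 / a) * x = 1 \<and> x * mconst (1 / a) = 1"
          using a by (simp add: mconst_def mult_single)
        then show "x \<in> Units (?R\<lparr>carrier := range mconst\<rparr>)"
          using a by (auto simp: Units_def chow_poly_ring_simps)
      qed
    qed
    moreover have "\<one>\<^bsub>?Q\<^esub> \<noteq> \<zero>\<^bsub>?Q\<^esub>"
      using h_zero_iff[of 1] h.hom_one one R.one_closed by (auto simp: chow_poly_ring_simps)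
    moreover have "chow_scalars M = ?h ` range mconst" by (auto simp: chow_scalars_def)
    ultimately show ?thesis using h.img_is_subfield(2) by simp
  qed
  obtain bs where bs: "set bs = S" "distinct bs" using finite_distinct_list[OF assms(1)] by blast
  define Us where "Us = map (\<lambda>b. ?h (Poly_Mapping.single b 1)) bs"
  have combine: "length cs = length xs \<Longrightarrow> set xs \<subseteq> S \<Longrightarrow>
     Q.combine (map (\<lambda>a. ?h (mconst a)) cs) (map (\<lambda>b. ?h (Poly_Mapping.single b 1)) xs) =
     ?h (\<Sum>(a, b)\<leftarrow>zip cs xs. Poly_Mapping.single b a) \<and>
     (\<Sum>(a, b)\<leftarrow>zip cs xs. Poly_Mapping.single b a) \<in> carrier ?R" for cs xs
  proof (induction cs xs rule: list_induct2)
    case Nil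
    then show ?case using h.hom_zero R.zero_closed by (simp add: chow_poly_ring_simps)
  next
    case (Cons a cs b xs)
    have b: "fy_monomial {} b" using Cons.prems assms by auto
    define s where "s = (\<Sum>(a, b)\<leftarrow>zip cs xs. Poly_Mapping.single b a)"
    have s: "s \<in> carrier ?R" using Cons by (simp add: s_def)
    have "?h (mconst a) \<otimes>\<^bsub>?Q\<^esub> ?h (Poly_Mapping.single b 1) = ?h (Poly_Mapping.single b a)"
      using h.hom_mult[OF const[of a] single[OF b, of 1]] by (simp add: chow_poly_ring_simps mconst_def mult_single)
    moreover have "?h (Poly_Mapping.single b a) \<oplus>\<^bsub>?Q\<^esub> ?h s = ?h (Poly_Mapping.single b a + s)"
      using h.hom_add[OF single[OF b, of a] s] by (simp add: chow_poly_ring_simps)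
    ultimately show ?case
      using Cons s R.a_closed[OF single[OF b, of a] s] by (simp add: s_def chow_poly_ring_simps)
  qed
  have sum_zip: "(\<Sum>(a, b)\<leftarrow>zip (map c bs) bs. Poly_Mapping.single b a) = (\<Sum>b\<in>S. Poly_Mapping.single b (c b))" for c
    using bs by (simp add: zip_map1 zip_same_conv_map comp_def case_prod_beta sum_list_distinct_conv_sum_set)
  have combine_S: "Q.combine (map (\<lambda>a. ?h (mconst a)) (map c bs)) Us = ?h (\<Sum>b\<in>S. Poly_Mapping.single b (c b))" for c
    unfolding Us_def using combine[of "map c bs" bs] bs by (simp only: sum_zip length_map order_refl)
  have sum_carrier: "(\<Sum>b\<in>S. Poly_Mapping.single b (c b)) \<in> carrier ?R" for c
    using assms single by (intro C_sum) auto
  \<comment> \<open>Since \<open>bs\<close> is distinct, the position of a basis element determines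
    its scalar, so a list is a coefficient function.\<close>
  have scalar_list: "\<exists>c. Ks = map (\<lambda>a. ?h (mconst a)) (map c bs)"
    if "set Ks \<subseteq> chow_scalars M" "length Ks = length bs" for Ks
  proof -
    have "\<forall>k\<in>set Ks. \<exists>a. k = ?h (mconst a)" using that by (auto simp: chow_scalars_def)
    then obtain g where g: "\<And>k. k \<in> set Ks \<Longrightarrow> k = ?h (mconst (g k))" by metis
    define c where "c b = g (the (map_of (zip bs Ks) b))" for b
    have "Ks = map (\<lambda>a. ?h (mconst a)) (map c bs)"
    proof (rule nth_equalityI)
      fix i assume i: "i < length Ks"
      then have "map_of (zip bs Ks) (bs ! i) = Some (Ks ! i)"
        using bs(2) that(2) by (intro map_of_is_SomeI) (auto simp: in_set_zip)
      then show "Ks ! i = map (\<lambda>a. ?h (mconst a)) (map c bs) ! i"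
        using g[of "Ks ! i"] i that(2) by (simp add: c_def)
    qed (use that in simp)
    then show ?thesis by blast
  qed
  have Us: "set Us \<subseteq> carrier ?Q"
    using bs assms single by (auto simp: Us_def)
  have len: "length Us = length bs" by (simp add: Us_def)
  have span: "Q.Span (chow_scalars M) Us = {?h (\<Sum>b\<in>S. Poly_Mapping.single b (c b)) |c. True}"
    unfolding Q.Span_eq_combine_set_length_version[OF K Us] len
  proof (intro equalityI subsetI)
    fix x assume "x \<in> {Q.combine Ks Us |Ks. length Ks = length bs \<and> set Ks \<subseteq> chow_scalars M}"
    then obtain Ks where Ks: "x = Q.combine Ks Us" "length Ks = length bs" "set Ks \<subseteq> chow_scalars M" by blast
    then obtain c where "Ks = map (\<lambda>a. ?h (mconst a)) (map c bs)" using scalar_list by blast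
    then show "x \<in> {?h (\<Sum>b\<in>S. Poly_Mapping.single b (c b)) |c. True}" using Ks combine_S by blast
  next
    fix x assume "x \<in> {?h (\<Sum>b\<in>S. Poly_Mapping.single b (c b)) |c. True}"
    then obtain c where "x = Q.combine (map (\<lambda>a. ?h (mconst a)) (map c bs)) Us" using combine_S by blast
    moreover have "set (map (\<lambda>a. ?h (mconst a)) (map c bs)) \<subseteq> chow_scalars M" by (auto simp: chow_scalars_def)
    ultimately show "x \<in> {Q.combine Ks Us |Ks. length Ks = length bs \<and> set Ks \<subseteq> chow_scalars M}"
      by (metis (mono_tags, lifting) length_map mem_Collect_eq)
  qed
  have ind: "Q.independent (chow_scalars M) Us"
  proof (rule ccontr)
    assume "Q.dependent (chow_scalars M) Us"
    then obtain Ks where Ks: "length Ks = length Us" "Q.combine Ks Us = \<zero>\<^bsub>?Q\<^esub>" "set Ks \<subseteq> chow_scalars M"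
      "set Ks \<noteq> {\<zero>\<^bsub>?Q\<^esub>}" "Us \<noteq> []"
      using Q.dependent_imp_non_trivial_combine[OF K Us] Q.li_Nil by metis
    then obtain c where c: "Ks = map (\<lambda>a. ?h (mconst a)) (map c bs)" using scalar_list len by metis
    have "(\<Sum>b\<in>S. Poly_Mapping.single b (c b)) \<in> chow_ideal M"
      using Ks(2) unfolding c combine_S h_zero_iff[OF sum_carrier] .
    then have "c b = 0" if "b \<in> S" for b
      using fy_coefficients_zero[OF assms _ that] by blast
    moreover have "?h (mconst 0) = \<zero>\<^bsub>?Q\<^esub>" using h.hom_zero by (simp add: mconst_def chow_poly_ring_simps)
    ultimately have "set Ks \<subseteq> {\<zero>\<^bsub>?Q\<^esub>}" using bs by (auto simp: c)
    then show False using Ks len by (metis length_0_conv set_empty subset_singletonD)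
  qed
  have "length Us = card S" using distinct_card[OF bs(2)] bs(1) len by simp
  then have "Q.dimension (card S) (chow_scalars M) {?h (\<Sum>b\<in>S. Poly_Mapping.single b (c b)) |c. True}"
    using Q.dimension_independent[OF ind] span by simp
  then show ?thesis using Q.dimI[OF K] unfolding over_def by simp
qed

section \<open>Dimensions of the graded parts and of the whole ring\<close>

lemma chow_class_eqI:
  assumes "p \<in> carrier (chow_poly_ring M)" "q \<in> carrier (chow_poly_ring M)" "p - q \<in> chow_ideal M"
  shows "chow_class M p = chow_class M q"
proof -
  interpret R: cring "chow_poly_ring M" by (rule chow_poly_ring_cring)
  have "\<ominus>\<^bsub>chow_poly_ring M\<^esub> q = - q"
    using assms(2) unfolding chow_poly_ring_def by (rule mpoly_ring_uminus)
  then have "p \<ominus>\<^bsub>chow_poly_ring M\<^esub> q = p - q"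
    by (simp add: a_minus_def chow_poly_ring_simps)
  then show ?thesis
    using R.quotient_eq_iff_same_a_r_cos[OF chow_ideal_ideal assms(1,2)] assms(3) by (simp add: chow_class_def)
qed

lemma fy_sum_carrier:
  assumes "S \<subseteq> {m. fy_monomial {} m}"
  shows "(\<Sum>b\<in>S. Poly_Mapping.single b (c b)) \<in> carrier (chow_poly_ring M)"
proof -
  interpret chow_relation_ideal M "chow_ideal M" by (rule chow_relation_ideal)
  have "Poly_Mapping.single b (c b) \<in> carrier (chow_poly_ring M)" if "b \<in> S" for b
    using fy_keys[of "{}" b] assms that above_nonempty_flats
    by (auto simp: chow_poly_ring_def intro!: mpoly_ring_single)
  then show ?thesis by (rule C_sum)
qed

theorem chow_graded_dim_eq: "chow_graded_dim M k = card {m. fy_monomial {} m \<and> monomial_degree m = k}"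
proof -
  interpret chow_relation_ideal M "chow_ideal M" by (rule chow_relation_ideal)
  let ?S = "{m. fy_monomial {} m \<and> monomial_degree m = k}"
  have S: "finite ?S" "?S \<subseteq> {m. fy_monomial {} m}"
    using finite_fy[of "{}"] by (auto intro: rev_finite_subset)
  have "chow_graded_part M k = {chow_class M (\<Sum>b\<in>?S. Poly_Mapping.single b (c b)) |c. True}"
    unfolding chow_graded_part_def
  proof (intro equalityI subsetI)
    fix x assume "x \<in> chow_class M ` {p \<in> carrier (chow_poly_ring M). homogeneous k p}"
    then obtain p where p: "x = chow_class M p" "p \<in> carrier (chow_poly_ring M)" "homogeneous k p" by blast
    then obtain c where "p - (\<Sum>b\<in>?S. Poly_Mapping.single b (c b)) \<in> chow_ideal M"
      using homogeneous_fy_span[of p k] by (auto simp: fy_span_def)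
    then show "x \<in> {chow_class M (\<Sum>b\<in>?S. Poly_Mapping.single b (c b)) |c. True}"
      using chow_class_eqI[OF p(2) fy_sum_carrier[OF S(2)]] p(1) by blast
  next
    fix x assume "x \<in> {chow_class M (\<Sum>b\<in>?S. Poly_Mapping.single b (c b)) |c. True}"
    then obtain c where c: "x = chow_class M (\<Sum>b\<in>?S. Poly_Mapping.single b (c b))" by blast
    have "homogeneous k (\<Sum>b\<in>?S. Poly_Mapping.single b (c b))"
      unfolding homogeneous_def using keys_sum[of "\<lambda>b. Poly_Mapping.single b (c b)" ?S]
      by (auto split: if_splits)
    then show "x \<in> chow_class M ` {p \<in> carrier (chow_poly_ring M). homogeneous k p}"
      using c fy_sum_carrier[OF S(2)] by blast
  qed
  then show ?thesis unfolding chow_graded_dim_def by (simp only: chow_dimension[OF S])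
qed

theorem chow_dim_eq: "chow_dim M = card {m. fy_monomial {} m}"
proof -
  interpret chow_relation_ideal M "chow_ideal M" by (rule chow_relation_ideal)
  let ?S = "{m. fy_monomial {} m}"
  have S: "finite ?S" "?S \<subseteq> {m. fy_monomial {} m}" by (simp_all add: finite_fy)
  have "carrier (chow_ring M) = {chow_class M (\<Sum>b\<in>?S. Poly_Mapping.single b (c b)) |c. True}"
  proof (intro equalityI subsetI)
    fix x assume "x \<in> carrier (chow_ring M)"
    then obtain p where p: "x = chow_class M p" "p \<in> carrier (chow_poly_ring M)"
      by (auto simp: chow_ring_def chow_class_def FactRing_def A_RCOSETS_def')
    then obtain c where "p - (\<Sum>b\<in>?S. Poly_Mapping.single b (c b)) \<in> chow_ideal M"
      using carrier_fy_span[of p] by (auto simp: fy_span_def)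
    then show "x \<in> {chow_class M (\<Sum>b\<in>?S. Poly_Mapping.single b (c b)) |c. True}"
      using chow_class_eqI[OF p(2) fy_sum_carrier[OF S(2)]] p(1) by blast
  next
    fix x assume "x \<in> {chow_class M (\<Sum>b\<in>?S. Poly_Mapping.single b (c b)) |c. True}"
    then show "x \<in> carrier (chow_ring M)"
      using fy_sum_carrier[OF S(2)] by (auto simp: chow_ring_def chow_class_def FactRing_def A_RCOSETS_def')
  qed
  then show ?thesis unfolding chow_dim_def by (simp only: chow_dimension[OF S])
qed

end

section \<open>Counting\<close>

context loopless_matroid
begin

definition fy_polynomial :: "'a set \<Rightarrow> int poly" where
  "fy_polynomial F = (\<Sum>m | fy_monomial F m. Polynomial.monom 1 (monomial_degree m))"

lemma fy_monomial_decomposition: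
  "{m. fy_monomial F m} = insert 0 ((\<lambda>(G, i, m). Poly_Mapping.single G i + m) `
     (SIGMA G:above F. SIGMA i:{1..<r G - r F}. {m. fy_monomial G m}))"
proof (intro equalityI subsetI)
  fix m assume "m \<in> {m. fy_monomial F m}"
  then have "fy_monomial F m" by simp
  then show "m \<in> insert 0 ((\<lambda>(G, i, m). Poly_Mapping.single G i + m) `
     (SIGMA G:above F. SIGMA i:{1..<r G - r F}. {m. fy_monomial G m}))"
  proof cases
    case (fy_step G i m')
    then show ?thesis by (intro insertI2 image_eqI[of _ _ "(G, i, m')"]) auto
  qed simp
qed (auto intro: fy_one fy_step)

text \<open>The first flat is recovered from the monomial: two different candidates would each lie
  strictly above the other.\<close>

lemma fy_monomial_decomposition_inj:
  "inj_on (\<lambda>(G, i, m). Poly_Mapping.single G i + m)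
     (SIGMA G:above F. SIGMA i:{1..<r G - r F}. {m. fy_monomial G m})"
proof (rule inj_onI, clarsimp)
  fix G i m G' i' m'
  assume i: "Suc 0 \<le> i" "Suc 0 \<le> i'" and m: "fy_monomial G m" "fy_monomial G' m'"
    and eq: "Poly_Mapping.single G i + m = Poly_Mapping.single G' i' + m'"
  have keys: "insert G (Poly_Mapping.keys m) = insert G' (Poly_Mapping.keys m')"
    using arg_cong[OF eq, of Poly_Mapping.keys] i by (simp add: keys_add_nat)
  have G: "G = G'"
  proof (rule ccontr)
    assume "G \<noteq> G'"
    then have "G \<in> Poly_Mapping.keys m'" "G' \<in> Poly_Mapping.keys m" using keys by auto
    then show False using fy_keys[OF m(1)] fy_keys[OF m(2)] by (auto simp: above_def)
  qed
  have "G \<notin> Poly_Mapping.keys m" "G \<notin> Poly_Mapping.keys m'"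
    using fy_keys[OF m(1)] fy_keys[OF m(2)] G by (auto simp: above_def)
  then have "i = i'"
    using arg_cong[OF eq, of "\<lambda>p. Poly_Mapping.lookup p G"] G by (simp add: lookup_add in_keys_iff)
  then show "G = G' \<and> i = i' \<and> m = m'" using eq G by simp
qed

lemma fy_polynomial_rec:
  "fy_polynomial F = 1 + (\<Sum>G\<in>above F. (\<Sum>i=1..<r G - r F. Polynomial.monom 1 i) * fy_polynomial G)"
proof -
  let ?X = "SIGMA G:above F. SIGMA i:{1..<r G - r F}. {m. fy_monomial G m}"
  let ?g = "\<lambda>(G, i, m). Poly_Mapping.single G i + m :: 'a set \<Rightarrow>\<^sub>0 nat"
  have fin: "finite ?X" by (intro finite_SigmaI) (auto simp: finite_above finite_fy)
  have "0 \<notin> ?g ` ?X"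
  proof
    assume "0 \<in> ?g ` ?X"
    then obtain G :: "'a set" and i :: nat and m where "1 \<le> i" "Poly_Mapping.single G i + m = 0" by auto
    then have "insert G (Poly_Mapping.keys m) = {}"
      using keys_add_nat[of "Poly_Mapping.single G i" m] by simp
    then show False by simp
  qed
  then have "fy_polynomial F = 1 + (\<Sum>m\<in>?g ` ?X. Polynomial.monom 1 (monomial_degree m))"
    unfolding fy_polynomial_def fy_monomial_decomposition[of F]
    using fin by simp
  also have "(\<Sum>m\<in>?g ` ?X. Polynomial.monom 1 (monomial_degree m) :: int poly) =
      (\<Sum>(G, i, m)\<in>?X. Polynomial.monom 1 i * Polynomial.monom 1 (monomial_degree m))"
    by (subst sum.reindex[OF fy_monomial_decomposition_inj])
       (auto intro!: sum.cong simp: monomial_degree_add Polynomial.mult_monom)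
  also have "\<dots> = (\<Sum>G\<in>above F. \<Sum>i=1..<r G - r F. \<Sum>m | fy_monomial G m.
      Polynomial.monom 1 i * Polynomial.monom 1 (monomial_degree m))"
    by (subst sum.Sigma) (auto simp: finite_above finite_fy sum.Sigma intro!: sum.cong)
  finally show ?thesis
    by (simp add: fy_polynomial_def sum_product)
qed

lemma chow_polynomial_eq: "chow_polynomial M = fy_polynomial {}"
proof -
  let ?S = "{m. fy_monomial {} m}"
  have "fy_polynomial {} = (\<Sum>k\<in>monomial_degree ` ?S. \<Sum>m | m \<in> ?S \<and> monomial_degree m = k.
      Polynomial.monom 1 (monomial_degree m))"
    unfolding fy_polynomial_def by (rule sum.image_gen) (rule finite_fy)
  also have "\<dots> = (\<Sum>k\<in>monomial_degree ` ?S. Polynomial.monom (int (chow_graded_dim M k)) k)"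
    by (intro sum.cong refl) (simp add: chow_graded_dim_eq of_nat_poly smult_monom)
  also have "monomial_degree ` ?S = {k. chow_graded_dim M k \<noteq> 0}"
    using finite_fy[of "{}"] by (auto simp: chow_graded_dim_eq card_eq_0_iff)
  finally show ?thesis by (simp add: chow_polynomial_def)
qed

lemma chow_dim_eq_poly: "int (chow_dim M) = poly (fy_polynomial {}) 1"
  by (simp add: chow_dim_eq fy_polynomial_def poly_sum poly_monom)

end

lemma geometric_monom_sum:
  "1 \<le> d \<Longrightarrow> [:-1, 1:] * (\<Sum>i=1..<d. Polynomial.monom 1 i) = Polynomial.monom 1 d - (Polynomial.monom 1 1 :: int poly)"
proof (induction d rule: dec_induct)
  case (step d)
  define t :: "int poly" where "t = Polynomial.monom 1 1"
  have t: "[:-1, 1:] = t - 1" "Polynomial.monom 1 (Suc d) = t * Polynomial.monom 1 d"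
    by (simp_all add: t_def monom_altdef one_pCons Polynomial.mult_monom)
  have "{1..<Suc d} = insert d {1..<d}" using step by auto
  then show ?case
    using step.IH unfolding t t_def[symmetric] by (simp add: algebra_simps)
qed simp

section \<open>Set partitions as idempotent deflationary maps\<close>

text \<open>A partition of a finite set of numbers is encoded by the map that sends each element
  to the least element of its block.\<close>

definition partition_maps :: "nat set \<Rightarrow> (nat \<Rightarrow> nat) set" where
  "partition_maps A = {f \<in> A \<rightarrow>\<^sub>E A. \<forall>i\<in>A. f i \<le> i \<and> f (f i) = f i}"

text \<open>These are the least elements of the blocks, so their number is the number of
  blocks.\<close>

definition fixpoints :: "nat set \<Rightarrow> (nat \<Rightarrow> nat) \<Rightarrow> nat set" where
  "fixpoints A f = {i \<in> A. f i = i}"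

lemma finite_partition_maps: "finite A \<Longrightarrow> finite (partition_maps A)"
  unfolding partition_maps_def by (rule finite_subset[OF _ finite_PiE[of A "\<lambda>_. A"]]) auto

text \<open>A new maximum either forms a block of its own (\<open>y = x\<close>) or joins the block
  with least element \<open>y\<close>; it never displaces an old least element.\<close>

lemma partition_maps_insert_max:
  assumes x: "\<And>i. i \<in> A \<Longrightarrow> i < x"
  shows "bij_betw (\<lambda>(f, y). f(x := y)) (SIGMA f:partition_maps A. insert x (fixpoints A f))
     (partition_maps (insert x A))"
proof (rule bij_betwI')
  have xA: "x \<notin> A" using x by blast
  fix p q
  assume p: "p \<in> (SIGMA f:partition_maps A. insert x (fixpoints A f))"
    and q: "q \<in> (SIGMA f:partition_maps A. insert x (fixpoints A f))"
  obtain f y g z where pq: "p = (f, y)" "q = (g, z)" by fastforce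
  have "f = g \<and> y = z" if "f(x := y) = g(x := z)"
  proof -
    have "f i = g i" for i
    proof (cases "i = x")
      case True
      then show ?thesis using p q pq xA by (auto simp: partition_maps_def PiE_def extensional_def)
    next
      case False
      then show ?thesis using fun_cong[OF that, of i] by simp
    qed
    then show ?thesis using fun_cong[OF that, of x] by auto
  qed
  then show "((case p of (f, y) \<Rightarrow> f(x := y)) = (case q of (f, y) \<Rightarrow> f(x := y))) = (p = q)"
    using pq by auto
next
  have xA: "x \<notin> A" using x by blast
  fix p assume p: "p \<in> (SIGMA f:partition_maps A. insert x (fixpoints A f))"
  then obtain f y where fy: "p = (f, y)" "f \<in> partition_maps A" "y = x \<or> y \<in> A \<and> f y = y"
    by (auto simp: fixpoints_def)
  then have "f(x := y) \<in> partition_maps (insert x A)"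
    using xA x by (fastforce simp: partition_maps_def PiE_def Pi_def extensional_def less_imp_le)
  then show "(case p of (f, y) \<Rightarrow> f(x := y)) \<in> partition_maps (insert x A)" by (simp add: fy)
next
  have xA: "x \<notin> A" using x by blast
  fix g assume g: "g \<in> partition_maps (insert x A)"
  define f where "f = g(x := undefined)"
  have gA: "g i \<in> A" if "i \<in> A" for i
  proof -
    have "g i \<in> insert x A" "g i \<le> i" using g that by (auto simp: partition_maps_def)
    then show ?thesis using x[OF that] by auto
  qed
  have "f \<in> partition_maps A"
    using g gA xA by (auto simp: partition_maps_def f_def PiE_def Pi_def extensional_def)
  moreover have "g x \<in> insert x (fixpoints A f)"
    using g xA by (auto simp: partition_maps_def f_def fixpoints_def)
  moreover have "g = f(x := g x)" by (auto simp: f_def)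
  ultimately show "\<exists>p\<in>SIGMA f:partition_maps A. insert x (fixpoints A f). g = (case p of (f, y) \<Rightarrow> f(x := y))"
    by (intro bexI[of _ "(f, g x)"]) auto
qed

lemma fixpoints_fun_upd:
  assumes "x \<notin> A"
  shows "fixpoints (insert x A) (f(x := y)) = (if y = x then insert x (fixpoints A f) else fixpoints A f)"
  using assms by (auto simp: fixpoints_def)

text \<open>Inserting a new maximum reproduces the Stirling recursion: one way to open a block, and
  as many ways to join one as there are fixed points.\<close>

theorem card_partition_maps:
  "finite A \<Longrightarrow> card {f \<in> partition_maps A. card (fixpoints A f) = k} = Stirling (card A) k"
proof (induction A arbitrary: k rule: finite_linorder_max_induct)
  case empty
  have "partition_maps {} = {\<lambda>_. undefined}" by (auto simp: partition_maps_def)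
  then show ?case by (cases k) (auto simp: fixpoints_def)
next
  case (insert x A)
  have xA: "x \<notin> A" using insert.hyps by blast
  have fin: "finite (fixpoints A f)" for f using insert.hyps by (simp add: fixpoints_def)
  let ?X = "SIGMA f:partition_maps A. insert x (fixpoints A f)"
  let ?h = "\<lambda>(f, y). f(x := y)"
  have bij: "bij_betw ?h ?X (partition_maps (insert x A))"
    using insert.hyps by (intro partition_maps_insert_max) auto
  let ?N = "\<lambda>j. {f \<in> partition_maps A. card (fixpoints A f) = j}"
  have "{f \<in> partition_maps (insert x A). card (fixpoints (insert x A) f) = k} =
      ?h ` {p \<in> ?X. card (fixpoints (insert x A) (?h p)) = k}"
    unfolding bij_betw_imp_surj_on[OF bij, symmetric] by (rule Compr_image_eq)
  then have "card {f \<in> partition_maps (insert x A). card (fixpoints (insert x A) f) = k} =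
      card {p \<in> ?X. card (fixpoints (insert x A) (?h p)) = k}"
    using inj_on_subset[OF bij_betw_imp_inj_on[OF bij]] by (simp add: card_image)
  also have "{p \<in> ?X. card (fixpoints (insert x A) (?h p)) = k} =
      ({f \<in> partition_maps A. Suc (card (fixpoints A f)) = k} \<times> {x}) \<union> (SIGMA f:?N k. fixpoints A f)"
  proof -
    have nx: "x \<notin> fixpoints A f" for f using xA by (simp add: fixpoints_def)
    have "(f, y) \<in> {p \<in> ?X. card (fixpoints (insert x A) (?h p)) = k} \<longleftrightarrow>
      (f, y) \<in> ({f \<in> partition_maps A. Suc (card (fixpoints A f)) = k} \<times> {x}) \<union> (SIGMA f:?N k. fixpoints A f)"
      for f y
      by (cases "y = x") (auto simp add: nx fin fixpoints_fun_upd[OF xA])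
    then show ?thesis by (intro Set.set_eqI) (simp only: split_paired_all)
  qed
  also have "card \<dots> = card {f \<in> partition_maps A. Suc (card (fixpoints A f)) = k} + k * card (?N k)"
  proof (subst card_Un_disjoint)
    show "finite (({f \<in> partition_maps A. Suc (card (fixpoints A f)) = k} \<times> {x}))"
      using finite_partition_maps[OF insert.hyps(1)] by simp
    show "finite (SIGMA f:?N k. fixpoints A f)"
      using finite_partition_maps[OF insert.hyps(1)] fin by (intro finite_SigmaI) auto
    show "({f \<in> partition_maps A. Suc (card (fixpoints A f)) = k} \<times> {x}) \<inter> (SIGMA f:?N k. fixpoints A f) = {}"
      using xA by (auto simp: fixpoints_def)
    have "card (SIGMA f:?N k. fixpoints A f) = (\<Sum>f\<in>?N k. card (fixpoints A f))"
      using finite_partition_maps[OF insert.hyps(1)] fin by (intro card_SigmaI) auto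
    also have "\<dots> = k * card (?N k)" by simp
    finally show "card (({f \<in> partition_maps A. Suc (card (fixpoints A f)) = k} \<times> {x})) +
        card (SIGMA f:?N k. fixpoints A f) =
      card {f \<in> partition_maps A. Suc (card (fixpoints A f)) = k} + k * card (?N k)"
      by (simp add: card_cartesian_product)
  qed
  also have "\<dots> = Stirling (Suc (card A)) k"
    using insert.IH by (cases k) auto
  finally show ?case using xA insert.hyps by simp
qed

text \<open>\<open>g (f i) = g i\<close> says that \<open>g\<close> is constant on the blocks of
  \<open>f\<close>.\<close>

definition coarsenings :: "nat set \<Rightarrow> (nat \<Rightarrow> nat) \<Rightarrow> (nat \<Rightarrow> nat) set" where
  "coarsenings A f = {g \<in> partition_maps A. \<forall>i\<in>A. g (f i) = g i}"

text \<open>The least element of a coarse block is also the least of the fine block containing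
  it.\<close>

lemma coarsening_absorbs:
  assumes f: "f \<in> partition_maps A" and g: "g \<in> coarsenings A f" and i: "i \<in> A"
  shows "f (g i) = g i"
proof (rule antisym)
  have gi: "g i \<in> A" using g i by (auto simp: coarsenings_def partition_maps_def)
  then show "f (g i) \<le> g i" using f by (auto simp: partition_maps_def)
  have "f (g i) \<in> A" using f gi by (auto simp: partition_maps_def)
  then have "g (f (g i)) \<le> f (g i)" using g by (auto simp: coarsenings_def partition_maps_def)
  moreover have "g (f (g i)) = g i" using g gi i by (auto simp: coarsenings_def partition_maps_def)
  ultimately show "g i \<le> f (g i)" by simp
qed

lemma fixpoints_coarsening:
  assumes f: "f \<in> partition_maps A" and g: "g \<in> coarsenings A f"
  shows "fixpoints A g = fixpoints (fixpoints A f) g"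
  using coarsening_absorbs[OF f g] by (force simp: fixpoints_def)

text \<open>Coarser partitions are partitions of the set of blocks, each block represented by its
  least element. Restriction to the fixed points and composition with \<open>f\<close> are inverse
  to each other.\<close>

lemma card_coarsenings:
  assumes A: "finite A" and f: "f \<in> partition_maps A"
  shows "card {g \<in> coarsenings A f. card (fixpoints A g) = j} = Stirling (card (fixpoints A f)) j"
proof -
  let ?B = "fixpoints A f"
  have BA: "?B \<subseteq> A" by (auto simp: fixpoints_def)
  have fB: "f i \<in> ?B" if "i \<in> A" for i using f that by (auto simp: fixpoints_def partition_maps_def)
  have "bij_betw (\<lambda>g. restrict g ?B) {g \<in> coarsenings A f. card (fixpoints A g) = j}
     {h \<in> partition_maps ?B. card (fixpoints ?B h) = j}"
  proof (rule bij_betw_byWitness[where f' = "\<lambda>h. restrict (h \<circ> f) A"])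
    have fixr: "fixpoints ?B (restrict g ?B) = fixpoints ?B g" for g by (auto simp: fixpoints_def)
    show "\<forall>g\<in>{g \<in> coarsenings A f. card (fixpoints A g) = j}. restrict (restrict g ?B \<circ> f) A = g"
    proof clarify
      fix g assume "g \<in> coarsenings A f"
      then show "restrict (restrict g ?B \<circ> f) A = g"
        using fB by (fastforce simp: coarsenings_def partition_maps_def PiE_def extensional_def)
    qed
    show "\<forall>h\<in>{h \<in> partition_maps ?B. card (fixpoints ?B h) = j}. restrict (restrict (h \<circ> f) A) ?B = h"
    proof clarify
      fix h assume "h \<in> partition_maps ?B"
      then show "restrict (restrict (h \<circ> f) A) ?B = h"
        using BA by (fastforce simp: fixpoints_def partition_maps_def PiE_def extensional_def)
    qed
    show "(\<lambda>g. restrict g ?B) ` {g \<in> coarsenings A f. card (fixpoints A g) = j}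
      \<subseteq> {h \<in> partition_maps ?B. card (fixpoints ?B h) = j}"
    proof clarify
      fix g assume g: "g \<in> coarsenings A f" and "j = card (fixpoints A g)"
      have gB: "g i \<in> ?B" if "i \<in> ?B" for i
        using coarsening_absorbs[OF f g, of i] that BA g
        by (auto simp: fixpoints_def coarsenings_def partition_maps_def)
      have "restrict g ?B \<in> partition_maps ?B"
        using g gB BA by (auto simp: coarsenings_def partition_maps_def)
      then show "restrict g ?B \<in> partition_maps ?B \<and> card (fixpoints ?B (restrict g ?B)) = card (fixpoints A g)"
        by (simp add: fixr fixpoints_coarsening[OF f g])
    qed
    show "(\<lambda>h. restrict (h \<circ> f) A) ` {h \<in> partition_maps ?B. card (fixpoints ?B h) = j}
      \<subseteq> {g \<in> coarsenings A f. card (fixpoints A g) = j}"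
    proof clarify
      fix h assume h: "h \<in> partition_maps ?B" and "j = card (fixpoints ?B h)"
      have hB: "h i \<in> ?B" "h i \<le> i" "h (h i) = h i" if "i \<in> ?B" for i
        using h that by (auto simp: partition_maps_def)
      have fh: "f (h i) = h i" "h i \<in> A" if "i \<in> ?B" for i using hB(1)[OF that] by (auto simp: fixpoints_def)
      have fA: "f i \<in> A" "f i \<le> i" "f (f i) = f i" if "i \<in> A" for i using f that by (auto simp: partition_maps_def)
      have "h (f i) \<le> i" if "i \<in> A" for i
        using order_trans[OF hB(2)[OF fB[OF that]] fA(2)[OF that]] .
      then have pm: "restrict (h \<circ> f) A \<in> partition_maps A"
        unfolding partition_maps_def using fh fB hB fA by auto
      then have co: "restrict (h \<circ> f) A \<in> coarsenings A f"
        using fA by (auto simp: coarsenings_def)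
      have "fixpoints ?B (restrict (h \<circ> f) A) = fixpoints ?B h"
        using BA by (auto simp: fixpoints_def)
      then show "restrict (h \<circ> f) A \<in> coarsenings A f \<and> card (fixpoints A (restrict (h \<circ> f) A)) = card (fixpoints ?B h)"
        using co fixpoints_coarsening[OF f co] by simp
    qed
  qed
  then have "card {g \<in> coarsenings A f. card (fixpoints A g) = j} = card {h \<in> partition_maps ?B. card (fixpoints ?B h) = j}"
    by (rule bij_betw_same_card)
  then show ?thesis using card_partition_maps[of ?B j] finite_subset[OF BA A] by simp
qed

section \<open>The braid matroid\<close>

lemma lookup_scale_functional: "Poly_Mapping.lookup (scale_functional c v) k = c * Poly_Mapping.lookup v k"
  by (simp add: scale_functional_def map.rep_eq when_def)

interpretation functional: vector_space scale_functional
  by standard (auto intro!: poly_mapping_eqI simp: lookup_scale_functional lookup_add algebra_simps)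

lemma lookup_braid_normal:
  "Poly_Mapping.lookup (braid_normal i j) k = (if k = i then 1 else 0) - (if k = j then 1 else 0)"
  by (simp add: braid_normal_def lookup_minus lookup_single when_def)

lemma braid_normal_same: "braid_normal i i = 0"
  by (simp add: braid_normal_def)

lemma braid_normal_eq_iff:
  assumes "i < j" "i' < j'"
  shows "braid_normal i j = braid_normal i' j' \<longleftrightarrow> i = i' \<and> j = j'"
proof
  assume eq: "braid_normal i j = braid_normal i' j'"
  have "(if k = i then 1 else 0) - (if k = j then 1 else 0) =
      (if k = i' then 1 else 0) - (if k = j' then 1 else (0::complex))" for k
    using arg_cong[OF eq, of "\<lambda>p. Poly_Mapping.lookup p k"] by (simp add: lookup_braid_normal)
  from this[of i] this[of j] show "i = i' \<and> j = j'"
    using assms by (auto split: if_splits)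
qed simp

lemma braid_normal_nonzero: "i < j \<Longrightarrow> braid_normal i j \<noteq> 0"
  using lookup_braid_normal[of i j i] by auto

lemma finite_braid_normals: "finite (braid_normals n)"
proof -
  have "braid_normals n \<subseteq> (\<lambda>(i, j). braid_normal i j) ` ({1..n} \<times> {1..n})"
    unfolding braid_normals_def by fastforce
  then show ?thesis by (rule finite_subset) simp
qed

section \<open>Rank in terms of linear spans\<close>

lemma braid_rank_basis:
  assumes "X \<subseteq> braid_normals n" "B \<subseteq> X" "functional.independent B" "X \<subseteq> functional.span B"
  shows "matroid_rank (braid_matroid n) X = card B"
proof -
  have finB: "finite B" by (rule finite_subset[OF subset_trans[OF assms(2,1)] finite_braid_normals])
  let ?S = "{I \<in> indep_sets (braid_matroid n). I \<subseteq> X}"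
  have S: "?S = {I. functional.independent I \<and> I \<subseteq> X}"
    using assms(1) by (auto simp: braid_matroid_def indep_sets_def)
  have "finite {I. functional.independent I \<and> I \<subseteq> X}"
    using finite_subset[OF assms(1) finite_braid_normals] by simp
  moreover have "card I \<le> card B" if "functional.independent I" "I \<subseteq> X" for I
    using functional.independent_span_bound[OF finB that(1) subset_trans[OF that(2) assms(4)]] by simp
  moreover have "B \<in> {I. functional.independent I \<and> I \<subseteq> X}" using assms by simp
  ultimately show ?thesis
    unfolding matroid_rank_def S by (intro Max_eqI) blast+
qed

lemma braid_rank_basis_exists:
  assumes "X \<subseteq> braid_normals n"
  obtains B where "B \<subseteq> X" "functional.independent B" "X \<subseteq> functional.span B"
    "functional.span B = functional.span X" "finite B" "matroid_rank (braid_matroid n) X = card B"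
proof -
  obtain B where B: "B \<subseteq> X" "functional.independent B" "X \<subseteq> functional.span B"
    using functional.maximal_independent_subset by blast
  moreover have "functional.span B = functional.span X"
    using functional.span_mono[OF B(1)] functional.span_minimal[OF B(3) functional.subspace_span] by blast
  ultimately show ?thesis
    using that braid_rank_basis[OF assms B] finite_subset[OF B(1) finite_subset[OF assms finite_braid_normals]] by blast
qed

text \<open>Reduces the rank axioms to monotonicity of the linear span.\<close>

lemma braid_rank_insert:
  assumes X: "X \<subseteq> braid_normals n" and e: "e \<in> braid_normals n"
  shows "matroid_rank (braid_matroid n) (insert e X) =
    (if e \<in> functional.span X then matroid_rank (braid_matroid n) X else Suc (matroid_rank (braid_matroid n) X))"
proof -
  obtain B where B: "B \<subseteq> X" "functional.independent B" "X \<subseteq> functional.span B"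
    "functional.span B = functional.span X" "finite B" "matroid_rank (braid_matroid n) X = card B"
    using braid_rank_basis_exists[OF X] .
  have eX: "insert e X \<subseteq> braid_normals n" using X e by simp
  show ?thesis
  proof (cases "e \<in> functional.span X")
    case True
    then have "matroid_rank (braid_matroid n) (insert e X) = card B"
      using B by (intro braid_rank_basis[OF eX]) auto
    then show ?thesis using True B by simp
  next
    case False
    then have "functional.independent (insert e B)"
      using B by (simp add: functional.independent_insert)
    moreover have "insert e X \<subseteq> functional.span (insert e B)"
      using B(3) functional.span_mono[of B "insert e B"] functional.span_base[of e "insert e B"] by auto
    ultimately have "matroid_rank (braid_matroid n) (insert e X) = card (insert e B)"
      using B by (intro braid_rank_basis[OF eX]) auto
    moreover have "e \<notin> B" using False X B functional.span_base[of e X] by blast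
    ultimately show ?thesis using False B by simp
  qed
qed

lemma ground_braid: "ground (braid_matroid n) = braid_normals n"
  by (simp add: ground_def braid_matroid_def)

interpretation braid: loopless_matroid "braid_matroid n" for n
proof
  show "finite (ground (braid_matroid n))" by (simp add: ground_braid finite_braid_normals)
  show "matroid_rank (braid_matroid n) {} = 0"
    using braid_rank_basis[of "{}" n "{}"] by (simp add: functional.independent_empty)
  fix e assume e: "e \<in> ground (braid_matroid n)"
  then obtain i j where "e = braid_normal i j" "i < j"
    by (auto simp: ground_braid braid_normals_def)
  then have "e \<notin> functional.span {}" using braid_normal_nonzero by simp
  then show "matroid_rank (braid_matroid n) {e} = 1"
    using braid_rank_insert[of "{}" n e] e \<open>matroid_rank (braid_matroid n) {} = 0\<close> by (simp add: ground_braid)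
next
  fix X Y e
  assume XY: "X \<subseteq> Y" "Y \<subseteq> ground (braid_matroid n)" "e \<in> ground (braid_matroid n)"
    "matroid_rank (braid_matroid n) (insert e X) = matroid_rank (braid_matroid n) X"
  then have "e \<in> functional.span X"
    using braid_rank_insert[of X n e] by (auto simp: ground_braid split: if_splits)
  then have "e \<in> functional.span Y" using functional.span_mono XY by blast
  then show "matroid_rank (braid_matroid n) (insert e Y) = matroid_rank (braid_matroid n) Y"
    using braid_rank_insert[of Y n e] XY by (simp add: ground_braid)
qed (auto simp: ground_braid braid_rank_insert)

section \<open>Flats of the braid matroid as set partitions\<close>

lemma braid_flat_iff:
  "F \<in> flats (braid_matroid n) \<longleftrightarrow> F \<subseteq> braid_normals n \<and> (\<forall>e\<in>braid_normals n. e \<in> functional.span F \<longrightarrow> e \<in> F)"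
proof -
  have "matroid_rank (braid_matroid n) F < matroid_rank (braid_matroid n) (insert e F) \<longleftrightarrow> e \<notin> functional.span F"
    if "F \<subseteq> braid_normals n" "e \<in> braid_normals n" for e
    using braid_rank_insert[OF that] by simp
  then show ?thesis unfolding flats_def ground_braid by blast
qed

definition partition_flat :: "nat \<Rightarrow> (nat \<Rightarrow> nat) \<Rightarrow> functional set" where
  "partition_flat n f = {braid_normal i j |i j. 1 \<le> i \<and> i < j \<and> j \<le> n \<and> f i = f j}"

lemma partition_flat_subset: "partition_flat n f \<subseteq> braid_normals n"
  by (auto simp: partition_flat_def braid_normals_def)

text \<open>The functional that adds up the coefficients over a block vanishes on the span.\<close>

lemma span_partition_flat_iff:
  assumes "1 \<le> i" "i < j" "j \<le> n"
  shows "braid_normal i j \<in> functional.span (partition_flat n f) \<longleftrightarrow> f i = f j"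
proof
  define A where "A = {k \<in> {1..n}. f k = f i}"
  have A: "finite A" by (simp add: A_def)
  have eval: "(\<Sum>k\<in>A. Poly_Mapping.lookup (braid_normal a b) k) = (if a \<in> A then 1 else 0) - (if b \<in> A then 1 else 0)" for a b
    using A by (simp add: lookup_braid_normal sum_subtractf)
  assume "braid_normal i j \<in> functional.span (partition_flat n f)"
  moreover have "functional.span (partition_flat n f) \<subseteq> {v. (\<Sum>k\<in>A. Poly_Mapping.lookup v k) = 0}"
  proof (rule functional.span_minimal)
    show "partition_flat n f \<subseteq> {v. (\<Sum>k\<in>A. Poly_Mapping.lookup v k) = 0}"
      by (auto simp: partition_flat_def eval) (auto simp: A_def)
    show "functional.subspace {v. (\<Sum>k\<in>A. Poly_Mapping.lookup v k) = 0}"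
      by (rule functional.subspaceI)
         (auto simp: lookup_add lookup_scale_functional sum.distrib simp flip: sum_distrib_left)
  qed
  ultimately have "(\<Sum>k\<in>A. Poly_Mapping.lookup (braid_normal i j) k) = 0" by blast
  then show "f i = f j" using assms unfolding eval by (auto simp: A_def split: if_splits)
next
  assume "f i = f j"
  then show "braid_normal i j \<in> functional.span (partition_flat n f)"
    using assms by (intro functional.span_base) (auto simp: partition_flat_def)
qed

lemma partition_flat_flat: "partition_flat n f \<in> flats (braid_matroid n)"
  unfolding braid_flat_iff
proof (intro conjI ballI impI partition_flat_subset)
  fix e assume "e \<in> braid_normals n" "e \<in> functional.span (partition_flat n f)"
  moreover from this obtain i j where "e = braid_normal i j" "1 \<le> i" "i < j" "j \<le> n"
    by (auto simp: braid_normals_def)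
  ultimately show "e \<in> partition_flat n f"
    using span_partition_flat_iff[of i j n f] by (auto simp: partition_flat_def)
qed

text \<open>It suffices to compare each \<open>i\<close> with the least element \<open>f i\<close>
  of its block, since these pairs determine the partition.\<close>

lemma partition_flat_subset_iff:
  assumes f: "f \<in> partition_maps {1..n}" and g: "g \<in> partition_maps {1..n}"
  shows "partition_flat n f \<subseteq> partition_flat n g \<longleftrightarrow> g \<in> coarsenings {1..n} f"
proof
  assume sub: "partition_flat n f \<subseteq> partition_flat n g"
  have "g (f i) = g i" if i: "i \<in> {1..n}" for i
  proof (cases "f i = i")
    case False
    have fi: "f i \<in> {1..n}" "f i \<le> i" "f (f i) = f i"
      using f i by (auto simp: partition_maps_def)
    then have "braid_normal (f i) i \<in> partition_flat n f"
      unfolding partition_flat_def using False i by (intro CollectI exI[of _ "f i"] exI[of _ i]) auto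
    then have "braid_normal (f i) i \<in> functional.span (partition_flat n g)"
      using sub functional.span_base by blast
    then show ?thesis using span_partition_flat_iff[of "f i" i n g] fi False i by auto
  qed simp
  then show "g \<in> coarsenings {1..n} f" using g by (simp add: coarsenings_def)
next
  assume co: "g \<in> coarsenings {1..n} f"
  have "g i = g j" if "1 \<le> i" "i < j" "j \<le> n" "f i = f j" for i j
  proof -
    have "i \<in> {1..n}" "j \<in> {1..n}" using that by simp_all
    then have "g (f i) = g i" "g (f j) = g j" using co unfolding coarsenings_def by blast+
    then show ?thesis using that by simp
  qed
  then show "partition_flat n f \<subseteq> partition_flat n g" by (auto simp: partition_flat_def)
qed

text \<open>Maps that coarsen each other satisfy both \<open>f (g i) = g i\<close>, by absorption,
  and \<open>f (g i) = f i\<close>.\<close>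

lemma partition_flat_inj: "inj_on (partition_flat n) (partition_maps {1..n})"
proof (rule inj_onI)
  fix f g assume f: "f \<in> partition_maps {1..n}" and g: "g \<in> partition_maps {1..n}"
    and eq: "partition_flat n f = partition_flat n g"
  then have co: "g \<in> coarsenings {1..n} f" "f \<in> coarsenings {1..n} g"
    using partition_flat_subset_iff[OF f g] partition_flat_subset_iff[OF g f] by auto
  show "f = g"
  proof
    fix i show "f i = g i"
    proof (cases "i \<in> {1..n}")
      case True
      have "f (g i) = g i" by (rule coarsening_absorbs[OF f co(1) True])
      then show ?thesis using co(2) True by (simp add: coarsenings_def)
    next
      case False
      then show ?thesis using f g by (auto simp: partition_maps_def PiE_def extensional_def)
    qed
  qed
qed

text \<open>Lying in the span of \<open>F\<close> makes \<open>z_i - z_j\<close> an equivalence of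
  \<open>i\<close> and \<open>j\<close>, transitive because the differences telescope. The map picks
  the least element of each class, and \<open>F\<close> is recovered as it contains every normal
  vector in its span.\<close>

lemma partition_flat_surj:
  assumes F: "F \<in> flats (braid_matroid n)"
  shows "\<exists>f\<in>partition_maps {1..n}. F = partition_flat n f"
proof -
  define R where "R i j \<longleftrightarrow> i \<in> {1..n} \<and> j \<in> {1..n} \<and> braid_normal i j \<in> functional.span F" for i j
  have refl: "R i i" if "i \<in> {1..n}" for i
    using that by (simp add: R_def braid_normal_same functional.span_zero)
  have sym: "R j i" if "R i j" for i j
  proof -
    have "braid_normal j i = - braid_normal i j" by (simp add: braid_normal_def)
    then show ?thesis using that by (simp add: R_def functional.span_neg)
  qed
  have trans: "R i k" if "R i j" "R j k" for i j k
  proof -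
    have "braid_normal i k = braid_normal i j + braid_normal j k" by (simp add: braid_normal_def)
    then show ?thesis using that by (simp add: R_def functional.span_add)
  qed
  define f where "f = (\<lambda>i\<in>{1..n}. Min {j. R j i})"
  have fin: "finite {j. R j i}" for i
    by (rule finite_subset[of _ "{1..n}"]) (auto simp: R_def)
  have f_R: "R (f i) i" and f_le: "R j i \<Longrightarrow> f i \<le> j" if i: "i \<in> {1..n}" for i j
    using Min_in[OF fin[of i]] Min_le[OF fin[of i]] refl[OF i] i by (auto simp: f_def)
  have f_eq: "f i = f j \<longleftrightarrow> R i j" if ij: "i \<in> {1..n}" "j \<in> {1..n}" for i j
  proof
    assume "f i = f j"
    then show "R i j" using f_R[OF ij(1)] f_R[OF ij(2)] sym trans by metis
  next
    assume "R i j"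
    then have "{k. R k i} = {k. R k j}" using sym trans by blast
    then show "f i = f j" using ij by (simp add: f_def)
  qed
  have "f \<in> partition_maps {1..n}"
    unfolding partition_maps_def
  proof (intro CollectI conjI ballI)
    show "f \<in> {1..n} \<rightarrow>\<^sub>E {1..n}"
    proof
      fix i assume "i \<in> {1..n}"
      then show "f i \<in> {1..n}" using f_R[of i] by (simp add: R_def)
    next
      fix i assume "i \<notin> {1..n}"
      then show "f i = undefined" by (simp only: f_def restrict_apply if_False)
    qed
    fix i assume i: "i \<in> {1..n}"
    show "f i \<le> i" using f_le[OF i refl[OF i]] .
    have "f i \<in> {1..n}" using f_R[OF i] by (simp add: R_def)
    then show "f (f i) = f i" using f_eq[of "f i" i] f_R[OF i] i by simp
  qed
  moreover have "F = partition_flat n f"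
  proof (intro equalityI subsetI)
    fix e assume e: "e \<in> F"
    then obtain i j where ij: "e = braid_normal i j" "1 \<le> i" "i < j" "j \<le> n"
      using F by (auto simp: braid_flat_iff braid_normals_def)
    then have "R i j" using functional.span_base[OF e] by (simp add: R_def)
    then show "e \<in> partition_flat n f" using f_eq[of i j] ij by (auto simp: partition_flat_def)
  next
    fix e assume "e \<in> partition_flat n f"
    then obtain i j where ij: "e = braid_normal i j" "1 \<le> i" "i < j" "j \<le> n" "f i = f j"
      by (auto simp: partition_flat_def)
    then have "e \<in> functional.span F" using f_eq[of i j] by (simp add: R_def)
    then show "e \<in> F" using F ij by (auto simp: braid_flat_iff braid_normals_def)
  qed
  ultimately show ?thesis by blast
qed

text \<open>A basis consists of the functionals comparing each element with the least element of its block.\<close>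

lemma rank_partition_flat:
  assumes f: "f \<in> partition_maps {1..n}"
  shows "matroid_rank (braid_matroid n) (partition_flat n f) + card (fixpoints {1..n} f) = n"
proof -
  define N where "N = {1..n} - fixpoints {1..n} f"
  define B where "B = (\<lambda>i. braid_normal (f i) i) ` N"
  have fN: "f i \<in> {1..n}" "f i < i" "f (f i) = f i" "i \<in> {1..n}" if "i \<in> N" for i
    using f that by (auto simp: partition_maps_def N_def fixpoints_def le_less)
  have fA: "f i \<in> {1..n}" if "i \<in> {1..n}" for i using f that by (auto simp: partition_maps_def)
  have "inj_on (\<lambda>i. braid_normal (f i) i) N"
    using fN by (auto intro!: inj_onI simp: braid_normal_eq_iff)
  then have card: "card B = card N" by (simp add: B_def card_image)
  have ind: "functional.independent B"
    unfolding functional.dependent_def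
  proof
    assume "\<exists>a\<in>B. a \<in> functional.span (B - {a})"
    then obtain i where i: "i \<in> N" "braid_normal (f i) i \<in> functional.span (B - {braid_normal (f i) i})"
      by (auto simp: B_def)
    \<comment> \<open>Coordinate \<open>i\<close> occurs in no other basis vector:
      \<open>f j = i\<close> would make \<open>i\<close> a fixed point, contrary to \<open>i\<close>
      being in \<open>N\<close>.\<close>
    have "functional.span (B - {braid_normal (f i) i}) \<subseteq> {v. Poly_Mapping.lookup v i = 0}"
    proof (rule functional.span_minimal)
      show "B - {braid_normal (f i) i} \<subseteq> {v. Poly_Mapping.lookup v i = 0}"
      proof
        fix v assume v: "v \<in> B - {braid_normal (f i) i}"
        then obtain j where j: "j \<in> N" "v = braid_normal (f j) j" "j \<noteq> i" by (auto simp: B_def)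
        have "f j \<noteq> i" using fN(2,3)[OF i(1)] fN(3)[OF j(1)] by auto
        then show "v \<in> {v. Poly_Mapping.lookup v i = 0}" using j by (simp add: lookup_braid_normal)
      qed
      show "functional.subspace {v. Poly_Mapping.lookup v i = 0}"
        by (rule functional.subspaceI) (auto simp: lookup_add lookup_scale_functional)
    qed
    then have "Poly_Mapping.lookup (braid_normal (f i) i) i = 0" using i by blast
    then show False using fN(2)[OF i(1)] by (simp add: lookup_braid_normal)
  qed
  have sub: "B \<subseteq> partition_flat n f" using fN by (fastforce simp: B_def partition_flat_def)
  have inB: "braid_normal (f i) i \<in> functional.span B" if "i \<in> {1..n}" for i
  proof (cases "i \<in> N")
    case True
    then show ?thesis by (intro functional.span_base) (auto simp: B_def)
  next
    case False
    then have "f i = i" using that by (auto simp: N_def fixpoints_def)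
    then show ?thesis by (simp add: braid_normal_same functional.span_zero)
  qed
  have span: "partition_flat n f \<subseteq> functional.span B"
  proof
    fix e assume "e \<in> partition_flat n f"
    then obtain i j where ij: "e = braid_normal i j" "i \<in> {1..n}" "j \<in> {1..n}" "f i = f j"
      by (fastforce simp: partition_flat_def)
    have e: "e = braid_normal (f j) j - braid_normal (f i) i" by (simp add: ij braid_normal_def)
    show "e \<in> functional.span B"
      unfolding e by (rule functional.span_diff[OF inB[OF ij(3)] inB[OF ij(2)]])
  qed
  have "matroid_rank (braid_matroid n) (partition_flat n f) = card N"
    using braid_rank_basis[OF partition_flat_subset sub ind span] card by simp
  moreover have "card N + card (fixpoints {1..n} f) = n"
  proof -
    have "fixpoints {1..n} f \<subseteq> {1..n}" by (auto simp: fixpoints_def)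
    then show ?thesis
      using card_mono[of "{1..n}" "fixpoints {1..n} f"] by (simp add: N_def card_Diff_subset finite_subset)
  qed
  ultimately show ?thesis by simp
qed

section \<open>The recursion over coarser partitions\<close>

lemma above_partition_flat:
  assumes f: "f \<in> partition_maps {1..n}"
  shows "braid.above n (partition_flat n f) = partition_flat n ` {g \<in> coarsenings {1..n} f. g \<noteq> f}"
proof (intro equalityI subsetI)
  fix G assume "G \<in> braid.above n (partition_flat n f)"
  then have G: "G \<in> flats (braid_matroid n)" "partition_flat n f \<subset> G" by (auto simp: braid.above_def)
  then obtain g where g: "g \<in> partition_maps {1..n}" "G = partition_flat n g" using partition_flat_surj by blast
  then show "G \<in> partition_flat n ` {g \<in> coarsenings {1..n} f. g \<noteq> f}"
    using G partition_flat_subset_iff[OF f g(1)] by auto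
next
  fix G assume "G \<in> partition_flat n ` {g \<in> coarsenings {1..n} f. g \<noteq> f}"
  then obtain g where g: "g \<in> coarsenings {1..n} f" "g \<noteq> f" "G = partition_flat n g" by blast
  then have gm: "g \<in> partition_maps {1..n}" by (simp add: coarsenings_def)
  then have "partition_flat n f \<subseteq> G" "partition_flat n f \<noteq> G"
    using g partition_flat_subset_iff[OF f gm] inj_onD[OF partition_flat_inj _ f gm] by auto
  then show "G \<in> braid.above n (partition_flat n f)"
    using g partition_flat_flat by (auto simp: braid.above_def)
qed

text \<open>The sum over the exponents allowed at a flat whose rank is \<open>d\<close> above the
  previous one; for positive \<open>d\<close> it is \<open>(t^d - t) / (t - 1)\<close>.\<close>

definition chain_factor :: "nat \<Rightarrow> int poly" where
  "chain_factor d = (\<Sum>i=1..<d. Polynomial.monom 1 i)"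

text \<open>Rank differences are differences of block numbers, so the coarser partitions can be
  grouped by their number of blocks. The values on them are passed in as \<open>H\<close>, which
  allows use inside an induction.\<close>

lemma fy_polynomial_partition_flat_rec:
  assumes f: "f \<in> partition_maps {1..n}" and k: "card (fixpoints {1..n} f) = k"
    and H: "\<And>g. g \<in> partition_maps {1..n} \<Longrightarrow> card (fixpoints {1..n} g) < k \<Longrightarrow>
      braid.fy_polynomial n (partition_flat n g) = H (card (fixpoints {1..n} g))"
  shows "braid.fy_polynomial n (partition_flat n f) =
    1 + (\<Sum>j<k. of_nat (Stirling k j) * (chain_factor (k - j) * H j))"
proof -
  let ?C = "{g \<in> coarsenings {1..n} f. g \<noteq> f}"
  let ?c = "\<lambda>g. card (fixpoints {1..n} g)"
  have fin: "finite ?C"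
    by (rule finite_subset[OF _ finite_partition_maps[of "{1..n}"]]) (auto simp: coarsenings_def)
  have inj: "inj_on (partition_flat n) ?C"
    by (rule inj_on_subset[OF partition_flat_inj]) (auto simp: coarsenings_def)
  have pm: "g \<in> partition_maps {1..n}" if "g \<in> ?C" for g using that by (simp add: coarsenings_def)
  have lt: "?c g < k" if g: "g \<in> ?C" for g
  proof -
    have "partition_flat n g \<in> braid.above n (partition_flat n f)"
      using g above_partition_flat[OF f] by blast
    then have "matroid_rank (braid_matroid n) (partition_flat n f) < matroid_rank (braid_matroid n) (partition_flat n g)"
      by (intro braid.rank_strict_mono partition_flat_flat) (auto simp: braid.above_def)
    then show ?thesis using rank_partition_flat[OF f] rank_partition_flat[OF pm[OF g]] k by linarith
  qed
  have "braid.fy_polynomial n (partition_flat n f) = 1 + (\<Sum>g\<in>?C.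
     chain_factor (matroid_rank (braid_matroid n) (partition_flat n g) - matroid_rank (braid_matroid n) (partition_flat n f))
       * braid.fy_polynomial n (partition_flat n g))"
    unfolding braid.fy_polynomial_rec[of n "partition_flat n f"] above_partition_flat[OF f]
      sum.reindex[OF inj] comp_def chain_factor_def by (rule refl)
  also have "(\<Sum>g\<in>?C.
     chain_factor (matroid_rank (braid_matroid n) (partition_flat n g) - matroid_rank (braid_matroid n) (partition_flat n f))
       * braid.fy_polynomial n (partition_flat n g)) = (\<Sum>g\<in>?C. chain_factor (k - ?c g) * H (?c g))"
  proof (intro sum.cong refl)
    fix g assume g: "g \<in> ?C"
    have "matroid_rank (braid_matroid n) (partition_flat n g) - matroid_rank (braid_matroid n) (partition_flat n f) = k - ?c g"
      using rank_partition_flat[OF f] rank_partition_flat[OF pm[OF g]] lt[OF g] k by linarith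
    then show "chain_factor (matroid_rank (braid_matroid n) (partition_flat n g) - matroid_rank (braid_matroid n) (partition_flat n f))
       * braid.fy_polynomial n (partition_flat n g) = chain_factor (k - ?c g) * H (?c g)"
      using H[OF pm[OF g] lt[OF g]] by simp
  qed
  also have "\<dots> = (\<Sum>j<k. \<Sum>g | g \<in> ?C \<and> ?c g = j. chain_factor (k - ?c g) * H (?c g))"
    by (rule sum.group[symmetric]) (use fin lt in auto)
  also have "\<dots> = (\<Sum>j<k. of_nat (Stirling k j) * (chain_factor (k - j) * H j))"
  proof (intro sum.cong refl)
    fix j assume j: "j \<in> {..<k}"
    have "{g. g \<in> ?C \<and> ?c g = j} = {g \<in> coarsenings {1..n} f. ?c g = j}"
      using j k by auto
    then have "card {g. g \<in> ?C \<and> ?c g = j} = Stirling k j"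
      using card_coarsenings[OF _ f, of j] k by simp
    moreover have "(\<Sum>g | g \<in> ?C \<and> ?c g = j. chain_factor (k - ?c g) * H (?c g)) =
        (\<Sum>g | g \<in> ?C \<and> ?c g = j. chain_factor (k - j) * H j)"
      by (rule sum.cong) auto
    ultimately show "(\<Sum>g | g \<in> ?C \<and> ?c g = j. chain_factor (k - ?c g) * H (?c g)) =
       of_nat (Stirling k j) * (chain_factor (k - j) * H j)" by simp
  qed
  finally show ?thesis .
qed

lemma finest_partition: "restrict id {1..n} \<in> partition_maps {1..n}"
  "fixpoints {1..n} (restrict id {1..n}) = {1..n}" "partition_flat n (restrict id {1..n}) = {}"
  by (auto simp: partition_maps_def fixpoints_def partition_flat_def)

text \<open>The contraction by a flat with \<open>k\<close> blocks behaves like the braid matroid on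
  \<open>k\<close> elements: both sides obey one recursion that depends on \<open>k\<close> alone.
  The right side is the case of the finest partition of \<open>{1..k}\<close>.\<close>

lemma fy_polynomial_partition_flat:
  "f \<in> partition_maps {1..n} \<Longrightarrow>
    braid.fy_polynomial n (partition_flat n f) = braid.fy_polynomial (card (fixpoints {1..n} f)) {}"
proof (induction "card (fixpoints {1..n} f)" arbitrary: n f rule: less_induct)
  case less
  let ?H = "\<lambda>k. braid.fy_polynomial k {}"
  let ?k = "card (fixpoints {1..n} f)"
  have "braid.fy_polynomial n (partition_flat n f) =
      1 + (\<Sum>j<?k. of_nat (Stirling ?k j) * (chain_factor (?k - j) * ?H j))"
    using less by (intro fy_polynomial_partition_flat_rec) auto
  moreover have "braid.fy_polynomial ?k (partition_flat ?k (restrict id {1..?k})) =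
      1 + (\<Sum>j<?k. of_nat (Stirling ?k j) * (chain_factor (?k - j) * ?H j))"
    using less.hyps finest_partition by (intro fy_polynomial_partition_flat_rec) auto
  ultimately show ?case using finest_partition(3)[of ?k] by simp
qed

lemma braid_fy_polynomial_rec:
  assumes n: "1 \<le> n"
  shows "[:-1, 1:] * braid.fy_polynomial n {} = [:-1, 1:] +
      (\<Sum>k=1..<n. of_nat (Stirling n k) * (Polynomial.monom 1 (n - k) - Polynomial.monom 1 1) * braid.fy_polynomial k {})"
proof -
  have "braid.fy_polynomial n (partition_flat n (restrict id {1..n})) =
      1 + (\<Sum>j<n. of_nat (Stirling n j) * (chain_factor (n - j) * braid.fy_polynomial j {}))"
    using fy_polynomial_partition_flat finest_partition by (intro fy_polynomial_partition_flat_rec) auto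
  also have "(\<Sum>j<n. of_nat (Stirling n j) * (chain_factor (n - j) * braid.fy_polynomial j {})) =
      (\<Sum>j=1..<n. of_nat (Stirling n j) * (chain_factor (n - j) * braid.fy_polynomial j {}))"
    using n by (intro sum.mono_neutral_right) (auto simp: not_less_eq_eq Stirling_0_right)
  finally have "[:-1, 1:] * braid.fy_polynomial n {} = [:-1, 1:] +
      (\<Sum>j=1..<n. [:-1, 1:] * (of_nat (Stirling n j) * (chain_factor (n - j) * braid.fy_polynomial j {})))"
    unfolding finest_partition(3) by (simp only: distrib_left sum_distrib_left mult_1_right)
  also have "(\<Sum>j=1..<n. [:-1, 1:] * (of_nat (Stirling n j) * (chain_factor (n - j) * braid.fy_polynomial j {}))) =
      (\<Sum>k=1..<n. of_nat (Stirling n k) * (Polynomial.monom 1 (n - k) - Polynomial.monom 1 1) * braid.fy_polynomial k {})"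
  proof (intro sum.cong refl)
    fix j assume "j \<in> {1..<n}"
    then have "Polynomial.monom 1 (n - j) - Polynomial.monom 1 1 = [:-1, 1:] * chain_factor (n - j)"
      unfolding chain_factor_def by (subst geometric_monom_sum) auto
    then show "[:-1, 1:] * (of_nat (Stirling n j) * (chain_factor (n - j) * braid.fy_polynomial j {})) =
       of_nat (Stirling n j) * (Polynomial.monom 1 (n - j) - Polynomial.monom 1 1) * braid.fy_polynomial j {}"
      by (simp only: mult_ac)
  qed
  finally show ?thesis .
qed

text \<open>For \<open>n = 1\<close> there are no nonempty flats and the only basis monomial is 1,
  so the conventional values at 1 fit the general formula.\<close>

lemma H_num_eq: "1 \<le> n \<Longrightarrow> H_num n = braid.fy_polynomial n {}"
  and chi_eq: "1 \<le> n \<Longrightarrow> chi n = poly (braid.fy_polynomial n {}) 1"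
proof -
  have "braid.fy_polynomial 1 {} = 1"
  proof -
    have "braid.above 1 {} = {}" by (auto simp: braid.above_def braid_flat_iff braid_normals_def)
    then show ?thesis by (subst braid.fy_polynomial_rec) simp
  qed
  then show "1 \<le> n \<Longrightarrow> H_num n = braid.fy_polynomial n {}" "1 \<le> n \<Longrightarrow> chi n = poly (braid.fy_polynomial n {}) 1"
    by (auto simp: H_num_def chi_def braid.chow_polynomial_eq braid.chow_dim_eq_poly)
qed

theorem corollaryB:
  fixes n :: nat
  assumes "n \<ge> 2"
  shows "[:-1, 1:] * H_num n =
           (\<Sum>k=1..n-1. H_num k *
              (\<Sum>j=k..n. Polynomial.monom (signed_stirling n j * int (Stirling j k)) (j - k)))
         \<and> chi n =
           (\<Sum>k=1..n-1. chi k * int (n choose (k - 1)) * fact (n - k - 1) * (-1) ^ (n - k - 1))"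
proof -
  note transform = stirling_transform[of "\<lambda>n. braid.fy_polynomial n {}", OF braid_fy_polynomial_rec assms]
  show ?thesis
    using transform assms by (simp add: H_num_eq chi_eq)
qed

end
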